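(* \textsc{Fault-Tolerant Path} (on directed graphs) can be solved in $2^{\mathcal{O}(|U|\log |U|)}\,n^3$ time and in $2^{\mathcal{O}(q\log q)}\,m^{q}\,n^3$ time, where $n$ and $m$ are the numbers of vertices and edges of the input graph, $|U|$ is the number of vulnerable edges of the input graph, and $q$ is the minimum number of vulnerable edges in a solution.
   Context: \textsc{Fault-Tolerant Path} (FTP): the input is a directed graph $G=(V,E=S\cup U)$ whose edge set is partitioned into disjoint sets $S$ of safe edges and $U$ of vulnerable edges, an edge-weight function $w\colon E\to\mathbb{N}_{\ge 1}$, two vertices $s,t\in V$, and integers $k$ and $\ell$. The question is whether there exists a set $K\subseteq E$ of total weight at most $\ell$ (a solution) such that for every $F\subseteq K\cap U$ with $|F|\le k$, the edges of $K\setminus F$ contain a directed $s$-$t$-path. *)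

theory Defs
  imports Complex_Main "HOL-Library.Landau_Symbols" "Graph_Theory.Pair_Digraph"
begin

section \<open>The problem\<close>

text \<open>Edges are ordered pairs of vertices: there are no parallel edges (so at most \<open>n\<^sup>2\<close> edges), and
  loops are permitted. The parameters \<open>k\<close> and \<open>\<ell>\<close> are arbitrary integers.\<close>

record 'v ftp =
  graph :: "'v pair_pre_digraph"
  safe :: "('v \<times> 'v) set"
  vulnerable :: "('v \<times> 'v) set"
  weight :: "'v \<times> 'v \<Rightarrow> nat"
  source :: 'v
  target :: 'v
  faults :: int
  budget :: int

definition ftp_instance :: "'v ftp \<Rightarrow> bool" where
  "ftp_instance I \<longleftrightarrow>
     pair_fin_digraph (graph I) \<and>
     parcs (graph I) = safe I \<union> vulnerable I \<and> safe I \<inter> vulnerable I = {} \<and>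
     (\<forall>e \<in> parcs (graph I). 1 \<le> weight I e) \<and>
     source I \<in> pverts (graph I) \<and> target I \<in> pverts (graph I)"

definition has_st_path :: "'v ftp \<Rightarrow> ('v \<times> 'v) set \<Rightarrow> bool" where
  "has_st_path I A \<longleftrightarrow>
     (\<exists>p. pre_digraph.apath (with_proj \<lparr>pverts = pverts (graph I), parcs = A\<rparr>) (source I) p (target I))"

definition ftp_solution :: "'v ftp \<Rightarrow> ('v \<times> 'v) set \<Rightarrow> bool" where
  "ftp_solution I K \<longleftrightarrow>
     K \<subseteq> parcs (graph I) \<and>
     int (\<Sum>e\<in>K. weight I e) \<le> budget I \<and>
     (\<forall>F \<subseteq> K \<inter> vulnerable I. int (card F) \<le> faults I \<longrightarrow> has_st_path I (K - F))"

definition ftp_yes :: "'v ftp \<Rightarrow> bool" where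
  "ftp_yes I \<longleftrightarrow> (\<exists>K. ftp_solution I K)"

definition num_verts :: "'v ftp \<Rightarrow> nat" where
  "num_verts I = card (pverts (graph I))"

definition num_edges :: "'v ftp \<Rightarrow> nat" where
  "num_edges I = card (parcs (graph I))"

definition num_vulnerable :: "'v ftp \<Rightarrow> nat" where
  "num_vulnerable I = card (vulnerable I)"

text \<open>The minimum is undefined if there is no solution. By convention it is then the trivial upper
  bound, the number of all vulnerable edges, so that a time bound in terms of this parameter
  constrains the running time on no-instances, too.\<close>

definition min_vulnerable :: "'v ftp \<Rightarrow> nat" where
  "min_vulnerable I =
     (if ftp_yes I then LEAST j. \<exists>K. ftp_solution I K \<and> j = card (K \<inter> vulnerable I)
      else num_vulnerable I)"


section \<open>The machine model\<close>

text \<open>A random access machine with uniform cost measure, addition and subtraction being the only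
  arithmetic operations, programmed in a structured language. A program has access to finitely many
  named arrays of integer cells; a scalar variable is cell 0 of an array.\<close>

type_synonym vname = string
type_synonym store = "vname \<Rightarrow> int \<Rightarrow> int"

datatype aexp =
    Num int
  | Cell vname aexp
  | Plus aexp aexp
  | Minus aexp aexp

datatype bexp =
    Less aexp aexp
  | Not bexp
  | And bexp bexp

datatype com =
    Skip
  | Assign vname aexp aexp  \<comment> \<open>array, index, new contents\<close>
  | Seq com com
  | If bexp com com
  | While bexp com

primrec aval :: "aexp \<Rightarrow> store \<Rightarrow> int" where
  "aval (Num i) \<sigma> = i"
| "aval (Cell x a) \<sigma> = \<sigma> x (aval a \<sigma>)"
| "aval (Plus a b) \<sigma> = aval a \<sigma> + aval b \<sigma>"
| "aval (Minus a b) \<sigma> = aval a \<sigma> - aval b \<sigma>"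

primrec bval :: "bexp \<Rightarrow> store \<Rightarrow> bool" where
  "bval (Less a b) \<sigma> \<longleftrightarrow> aval a \<sigma> < aval b \<sigma>"
| "bval (Not b) \<sigma> \<longleftrightarrow> \<not> bval b \<sigma>"
| "bval (And b c) \<sigma> \<longleftrightarrow> bval b \<sigma> \<and> bval c \<sigma>"

primrec acost :: "aexp \<Rightarrow> nat" where
  "acost (Num i) = 1"
| "acost (Cell x a) = acost a + 1"
| "acost (Plus a b) = acost a + acost b + 1"
| "acost (Minus a b) = acost a + acost b + 1"

primrec bcost :: "bexp \<Rightarrow> nat" where
  "bcost (Less a b) = acost a + acost b + 1"
| "bcost (Not b) = bcost b + 1"
| "bcost (And b c) = bcost b + bcost c + 1"

text \<open>\<open>exec c \<sigma> t \<tau>\<close>: started in store \<open>\<sigma>\<close>, the program \<open>c\<close> halts after \<open>t\<close> steps in store \<open>\<tau>\<close>.\<close>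

inductive exec :: "com \<Rightarrow> store \<Rightarrow> nat \<Rightarrow> store \<Rightarrow> bool" where
  exec_Skip: "exec Skip \<sigma> 1 \<sigma>"
| exec_Assign:
    "exec (Assign x a b) \<sigma> (acost a + acost b + 1) (\<sigma>(x := (\<sigma> x)(aval a \<sigma> := aval b \<sigma>)))"
| exec_Seq: "exec c \<sigma> i \<rho> \<Longrightarrow> exec d \<rho> j \<tau> \<Longrightarrow> exec (Seq c d) \<sigma> (i + j) \<tau>"
| exec_If_True: "bval b \<sigma> \<Longrightarrow> exec c \<sigma> i \<tau> \<Longrightarrow> exec (If b c d) \<sigma> (bcost b + i + 1) \<tau>"
| exec_If_False: "\<not> bval b \<sigma> \<Longrightarrow> exec d \<sigma> i \<tau> \<Longrightarrow> exec (If b c d) \<sigma> (bcost b + i + 1) \<tau>"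
| exec_While_True:
    "bval b \<sigma> \<Longrightarrow> exec c \<sigma> i \<rho> \<Longrightarrow> exec (While b c) \<rho> j \<tau>
      \<Longrightarrow> exec (While b c) \<sigma> (bcost b + i + j + 1) \<tau>"
| exec_While_False: "\<not> bval b \<sigma> \<Longrightarrow> exec (While b c) \<sigma> (bcost b + 1) \<sigma>"

inductive_cases exec_SkipE: "exec Skip \<sigma> t \<tau>"
inductive_cases exec_AssignE: "exec (Assign x a b) \<sigma> t \<tau>"
inductive_cases exec_SeqE: "exec (Seq c d) \<sigma> t \<tau>"
inductive_cases exec_IfE: "exec (If b c d) \<sigma> t \<tau>"
inductive_cases exec_WhileE: "exec (While b c) \<sigma> t \<tau>"

lemma exec_deterministic:
  "exec c \<sigma> t \<tau> \<Longrightarrow> exec c \<sigma> t' \<tau>' \<Longrightarrow> t' = t \<and> \<tau>' = \<tau>"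
proof (induction arbitrary: t' \<tau>' rule: exec.induct)
  case exec_Skip
  then show ?case by (rule exec_SkipE) simp
next
  case exec_Assign
  then show ?case by (rule exec_AssignE) simp
next
  case (exec_Seq c \<sigma> i \<rho> d j \<tau>)
  show ?case
  proof (rule exec_SeqE[OF exec_Seq.prems], goal_cases)
    case (1 i' \<rho>' j')
    note first = exec_Seq.IH(1)[OF 1(2)]
    have "exec d \<rho> j' \<tau>'" using 1(3) first by simp
    note second = exec_Seq.IH(2)[OF this]
    show ?case using first second 1(1) by simp
  qed
next
  case exec_If_True
  show ?case
    by (rule exec_IfE[OF exec_If_True.prems])
      (use exec_If_True.hyps in \<open>auto dest!: exec_If_True.IH\<close>)
next
  case exec_If_False
  show ?case
    by (rule exec_IfE[OF exec_If_False.prems])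
      (use exec_If_False.hyps in \<open>auto dest!: exec_If_False.IH\<close>)
next
  case (exec_While_True b \<sigma> c i \<rho> j \<tau>)
  show ?case
  proof (rule exec_WhileE[OF exec_While_True.prems], goal_cases)
    case (1 i' \<rho>' j')
    note first = exec_While_True.IH(1)[OF 1(3)]
    have "exec (While b c) \<rho> j' \<tau>'" using 1(4) first by simp
    note second = exec_While_True.IH(2)[OF this]
    show ?case using first second 1(1) by simp
  next
    case 2
    then show ?case using exec_While_True.hyps by simp
  qed
next
  case exec_While_False
  show ?case
    by (rule exec_WhileE[OF exec_While_False.prems]) (use exec_While_False.hyps in simp_all)
qed


section \<open>Solving the problem within a time bound\<close>

definition scalar :: "int \<Rightarrow> int \<Rightarrow> int" where
  "scalar a = (\<lambda>i. if i = 0 then a else 0)"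

definition array :: "int list \<Rightarrow> int \<Rightarrow> int" where
  "array xs = (\<lambda>i. if 0 \<le> i \<and> i < int (length xs) then xs ! nat i else 0)"

text \<open>The input as a list of edges in arbitrary order.\<close>

definition encode :: "nat ftp \<Rightarrow> (nat \<times> nat) list \<Rightarrow> store" where
  "encode I es = (\<lambda>_ _. 0)
     (''n'' := scalar (int (num_verts I)),
      ''m'' := scalar (int (num_edges I)),
      ''tail'' := array (map (\<lambda>e. int (fst e)) es),
      ''head'' := array (map (\<lambda>e. int (snd e)) es),
      ''weight'' := array (map (\<lambda>e. int (weight I e)) es),
      ''vulnerable'' := array (map (\<lambda>e. if e \<in> vulnerable I then 1 else 0) es),
      ''s'' := scalar (int (source I)),
      ''t'' := scalar (int (target I)),
      ''k'' := scalar (faults I),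
      ''l'' := scalar (budget I))"

definition solves_ftp_in_time :: "com \<Rightarrow> (nat ftp \<Rightarrow> real) \<Rightarrow> bool" where
  "solves_ftp_in_time P T \<longleftrightarrow>
     (\<forall>I es. ftp_instance I \<and> pverts (graph I) = {..<num_verts I} \<and>
        distinct es \<and> set es = parcs (graph I) \<longrightarrow>
        (\<exists>t \<tau>. exec P (encode I es) t \<tau> \<and> \<tau> ''answer'' 0 = (if ftp_yes I then 1 else 0) \<and>
           real t \<le> T I))"

end

theory Submission
  imports Defs "HOL-Library.Multiset" "HOL-Library.Nat_Bijection"
begin

text \<open>By Menger's theorem a set \<open>K\<close> is a solution for \<open>k\<close> faults if and only if it carries an integral
  \<open>s\<close>-\<open>t\<close>-flow of value \<open>k + 1\<close> in which vulnerable edges have capacity 1 and safe edges are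
  uncapacitated. Once the set of vulnerable edges used is fixed, a cheapest support of the safe part of
  the flow can be taken to be a forest that joins the ends of these edges, \<open>s\<close> and \<open>t\<close>, and in which
  every edge is directed by the net supply of the ends on one of its sides. Such a forest is found as in
  the algorithm of Dreyfus and Wagner for Steiner trees: a table over the subsets of the ends and the
  vertices is filled by merging disjoint subsets and by relaxing along the safe edges. The
  algorithm runs in time \<open>64\<^sup>u n\<^sup>3\<close> up to a constant factor, where \<open>u\<close> is the number of
  vulnerable edges it is given. It may discard vulnerable edges, so for the first bound it is given all of
  them. For the second bound it is given all sets of vulnerable edges in the order of their size, until
  a solution is found.\<close>

section \<open>Flows and fault tolerance\<close>

text \<open>The value \<open>p\<close> of the flow enters the table only through the signs of the
  totals of groups, so the running time does not depend on \<open>k\<close>;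
  \<open>p = max 0 (k + 1)\<close> covers negative \<open>k\<close>, where no fault set is
  admissible and the zero flow will do. Subsets of ends are a sufficient state because on a forest
  the flow through an edge is forced to be the net supply of one side and need not be remembered.
  The machine shapes the rest: it neither multiplies nor handles bits, so row addresses, supplies
  and bit counts are tabulated by recurrences over the masks, and merging tries every smaller mask,
  submask or not. The \<open>2 u + 2\<close> ends have \<open>4^(u+1)\<close> masks, which gives
  \<open>16^(u+1)\<close> pairs; bounding the number of levels by another \<open>4^(u+1)\<close>
  yields the base 64. An exponent linear in \<open>u\<close> is more than the claimed
  \<open>u log u\<close> demands. In the search, size \<open>r\<close> costs \<open>m^r\<close>
  readings, and the \<open>q + 1\<close> sizes are absorbed by squaring the base. On a no-instance
  every size up to \<open>|U|\<close> is tried, which is why the convention for the undefined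
  minimum fits.\<close>

definition net :: "('v \<times> 'v) set \<Rightarrow> ('v \<times> 'v \<Rightarrow> 'a::comm_ring_1) \<Rightarrow> 'v \<Rightarrow> 'a" where
  "net E \<phi> x = (\<Sum>e\<in>E. \<phi> e * (of_bool (fst e = x) - of_bool (snd e = x)))"

text \<open>The cut formula: an edge with both ends in \<open>R\<close>, or with none, contributes
  0, so the net outflow of \<open>R\<close> is carried by the edges that cross its border.\<close>

lemma net_sum:
  assumes "finite E" "finite R"
  shows "(\<Sum>x\<in>R. net E \<phi> x) = (\<Sum>e\<in>E. \<phi> e * (of_bool (fst e \<in> R) - of_bool (snd e \<in> R)))"
proof -
  have *: "(\<Sum>x\<in>R. of_bool (a = x)) = of_bool (a \<in> R)" for a
    using assms(2) by (simp add: of_bool_def)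
  have "(\<Sum>x\<in>R. net E \<phi> x)
      = (\<Sum>e\<in>E. \<Sum>x\<in>R. \<phi> e * (of_bool (fst e = x) - of_bool (snd e = x)))"
    unfolding net_def by (rule sum.swap)
  also have "\<dots> = (\<Sum>e\<in>E. \<phi> e * (of_bool (fst e \<in> R) - of_bool (snd e \<in> R)))"
    by (simp only: sum_distrib_left[symmetric] sum_subtractf *)
  finally show ?thesis .
qed

lemma net_add: "net E (\<lambda>e. \<phi> e + \<psi> e) x = net E \<phi> x + net E \<psi> x"
  by (simp add: net_def distrib_right sum.distrib)

lemma net_scale: "net E (\<lambda>e. c * \<phi> e) x = c * net E \<phi> x"
  by (simp add: net_def sum_distrib_left mult.assoc)

lemma net_upd:
  assumes "finite E" "e \<in> E"
  shows "net E (\<phi>(e := b)) x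
    = net E \<phi> x + (b - \<phi> e) * (of_bool (fst e = x) - of_bool (snd e = x))"
  using assms unfolding net_def
  by (subst (1 2) sum.remove[OF assms]) (simp add: algebra_simps)

lemma net_cong: "(\<And>e. e \<in> E \<Longrightarrow> \<phi> e = \<psi> e) \<Longrightarrow> net E \<phi> x = net E \<psi> x"
  unfolding net_def by (rule sum.cong) auto

lemma net_superset:
  assumes "finite E'" "E \<subseteq> E'" "\<And>e. e \<in> E' - E \<Longrightarrow> \<phi> e = 0"
  shows "net E' \<phi> x = net E \<phi> x"
  unfolding net_def using assms by (intro sum.mono_neutral_right) auto

lemma net_union:
  assumes "finite A" "finite B" "A \<inter> B = {}"
  shows "net (A \<union> B) \<phi> x = net A \<phi> x + net B \<phi> x"
  unfolding net_def using assms by (rule sum.union_disjoint)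

section \<open>Menger's theorem with edges that cannot fail\<close>

definition robust :: "int \<Rightarrow> 'v \<Rightarrow> 'v \<Rightarrow> ('v \<times> 'v) set \<Rightarrow> ('v \<times> 'v) set \<Rightarrow> bool" where
  "robust k s t U K \<longleftrightarrow> (\<forall>F \<subseteq> K \<inter> U. int (card F) \<le> k \<longrightarrow> (s, t) \<in> (K - F)\<^sup>*)"

text \<open>Safe edges have no upper bound since they never fail. If \<open>s = t\<close>, the
  prescribed excess is 0 everywhere and the zero flow qualifies for every \<open>p\<close>, in
  accordance with the empty path.\<close>

definition unit_flow ::
  "int \<Rightarrow> 'v \<Rightarrow> 'v \<Rightarrow> ('v \<times> 'v) set \<Rightarrow> ('v \<times> 'v) set \<Rightarrow> ('v \<times> 'v \<Rightarrow> int) \<Rightarrow> bool" where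
  "unit_flow p s t U K \<phi> \<longleftrightarrow> (\<forall>e\<in>K. 0 \<le> \<phi> e) \<and> (\<forall>e\<in>K \<inter> U. \<phi> e \<le> 1) \<and>
     (\<forall>x. net K \<phi> x = p * (of_bool (x = s) - of_bool (x = t)))"

lemma sum_st:
  assumes "finite R" "s \<in> R" "t \<notin> R"
  shows "(\<Sum>x\<in>R. p * (of_bool (x = s) - of_bool (x = t))) = (p::int)"
proof -
  have "(\<Sum>x\<in>R. p * (of_bool (x = s) - of_bool (x = t))) = (\<Sum>x\<in>R. if x = s then p else 0)"
    using assms by (intro sum.cong) (auto simp: of_bool_def)
  then show ?thesis using assms by simp
qed

text \<open>Weak duality. Let \<open>R\<close> be the set of vertices reachable after the faults.
  Every edge of \<open>K\<close> leaving \<open>R\<close> belongs to \<open>F\<close> and carries at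
  most one unit, so \<open>p\<close> units cannot leave \<open>R\<close> when
  \<open>card F \<le> k < p\<close>.\<close>

lemma unit_flow_imp_robust:
  assumes "finite K" and flow: "unit_flow p s t U K \<phi>" and "k < p"
  shows "robust k s t U K"
  unfolding robust_def
proof (intro allI impI, rule ccontr)
  fix F assume F: "F \<subseteq> K \<inter> U" "int (card F) \<le> k" and no: "(s, t) \<notin> (K - F)\<^sup>*"
  define R where "R = (K - F)\<^sup>* `` {s}"
  have "R \<subseteq> insert s (snd ` K)"
  proof
    fix x assume "x \<in> R"
    then have "(s, x) \<in> (K - F)\<^sup>*" by (simp add: R_def)
    then show "x \<in> insert s (snd ` K)" by (cases rule: rtranclE) force+
  qed
  then have "finite R" by (rule finite_subset) (use assms in auto)
  have closed: "b \<in> R" if "(a, b) \<in> K" "(a, b) \<notin> F" "a \<in> R" for a b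
    using that by (auto simp: R_def intro: rtrancl_into_rtrancl)
  have "p = (\<Sum>x\<in>R. net K \<phi> x)"
    using sum_st[of R s t p] \<open>finite R\<close> flow no by (simp add: unit_flow_def R_def)
  also have "\<dots> = (\<Sum>e\<in>K. \<phi> e * (of_bool (fst e \<in> R) - of_bool (snd e \<in> R)))"
    using assms \<open>finite R\<close> by (rule_tac net_sum)
  also have "\<dots> \<le> (\<Sum>e\<in>K. of_bool (e \<in> F))"
  proof (rule sum_mono)
    fix e assume e: "e \<in> K"
    then have "0 \<le> \<phi> e" "e \<in> F \<Longrightarrow> \<phi> e \<le> 1" using flow F by (auto simp: unit_flow_def)
    then show "\<phi> e * (of_bool (fst e \<in> R) - of_bool (snd e \<in> R)) \<le> of_bool (e \<in> F)"
      using closed[of "fst e" "snd e"] e by (auto simp: of_bool_def)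
  qed
  also have "\<dots> = int (card F)"
  proof -
    have "K \<inter> {e. e \<in> F} = F" using F by auto
    then show ?thesis using assms(1) by (simp add: of_bool_def sum.If_cases)
  qed
  finally show False using F assms by simp
qed

text \<open>One augmentation step. The set \<open>R\<close> is a maximal set of vertices to each of which one more unit
  can be sent from \<open>s\<close> inside \<open>R\<close>, so it is closed under residual edges.\<close>

lemma robust_augment:
  assumes "finite K" and rob: "robust k s t U K" and flow: "unit_flow p s t U K \<phi>" and "p \<le> k"
  shows "\<exists>\<psi>. unit_flow (p + 1) s t U K \<psi>"
proof -
  define V where "V = insert s (fst ` K \<union> snd ` K)"
  \<comment> \<open>\<open>push y R \<delta>\<close>: the change \<open>\<delta>\<close> brings one
    more unit from \<open>s\<close> to \<open>y\<close>, is confined to edges inside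
    \<open>R\<close>, and keeps \<open>\<phi> + \<delta>\<close> within the capacities.\<close>
  define push where "push y R \<delta> \<longleftrightarrow> (\<forall>e\<in>K. \<delta> e \<noteq> 0 \<longrightarrow> fst e \<in> R \<and> snd e \<in> R) \<and>
      (\<forall>e\<in>K. 0 \<le> \<phi> e + \<delta> e) \<and> (\<forall>e\<in>K \<inter> U. \<phi> e + \<delta> e \<le> 1) \<and>
      (\<forall>x. net K \<delta> x = of_bool (x = s) - of_bool (x = y))" for y R and \<delta> :: "_ \<Rightarrow> int"
  define good where "good R \<longleftrightarrow> s \<in> R \<and> (\<forall>y\<in>R. \<exists>\<delta>. push y R \<delta>)" for R
  have "finite V" using assms by (simp add: V_def)
  have "push s {s} (\<lambda>_. 0)" using flow by (auto simp: push_def unit_flow_def net_def)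
  then have "good {s}" by (auto simp: good_def)
  then have "{R \<in> Pow V. good R} \<noteq> {}" by (auto simp: V_def)
  then obtain R where R: "R \<subseteq> V" "good R" and "\<And>R'. R' \<subseteq> V \<Longrightarrow> good R' \<Longrightarrow> R \<subseteq> R' \<Longrightarrow> R = R'"
    using finite_has_maximal[of "{R \<in> Pow V. good R}"] \<open>finite V\<close> by auto
  then have maximal: "y \<in> R" if "y \<in> V" "good (insert y R)" for y
    using that by blast
  \<comment> \<open>Both kinds of residual edges at once: \<open>d = 1\<close> sends a unit forward
    along \<open>e\<close>, \<open>d = - 1\<close> takes one back. As \<open>y\<close> lies outside
    \<open>R\<close>, the change that reaches \<open>x\<close> vanishes on \<open>e\<close> and can
    be set to \<open>d\<close> there without further effect.\<close>
  have extend: "y \<in> R"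
    if "x \<in> R" "e \<in> K" "{fst e, snd e} = {x, y}"
      and d: "\<And>z. d * (of_bool (fst e = z) - of_bool (snd e = z)) = of_bool (z = x) - of_bool (z = y)"
      and cap: "0 \<le> \<phi> e + d" "e \<in> U \<Longrightarrow> \<phi> e + d \<le> 1" for x y e and d :: int
  proof (rule ccontr)
    assume y: "y \<notin> R"
    have mono: "push z R \<delta> \<Longrightarrow> push z (insert y R) \<delta>" for z \<delta>
      unfolding push_def by simp
    obtain \<delta> where \<delta>: "push x R \<delta>" using R(2) \<open>x \<in> R\<close> unfolding good_def by blast
    have "\<not> (fst e \<in> R \<and> snd e \<in> R)" using y that(3) by (auto simp: doubleton_eq_iff)
    then have "\<delta> e = 0" using \<delta> \<open>e \<in> K\<close> unfolding push_def by blast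
    have "fst e \<in> insert y R" "snd e \<in> insert y R" using that(1,3) by (auto simp: doubleton_eq_iff)
    moreover have "net K (\<delta>(e := d)) z = of_bool (z = s) - of_bool (z = y)" for z
    proof -
      have "net K (\<delta>(e := d)) z
          = net K \<delta> z + d * (of_bool (fst e = z) - of_bool (snd e = z))"
        using net_upd[OF assms(1) \<open>e \<in> K\<close>, of \<delta> d z] \<open>\<delta> e = 0\<close> by simp
      also have "net K \<delta> z = of_bool (z = s) - of_bool (z = x)"
        using \<delta> by (simp add: push_def)
      finally show ?thesis by (simp only: d)
    qed
    ultimately have "push y (insert y R) (\<delta>(e := d))"
      using \<delta> cap unfolding push_def by simp
    then have "good (insert y R)" using R(2) mono unfolding good_def by blast
    moreover have "y \<in> V" using that(2,3) by (auto simp: V_def doubleton_eq_iff)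
    ultimately show False using maximal y by blast
  qed
  have cap: "0 \<le> \<phi> e" "e \<in> U \<Longrightarrow> \<phi> e \<le> 1" if "e \<in> K" for e
    using flow that by (auto simp: unit_flow_def)
  have out: "e \<in> U \<and> \<phi> e = 1" if "e \<in> K" "fst e \<in> R" "snd e \<notin> R" for e
  proof (rule ccontr)
    assume "\<not> (e \<in> U \<and> \<phi> e = 1)"
    then have "e \<in> U \<Longrightarrow> \<phi> e + 1 \<le> 1" using cap[of e] that by linarith
    then have "snd e \<in> R"
      using that cap[of e] by (intro extend[of "fst e" e "snd e" 1]) (auto simp: of_bool_def)
    with that show False by simp
  qed
  have into: "\<phi> e = 0" if "e \<in> K" "fst e \<notin> R" "snd e \<in> R" for e
  proof (rule ccontr)
    assume "\<phi> e \<noteq> 0"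
    then have "0 \<le> \<phi> e + (- 1)" "e \<in> U \<Longrightarrow> \<phi> e + (- 1) \<le> 1"
      using cap[of e] that by force+
    then have "fst e \<in> R"
      using that by (intro extend[of "snd e" e "fst e" "- 1"]) (auto simp: of_bool_def)
    with that show False by simp
  qed
  have "t \<in> R"
  proof (rule ccontr)
    assume t: "t \<notin> R"
    have s: "s \<in> R" and "finite R" using R \<open>finite V\<close> finite_subset by (auto simp: good_def)
    \<comment> \<open>If \<open>t\<close> were outside \<open>R\<close>, all edges leaving
      \<open>R\<close> would be saturated vulnerable edges and nothing would flow back. Hence
      \<open>card F\<close> is the value \<open>p \<le> k\<close>, so \<open>F\<close> is an
      admissible fault set, yet it cuts off \<open>t\<close>.\<close>
    define F where "F = {e \<in> K. fst e \<in> R \<and> snd e \<notin> R}"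
    have "p = (\<Sum>x\<in>R. net K \<phi> x)"
      using sum_st[OF \<open>finite R\<close> s t] flow by (simp add: unit_flow_def)
    also have "\<dots> = (\<Sum>e\<in>K. \<phi> e * (of_bool (fst e \<in> R) - of_bool (snd e \<in> R)))"
      using assms(1) \<open>finite R\<close> by (rule_tac net_sum)
    also have "\<dots> = (\<Sum>e\<in>K. of_bool (e \<in> F))"
      using out into by (intro sum.cong) (auto simp: F_def of_bool_def)
    also have "\<dots> = int (card F)"
    proof -
      have "K \<inter> {e. e \<in> F} = F" by (auto simp: F_def)
      then show ?thesis using assms(1) by (simp add: of_bool_def sum.If_cases)
    qed
    finally have "int (card F) \<le> k" using assms by simp
    moreover have "F \<subseteq> K \<inter> U" using out by (auto simp: F_def)
    ultimately have "(s, t) \<in> (K - F)\<^sup>*" using rob by (simp add: robust_def)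
    then have "t \<in> R"
      by (induction rule: rtrancl_induct) (use s in \<open>auto simp: F_def\<close>)
    with t show False by simp
  qed
  then obtain \<delta> where "push t R \<delta>" using R unfolding good_def by blast
  then have "unit_flow (p + 1) s t U K (\<lambda>e. \<phi> e + \<delta> e)"
    using flow unfolding unit_flow_def push_def by (simp add: net_add algebra_simps)
  then show ?thesis by blast
qed

text \<open>The zero flow is augmented unit by unit; as long as the value is at most
  \<open>k\<close>, one more unit fits. For negative \<open>k\<close> the zero flow is already the
  claim.\<close>

lemma robust_imp_unit_flow:
  assumes "finite K" "robust k s t U K" "int p \<le> max 0 (k + 1)"
  shows "\<exists>\<phi>. unit_flow (int p) s t U K \<phi>"
  using assms(3)
proof (induction p)
  case 0
  have "unit_flow 0 s t U K (\<lambda>_. 0)" by (simp add: unit_flow_def net_def)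
  then show ?case by auto
next
  case (Suc p)
  then have "int p \<le> max 0 (k + 1)" by simp
  then obtain \<phi> where "unit_flow (int p) s t U K \<phi>" using Suc.IH by blast
  from robust_augment[OF assms(1,2) this] Suc.prems show ?case by (auto simp: add.commute)
qed

lemma robust_iff_unit_flow:
  assumes "finite K"
  shows "robust k s t U K \<longleftrightarrow> (\<exists>\<phi>. unit_flow (max 0 (k + 1)) s t U K \<phi>)"
  using robust_imp_unit_flow[of K k s t U "nat (max 0 (k + 1))"] unit_flow_imp_robust[OF assms]
    assms by auto

section \<open>Circulations in graphs without leaves\<close>

lemma homogeneous_solution:
  fixes a :: "'q \<Rightarrow> 'e \<Rightarrow> real"
  assumes "finite Q" "finite E" "card Q < card E"
  shows "\<exists>\<psi>. (\<exists>e\<in>E. \<psi> e \<noteq> 0) \<and> (\<forall>q\<in>Q. (\<Sum>e\<in>E. a q e * \<psi> e) = 0)"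
  using assms
proof (induction Q arbitrary: a E rule: finite_induct)
  case empty
  then have "E \<noteq> {}" by auto
  then show ?case by (intro exI[of _ "\<lambda>_. 1"]) auto
next
  case (insert r Q)
  show ?case
  proof (cases "\<forall>e\<in>E. a r e = 0")
    case True
    obtain \<psi> where "\<exists>e\<in>E. \<psi> e \<noteq> 0" "\<forall>q\<in>Q. (\<Sum>e\<in>E. a q e * \<psi> e) = 0"
      using insert.IH[of E a] insert.prems insert.hyps by auto
    with True show ?thesis by (intro exI[of _ \<psi>]) auto
  next
    case False
    then obtain f where f: "f \<in> E" "a r f \<noteq> 0" by blast
    define E' where "E' = E - {f}"
    have E: "E = insert f E'" "f \<notin> E'" "finite E'" using f insert.prems by (auto simp: E'_def)
    have "card Q < card E'" using insert.prems insert.hyps E by simp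
    then obtain \<psi> where nz: "\<exists>e\<in>E'. \<psi> e \<noteq> 0"
      and \<psi>: "\<And>q. q \<in> Q \<Longrightarrow> (\<Sum>e\<in>E'. (a q e - a q f * a r e / a r f) * \<psi> e) = 0"
      using insert.IH[of E' "\<lambda>q e. a q e - a q f * a r e / a r f"] E by blast
    \<comment> \<open>Gaussian elimination: row \<open>r\<close> is solved for the unknown
      \<open>f\<close>. The induction hypothesis was applied to the other rows after substituting
      this solution into them.\<close>
    define \<psi>' where "\<psi>' = \<psi>(f := - (\<Sum>e\<in>E'. a r e * \<psi> e) / a r f)"
    have *: "(\<Sum>e\<in>E. a q e * \<psi>' e)
        = (\<Sum>e\<in>E'. a q e * \<psi> e) - a q f * (\<Sum>e\<in>E'. a r e * \<psi> e) / a r f" for q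
    proof -
      have "(\<Sum>e\<in>E'. a q e * \<psi>' e) = (\<Sum>e\<in>E'. a q e * \<psi> e)"
        using E by (intro sum.cong) (auto simp: \<psi>'_def)
      then show ?thesis using E by (simp add: \<psi>'_def)
    qed
    have "(\<Sum>e\<in>E. a q e * \<psi>' e) = 0" if "q \<in> insert r Q" for q
    proof (cases "q = r")
      case True
      then show ?thesis using f by (simp add: *)
    next
      case False
      then have "(\<Sum>e\<in>E'. (a q e - a q f * a r e / a r f) * \<psi> e) = 0" using \<psi> that by simp
      then show ?thesis
        by (simp add: * left_diff_distrib sum_subtractf sum_distrib_left sum_divide_distrib mult.assoc)
    qed
    moreover have "\<exists>e\<in>E. \<psi>' e \<noteq> 0" using nz E by (auto simp: \<psi>'_def)
    ultimately show ?thesis by blast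
  qed
qed

text \<open>Every vertex on \<open>E\<close> has degree at least 2, so double counting incidences
  gives at least as many edges as vertices. The conservation equations add up to 0, hence the one at
  \<open>x0\<close> follows from the others, and what remains has fewer equations than unknowns.
  \<open>\<psi>\<close> may take both signs: the underlying cycles need not be directed.\<close>

lemma circulation_exists:
  fixes E :: "('v \<times> 'v) set"
  assumes "finite E" "E \<noteq> {}" "\<And>e. e \<in> E \<Longrightarrow> fst e \<noteq> snd e"
    and deg: "\<And>x. x \<in> fst ` E \<union> snd ` E \<Longrightarrow> card {e \<in> E. fst e = x \<or> snd e = x} \<noteq> 1"
  shows "\<exists>\<psi> :: _ \<Rightarrow> real. (\<exists>e\<in>E. \<psi> e \<noteq> 0) \<and> (\<forall>x. net E \<psi> x = 0)"
proof -
  define W where "W = fst ` E \<union> snd ` E"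
  have "finite W" using assms by (simp add: W_def)
  obtain x0 where "x0 \<in> W" using assms by (auto simp: W_def)
  have "2 * card W = (\<Sum>x\<in>W. 2)" by simp
  also have "\<dots> \<le> (\<Sum>x\<in>W. card {e \<in> E. fst e = x \<or> snd e = x})"
  proof (rule sum_mono)
    fix x assume "x \<in> W"
    then obtain e where "e \<in> {e \<in> E. fst e = x \<or> snd e = x}" by (auto simp: W_def)
    then have "card {e \<in> E. fst e = x \<or> snd e = x} \<noteq> 0"
      using assms(1) card_eq_0_iff[of "{e \<in> E. fst e = x \<or> snd e = x}"] by fastforce
    with deg \<open>x \<in> W\<close> show "2 \<le> card {e \<in> E. fst e = x \<or> snd e = x}"
      unfolding W_def by fastforce
  qed
  also have "\<dots> = (\<Sum>x\<in>W. \<Sum>e\<in>E. of_bool (fst e = x \<or> snd e = x))"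
    using assms(1) by (simp add: of_bool_def sum.If_cases Int_def)
  also have "\<dots> = (\<Sum>e\<in>E. \<Sum>x\<in>W. of_bool (fst e = x \<or> snd e = x))"
    by (rule sum.swap)
  also have "\<dots> = (\<Sum>e\<in>E. 2)"
  proof (rule sum.cong)
    fix e assume e: "e \<in> E"
    then have "W \<inter> {x. fst e = x \<or> snd e = x} = {fst e, snd e}" by (auto simp: W_def)
    then show "(\<Sum>x\<in>W. of_bool (fst e = x \<or> snd e = x)) = (2::nat)"
      using assms(3)[OF e] \<open>finite W\<close> by (simp add: of_bool_def sum.If_cases)
  qed simp
  finally have "card W \<le> card E" by simp
  then have "card (W - {x0}) < card E"
    using \<open>x0 \<in> W\<close> \<open>finite W\<close> by (metis card_Diff1_less order_less_le_trans)
  then obtain \<psi> :: "_ \<Rightarrow> real" where nz: "\<exists>e\<in>E. \<psi> e \<noteq> 0"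
    and "\<forall>x\<in>W - {x0}. (\<Sum>e\<in>E. (of_bool (fst e = x) - of_bool (snd e = x)) * \<psi> e) = 0"
    using homogeneous_solution[of "W - {x0}" E "\<lambda>x e. of_bool (fst e = x) - of_bool (snd e = x)"]
      \<open>finite W\<close> assms(1) by auto
  then have zero: "net E \<psi> x = 0" if "x \<in> W" "x \<noteq> x0" for x
    using that by (simp add: net_def mult.commute)
  have "(\<Sum>x\<in>W. net E \<psi> x) = (\<Sum>e\<in>E. \<psi> e * (of_bool (fst e \<in> W) - of_bool (snd e \<in> W)))"
    by (rule net_sum) fact+
  also have "\<dots> = 0" by (intro sum.neutral) (auto simp: W_def)
  finally have "net E \<psi> x0 = 0"
    using zero \<open>x0 \<in> W\<close> \<open>finite W\<close> by (simp add: sum.remove)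
  moreover have "net E \<psi> x = 0" if "x \<notin> W" for x
    unfolding net_def using that by (intro sum.neutral) (auto simp: W_def image_iff)
  ultimately have "net E \<psi> x = 0" for x using zero by metis
  with nz show ?thesis by blast
qed

text \<open>The ratio test: \<open>f\<close> minimizes
  \<open>\<phi> e / \<bar>\<psi> e\<bar>\<close>, so a step just long enough to empty
  \<open>f\<close> changes every other edge by at most the flow that it carries.\<close>

lemma cancel_circulation:
  fixes \<phi> \<psi> :: "'e \<Rightarrow> real"
  assumes "finite E" "\<And>e. e \<in> E \<Longrightarrow> 0 < \<phi> e" "\<exists>e\<in>E. \<psi> e \<noteq> 0"
  shows "\<exists>c. (\<forall>e\<in>E. 0 \<le> \<phi> e + c * \<psi> e) \<and> (\<exists>e\<in>E. \<phi> e + c * \<psi> e = 0)"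
proof -
  define N where "N = {e \<in> E. \<psi> e \<noteq> 0}"
  have "finite N" "N \<noteq> {}" using assms by (auto simp: N_def)
  define f where "f = arg_min_on (\<lambda>e. \<phi> e / \<bar>\<psi> e\<bar>) N"
  have f: "f \<in> N" and min: "\<And>e. e \<in> N \<Longrightarrow> \<phi> f / \<bar>\<psi> f\<bar> \<le> \<phi> e / \<bar>\<psi> e\<bar>"
    using arg_min_if_finite(1)[OF \<open>finite N\<close> \<open>N \<noteq> {}\<close>] arg_min_least[OF \<open>finite N\<close> \<open>N \<noteq> {}\<close>]
    unfolding f_def by auto
  define c where "c = - \<phi> f / \<psi> f"
  have "0 \<le> \<phi> e + c * \<psi> e" if e: "e \<in> E" for e
  proof (cases "\<psi> e = 0")
    case True
    then show ?thesis using assms(2)[OF e] by simp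
  next
    case False
    then have "\<phi> f / \<bar>\<psi> f\<bar> \<le> \<phi> e / \<bar>\<psi> e\<bar>" using min e by (simp add: N_def)
    then have "\<phi> f / \<bar>\<psi> f\<bar> * \<bar>\<psi> e\<bar> \<le> \<phi> e" using False by (simp add: field_simps)
    moreover have "\<bar>c * \<psi> e\<bar> = \<phi> f / \<bar>\<psi> f\<bar> * \<bar>\<psi> e\<bar>"
      using assms(2)[of f] f by (simp add: c_def abs_mult N_def)
    ultimately show ?thesis by (smt (verit))
  qed
  moreover have "\<phi> f + c * \<psi> f = 0" "f \<in> E" using f by (auto simp: c_def N_def)
  ultimately show ?thesis by blast
qed

section \<open>The Steiner dynamic program\<close>

text \<open>\<open>vs\<close> is a list because the position of a vulnerable edge numbers its two
  ends among the items. Weights are integers like the cells of the machine.\<close>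

locale steiner =
  fixes V :: "'v set" and S :: "('v \<times> 'v) set" and w :: "'v \<times> 'v \<Rightarrow> int"
    and vs :: "('v \<times> 'v) list" and s t :: 'v and p :: int
  assumes finite_V: "finite V" and S_sub: "S \<subseteq> V \<times> V" and vs_sub: "set vs \<subseteq> V \<times> V"
    and w_pos: "e \<in> S \<union> set vs \<Longrightarrow> 1 \<le> w e" and S_vs: "S \<inter> set vs = {}"
    and distinct_vs: "distinct vs" and s_in: "s \<in> V" and t_in: "t \<in> V"
begin

abbreviation items :: "nat set" where "items \<equiv> {..<2 * length vs + 2}"

definition pos :: "nat \<Rightarrow> 'v" where
  "pos i = (if i = 0 then s else if i = 1 then t
     else if even i then fst (vs ! (i div 2 - 1)) else snd (vs ! (i div 2 - 1)))"

text \<open>Amounts are supplies of the flow on the safe edges alone: \<open>p\<close> units start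
  at \<open>s\<close> and end at \<open>t\<close>, while a used vulnerable edge swallows one unit at
  its tail and releases one at its head.\<close>

definition amount :: "nat \<Rightarrow> int" where
  "amount i = (if i = 0 then p else if i = 1 then - p else if even i then - 1 else 1)"

definition charge :: "nat \<Rightarrow> int" where
  "charge i = (if 2 \<le> i \<and> even i then w (vs ! (i div 2 - 1)) else 0)"

abbreviation total :: "nat set \<Rightarrow> int" where "total X \<equiv> sum amount X"

text \<open>A group with positive total sends its surplus along an edge out of \<open>u\<close>; one
  with negative total is served through an edge into \<open>u\<close>. The weight is paid once,
  whatever the amount, because safe edges are uncapacitated. A balanced group needs no connection
  and is left to the rule \<open>jump\<close>.\<close>

definition move :: "nat set \<Rightarrow> 'v \<Rightarrow> 'v \<Rightarrow> int \<Rightarrow> bool" where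
  "move X u v d \<longleftrightarrow> 0 < total X \<and> (u, v) \<in> S \<and> d = w (u, v)
     \<or> total X < 0 \<and> (v, u) \<in> S \<and> d = w (v, u)"

text \<open>A group \<open>X\<close> of items located at the vertex \<open>v\<close> at cost \<open>c\<close>. Item 0 is the source, item 1 the
  target, and the items \<open>2 * j + 2\<close> and \<open>2 * j + 3\<close> are the two ends of the \<open>j\<close>-th vulnerable edge,
  whose weight is charged to the tail. The rule \<open>skip\<close> discards an unused vulnerable edge.\<close>

inductive der :: "nat set \<Rightarrow> 'v \<Rightarrow> int \<Rightarrow> bool" where
  single: "i \<in> items \<Longrightarrow> der {i} (pos i) (charge i)"
| skip: "j < length vs \<Longrightarrow> v \<in> V \<Longrightarrow> der {2 * j + 2, 2 * j + 3} v 0"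
| merge: "der A v a \<Longrightarrow> der B v b \<Longrightarrow> A \<inter> B = {} \<Longrightarrow> der (A \<union> B) v (a + b)"
| move: "der X u c \<Longrightarrow> move X u v d \<Longrightarrow> der X v (c + d)"
| jump: "der X u c \<Longrightarrow> total X = 0 \<Longrightarrow> v \<in> V \<Longrightarrow> der X v c"

lemma pos_in: "i \<in> items \<Longrightarrow> pos i \<in> V"
proof -
  assume i: "i \<in> items"
  show ?thesis
  proof (cases "i < 2")
    case True
    then show ?thesis using s_in t_in by (auto simp: pos_def)
  next
    case False
    then have "vs ! (i div 2 - 1) \<in> set vs" using i by (intro nth_mem) auto
    then have "fst (vs ! (i div 2 - 1)) \<in> V \<and> snd (vs ! (i div 2 - 1)) \<in> V"
      using vs_sub by auto
    then show ?thesis using False by (auto simp: pos_def)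
  qed
qed

lemma charge_nonneg: "i \<in> items \<Longrightarrow> 0 \<le> charge i"
proof -
  assume i: "i \<in> items"
  have "1 \<le> w (vs ! (i div 2 - 1))" if "2 \<le> i"
    using that i by (intro w_pos UnI2 nth_mem) auto
  then show ?thesis by (auto simp: charge_def)
qed

lemma der_props: "der X v c \<Longrightarrow> X \<subseteq> items \<and> X \<noteq> {} \<and> v \<in> V \<and> 0 \<le> c"
proof (induction rule: der.induct)
  case (single i)
  then show ?case using pos_in charge_nonneg by simp
next
  case (move X u c v d)
  then have "v \<in> V \<and> 1 \<le> d"
    using S_sub w_pos[of "(u, v)"] w_pos[of "(v, u)"] unfolding move_def by blast
  then show ?case using move.IH by simp
qed auto

lemma der_finite: "der X v c \<Longrightarrow> finite X"
  using der_props[of X v c] finite_subset[of X items] by simp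

lemma sum_items:
  "(\<Sum>i\<in>items. f i) = f 0 + f 1 + (\<Sum>j<length vs. f (2 * j + 2) + f (2 * j + 3))"
  for f :: "nat \<Rightarrow> 'a::comm_monoid_add"
proof -
  have "(\<Sum>i<2 * n + 2. f i) = f 0 + f 1 + (\<Sum>j<n. f (2 * j + 2) + f (2 * j + 3))" for n
  proof (induction n)
    case 0
    have "{..<2} = {0, 1::nat}" by auto
    then show ?case by simp
  next
    case (Suc n)
    have "{..<2 * Suc n + 2} = insert (2 * n + 3) (insert (2 * n + 2) {..<2 * n + 2})" by auto
    then show ?case using Suc by (simp add: ac_simps)
  qed
  then show ?thesis .
qed

lemma finite_S: "finite S"
  using finite_subset[OF S_sub] finite_V by simp

section \<open>Soundness: from a derivation to a flow\<close>

definition paired :: "nat set \<Rightarrow> bool" where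
  "paired Y \<longleftrightarrow> Y \<subseteq> items - {0, 1} \<and> (\<forall>j<length vs. 2 * j + 2 \<in> Y \<longleftrightarrow> 2 * j + 3 \<in> Y)"

text \<open>\<open>Y\<close> collects the discarded items and \<open>A\<close> the safe edges that
  were bought. The flow \<open>\<phi>\<close> takes the supplies of the remaining items to
  \<open>v\<close>, where \<open>total X\<close> is still to be passed on. The cost is only bounded
  above, as an edge that is bought twice occurs once in \<open>A\<close>.\<close>

definition routed :: "nat set \<Rightarrow> 'v \<Rightarrow> int \<Rightarrow> nat set \<Rightarrow> ('v \<times> 'v) set \<Rightarrow> ('v \<times> 'v \<Rightarrow> int) \<Rightarrow> bool"
where
  "routed X v c Y A \<phi> \<longleftrightarrow> paired Y \<and> Y \<subseteq> X \<and> A \<subseteq> S \<and> total Y = 0 \<and>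
     sum w A + sum charge (X - Y) \<le> c \<and> (\<forall>e. 0 \<le> \<phi> e) \<and> (\<forall>e. e \<notin> A \<longrightarrow> \<phi> e = 0) \<and>
     (\<forall>x. net S \<phi> x = (\<Sum>i\<in>X - Y. amount i * of_bool (pos i = x)) - total X * of_bool (v = x))"

text \<open>Sending \<open>\<bar>total X\<bar>\<close> along the edge shifts the outstanding total
  from \<open>u\<close> to \<open>v\<close>. For a negative total the edge is traversed from
  \<open>v\<close> to \<open>u\<close>; the two sign changes cancel, so one formula covers both
  cases.\<close>

lemma routed_move:
  assumes "routed X u c Y A \<phi>" "move X u v d"
  shows "\<exists>A' \<phi>'. routed X v (c + d) Y A' \<phi>'"
proof -
  define e where "e = (if 0 < total X then (u, v) else (v, u))"
  have e: "e \<in> S" "d = w e" using assms by (auto simp: move_def e_def)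
  define \<phi>' where "\<phi>' = \<phi>(e := \<phi> e + \<bar>total X\<bar>)"
  have "net S \<phi>' x = net S \<phi> x + \<bar>total X\<bar> * (of_bool (fst e = x) - of_bool (snd e = x))" for x
    unfolding \<phi>'_def using finite_S e by (subst net_upd) auto
  also have "\<bar>total X\<bar> * (of_bool (fst e = x) - of_bool (snd e = x))
      = total X * (of_bool (u = x) - of_bool (v = x))" for x
    by (auto simp: e_def)
  finally have *: "net S \<phi>' x = net S \<phi> x + total X * (of_bool (u = x) - of_bool (v = x))" for x .
  have "A \<subseteq> S" using assms by (simp add: routed_def)
  then have "sum w (insert e A) \<le> sum w A + w e"
    using finite_S finite_subset[OF \<open>A \<subseteq> S\<close>] w_pos[of e] e by (cases "e \<in> A") (auto simp: insert_absorb)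
  then have "routed X v (c + d) Y (insert e A) \<phi>'"
  proof -
    have "net S \<phi>' x
        = (\<Sum>i\<in>X - Y. amount i * of_bool (pos i = x)) - total X * of_bool (v = x)" for x
      using assms(1) * by (simp add: routed_def right_diff_distrib)
    moreover have "sum w (insert e A) + sum charge (X - Y) \<le> c + d"
      using assms(1) e \<open>sum w (insert e A) \<le> sum w A + w e\<close> by (simp add: routed_def)
    moreover have "\<forall>f. 0 \<le> \<phi>' f" "\<forall>f. f \<notin> insert e A \<longrightarrow> \<phi>' f = 0"
      using assms(1) by (simp_all add: routed_def \<phi>'_def del: split_paired_All)
    ultimately show ?thesis using assms(1) e unfolding routed_def by blast
  qed
  then show ?thesis by blast
qed

text \<open>The flows add up and the discarded sets are disjoint. An edge in both \<open>A\<close>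
  and \<open>A'\<close> has been paid twice, which only helps since weights are positive.\<close>

lemma routed_merge:
  assumes "routed X v c Y A \<phi>" "routed X' v c' Y' A' \<phi>'" "X \<inter> X' = {}" "finite X" "finite X'"
    "X \<subseteq> items" "X' \<subseteq> items"
  shows "routed (X \<union> X') v (c + c') (Y \<union> Y') (A \<union> A') (\<lambda>e. \<phi> e + \<phi>' e)"
proof -
  note r = assms(1,2)[unfolded routed_def]
  have fin: "finite A" "finite A'" using r finite_S finite_subset by blast+
  have *: "X \<union> X' - (Y \<union> Y') = (X - Y) \<union> (X' - Y')" "(X - Y) \<inter> (X' - Y') = {}" "Y \<inter> Y' = {}"
    using r assms(3) by auto
  have fy: "finite Y" "finite Y'" using r assms finite_subset by blast+
  have sums: "(\<Sum>i\<in>X \<union> X' - (Y \<union> Y'). f i) = (\<Sum>i\<in>X - Y. f i) + (\<Sum>i\<in>X' - Y'. f i)"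
    for f :: "nat \<Rightarrow> int"
    unfolding * using assms * by (intro sum.union_disjoint) auto
  have tot: "total (X \<union> X') = total X + total X'" "total (Y \<union> Y') = total Y + total Y'"
    using assms * fy by (auto intro: sum.union_disjoint)
  have "sum w (A \<union> A') + sum w (A \<inter> A') = sum w A + sum w A'"
    using fin by (rule sum.union_inter)
  moreover have "0 \<le> sum w (A \<inter> A')"
  proof (rule sum_nonneg)
    fix e assume "e \<in> A \<inter> A'"
    then have "e \<in> S" using r by auto
    then show "0 \<le> w e" using w_pos[of e] by simp
  qed
  ultimately have "sum w (A \<union> A') \<le> sum w A + sum w A'" by linarith
  moreover have "paired (Y \<union> Y')" using r by (auto simp: paired_def)
  moreover have "net S (\<lambda>e. \<phi> e + \<phi>' e) x
      = (\<Sum>i\<in>X \<union> X' - (Y \<union> Y'). amount i * of_bool (pos i = x)) - total (X \<union> X') * of_bool (v = x)"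
    for x
  proof -
    have "net S \<phi> x = (\<Sum>i\<in>X - Y. amount i * of_bool (pos i = x)) - total X * of_bool (v = x)"
      "net S \<phi>' x = (\<Sum>i\<in>X' - Y'. amount i * of_bool (pos i = x)) - total X' * of_bool (v = x)"
      using r by blast+
    then show ?thesis unfolding sums tot net_add by (simp add: distrib_right)
  qed
  moreover have "\<forall>e. 0 \<le> \<phi> e + \<phi>' e" "\<forall>e. e \<notin> A \<union> A' \<longrightarrow> \<phi> e + \<phi>' e = 0"
    using r by simp_all
  moreover have "sum w (A \<union> A') + sum charge (X \<union> X' - (Y \<union> Y')) \<le> c + c'"
    using r \<open>sum w (A \<union> A') \<le> sum w A + sum w A'\<close> unfolding sums by linarith
  moreover have "total (Y \<union> Y') = 0" "Y \<union> Y' \<subseteq> X \<union> X'" "A \<union> A' \<subseteq> S"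
    using r tot by auto
  ultimately show ?thesis unfolding routed_def by blast
qed

lemma der_routed: "der X v c \<Longrightarrow> \<exists>Y A \<phi>. routed X v c Y A \<phi>"
proof (induction rule: der.induct)
  case (single i)
  have "routed {i} (pos i) (charge i) {} {} (\<lambda>_. 0)"
    by (auto simp: routed_def paired_def net_def)
  then show ?case by blast
next
  case (skip j v)
  have "paired {2 * j + 2, 2 * j + 3}"
    using skip unfolding paired_def by auto
  moreover have "amount (2 * j + 2) = - 1" "amount (2 * j + 3) = 1" by (auto simp: amount_def)
  ultimately have "routed {2 * j + 2, 2 * j + 3} v 0 {2 * j + 2, 2 * j + 3} {} (\<lambda>_. 0)"
    by (auto simp: routed_def net_def)
  then show ?case by blast
next
  case (merge A v a B b)
  then show ?case using routed_merge der_props der_finite by meson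
next
  case (move X u c v d)
  then show ?case using routed_move by blast
next
  case (jump X u c v)
  then obtain Y A \<phi> where "routed X u c Y A \<phi>" by blast
  then have "routed X v c Y A \<phi>" using jump by (simp add: routed_def)
  then show ?case by blast
qed

text \<open>All amounts together cancel, so the outstanding total at \<open>v\<close> is 0 and the
  flow meets the supplies of the undiscarded items exactly. One unit on each edge of
  \<open>W\<close>, from its tail to its head, cancels the supplies of its two ends; what is left is
  \<open>p\<close> at \<open>s\<close> and \<open>- p\<close> at \<open>t\<close>.\<close>

lemma der_sound:
  assumes "der items v c"
  shows "\<exists>K \<phi>. K \<subseteq> S \<union> set vs \<and> sum w K \<le> c \<and> unit_flow p s t (set vs) K \<phi>"
proof -
  obtain Y A \<phi> where r: "routed items v c Y A \<phi>" using der_routed assms by blast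
  note r = r[unfolded routed_def]
  define J where "J = {j. j < length vs \<and> 2 * j + 2 \<notin> Y}"
  define W where "W = (\<lambda>j. vs ! j) ` J"
  define \<psi> where "\<psi> e = (if e \<in> W then 1 else \<phi> e)" for e
  have inj: "inj_on (\<lambda>j. vs ! j) J"
    using distinct_vs by (auto simp: J_def inj_on_def nth_eq_iff_index_eq)
  have Y: "2 * j + 3 \<in> Y \<longleftrightarrow> 2 * j + 2 \<in> Y" "0 \<notin> Y" "1 \<notin> Y" if "j < length vs" for j
    using r that by (auto simp: paired_def)
  have Y01: "0 \<notin> Y" "1 \<notin> Y" using r by (auto simp: paired_def)
  have W: "W \<subseteq> set vs" "finite W" by (auto simp: W_def J_def)
  have "A \<subseteq> S" using r by simp
  then have A: "A \<subseteq> S" "finite A" using finite_S finite_subset by auto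
  have supp: "\<phi> e = 0" if "e \<notin> A" for e using r that by blast
  have nonneg: "0 \<le> \<phi> e" for e using r by blast
  have disj: "A \<inter> W = {}" using A W S_vs by blast
  have reduce: "(\<Sum>i\<in>items - Y. f i) = f 0 + f 1 + (\<Sum>j\<in>J. f (2 * j + 2) + f (2 * j + 3))"
    for f :: "nat \<Rightarrow> int"
  proof -
    have "(\<Sum>i\<in>items - Y. f i) = (\<Sum>i\<in>items. if i \<in> Y then 0 else f i)"
      by (rule sum.mono_neutral_cong_left) auto
    also have "\<dots> = f 0 + f 1
        + (\<Sum>j<length vs. if 2 * j + 2 \<in> Y then 0 else f (2 * j + 2) + f (2 * j + 3))"
      unfolding sum_items using Y Y01 by (intro arg_cong2[where f = "(+)"] sum.cong) auto
    also have "(\<Sum>j<length vs. if 2 * j + 2 \<in> Y then 0 else f (2 * j + 2) + f (2 * j + 3))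
        = (\<Sum>j\<in>J. f (2 * j + 2) + f (2 * j + 3))"
      by (rule sum.mono_neutral_cong_right) (auto simp: J_def)
    finally show ?thesis .
  qed
  have ends: "pos (2 * j + 2) = fst (vs ! j)" "pos (2 * j + 3) = snd (vs ! j)"
    "amount (2 * j + 2) = - 1" "amount (2 * j + 3) = 1"
    "charge (2 * j + 2) = w (vs ! j)" "charge (2 * j + 3) = 0" for j
    by (auto simp: pos_def amount_def charge_def)
  have zero_total: "total items = 0"
    unfolding sum_items by (simp add: ends) (simp add: amount_def)
  have "sum w (A \<union> W) = sum w A + sum w W" using A W disj by (intro sum.union_disjoint)
  also have "sum w W = sum charge (items - Y)"
    unfolding reduce ends W_def sum.reindex[OF inj] by (simp add: charge_def)
  finally have "sum w (A \<union> W) \<le> c" using r by simp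
  moreover have "net (A \<union> W) \<psi> x = p * (of_bool (x = s) - of_bool (x = t))" for x
  proof -
    have "net (A \<union> W) \<psi> x = net A \<psi> x + net W \<psi> x" using A W disj by (intro net_union)
    also have "net A \<psi> x = net A \<phi> x" using disj by (intro net_cong) (auto simp: \<psi>_def)
    also have "net A \<phi> x = net S \<phi> x"
      using A(1) finite_S supp by (intro net_superset[symmetric]) auto
    also have "net S \<phi> x = (\<Sum>i\<in>items - Y. amount i * of_bool (pos i = x))"
      using r zero_total by simp
    also have "\<dots> = p * (of_bool (x = s) - of_bool (x = t))
        + (\<Sum>j\<in>J. of_bool (snd (vs ! j) = x) - of_bool (fst (vs ! j) = x))"
      unfolding reduce ends by (simp add: pos_def amount_def eq_commute)
    also have "net W \<psi> x = (\<Sum>j\<in>J. of_bool (fst (vs ! j) = x) - of_bool (snd (vs ! j) = x))"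
      unfolding net_def W_def sum.reindex[OF inj] by (intro sum.cong) (auto simp: \<psi>_def W_def)
    finally show ?thesis by (simp add: sum_subtractf)
  qed
  moreover have "A \<union> W \<subseteq> S \<union> set vs" using A W by blast
  moreover have "\<forall>e\<in>A \<union> W. 0 \<le> \<psi> e" using nonneg by (simp add: \<psi>_def)
  moreover have "\<forall>e\<in>(A \<union> W) \<inter> set vs. \<psi> e \<le> 1"
  proof
    fix e assume "e \<in> (A \<union> W) \<inter> set vs"
    then have "e \<in> W" using A(1) S_vs by blast
    then show "\<psi> e \<le> 1" by (simp add: \<psi>_def)
  qed
  ultimately show ?thesis unfolding unit_flow_def
    by (intro exI[of _ "A \<union> W"] exI[of _ \<psi>]) simp
qed

section \<open>Completeness: collapsing a flow into a derivation\<close>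

text \<open>A half-finished conversion of a flow into a derivation: the groups of \<open>C\<close>
  partition \<open>U\<close>, and \<open>\<phi>\<close> is the flow not yet converted, whose net
  outflow at a vertex is the total of the groups there. It is real because cancelling a circulation
  can leave the integers.\<close>

definition config :: "nat set \<Rightarrow> ('v \<times> 'v \<Rightarrow> real) \<Rightarrow> (nat set \<times> 'v \<times> int) multiset \<Rightarrow> bool" where
  "config U \<phi> C \<longleftrightarrow> C \<noteq> {#} \<and> (\<forall>g\<in>#C. der (fst g) (fst (snd g)) (snd (snd g))) \<and>
     (\<forall>e\<in>S. 0 \<le> \<phi> e) \<and> (\<forall>i. (\<Sum>g\<in>#C. of_bool (i \<in> fst g)) = (of_bool (i \<in> U) :: nat)) \<and>
     (\<forall>x. net S \<phi> x = (\<Sum>g\<in>#C. of_int (total (fst g)) * of_bool (fst (snd g) = x)))"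

text \<open>The potential of the conversion: the cost of the groups so far plus the weight of the
  edges that still carry flow. No conversion step raises it.\<close>

definition price :: "('v \<times> 'v \<Rightarrow> real) \<Rightarrow> (nat set \<times> 'v \<times> int) multiset \<Rightarrow> int" where
  "price \<phi> C = (\<Sum>g\<in>#C. snd (snd g)) + (\<Sum>e\<in>{e \<in> S. \<phi> e \<noteq> 0}. w e)"

lemma config_merge:
  assumes "config U \<phi> (add_mset (A, v, a) (add_mset (B, v, b) C))"
  shows "config U \<phi> (add_mset (A \<union> B, v, a + b) C)"
    and "price \<phi> (add_mset (A \<union> B, v, a + b) C) = price \<phi> (add_mset (A, v, a) (add_mset (B, v, b) C))"
proof -
  have der: "der A v a" "der B v b" using assms by (auto simp: config_def)
  \<comment> \<open>An item in both groups would be counted twice, while the configuration counts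
    every item at most once.\<close>
  have "A \<inter> B = {}"
  proof (rule ccontr)
    assume "A \<inter> B \<noteq> {}"
    then obtain i where i: "i \<in> A" "i \<in> B" by blast
    have "(\<Sum>g\<in>#add_mset (A, v, a) (add_mset (B, v, b) C). of_bool (i \<in> fst g)) = (of_bool (i \<in> U) :: nat)"
      using assms unfolding config_def by blast
    with i show False by (simp add: of_bool_def split: if_splits)
  qed
  moreover from this have "total (A \<union> B) = total A + total B"
    using der der_finite by (intro sum.union_disjoint)
  moreover have "(of_bool (i \<in> A \<union> B) :: nat) = of_bool (i \<in> A) + of_bool (i \<in> B)" for i
    using \<open>A \<inter> B = {}\<close> by (auto simp: of_bool_def)
  ultimately show "config U \<phi> (add_mset (A \<union> B, v, a + b) C)"
    using assms der der.merge[OF der] unfolding config_def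
    by (simp add: algebra_simps del: split_paired_All Un_iff of_int_sum)
  show "price \<phi> (add_mset (A \<union> B, v, a + b) C) = price \<phi> (add_mset (A, v, a) (add_mset (B, v, b) C))"
    by (simp add: price_def)
qed

lemma config_jump:
  assumes "config U \<phi> (add_mset (X, u, c) C)" "total X = 0" "v \<in> V"
  shows "config U \<phi> (add_mset (X, v, c) C)"
  using assms der.jump[of X u c v] unfolding config_def by (simp del: split_paired_All of_int_sum)

text \<open>The edge carries exactly the total of the group, up to orientation, so taking the flow
  off the edge is the same as moving the group across it. The weight leaves the support sum and
  enters the cost of the group, hence the price is kept.\<close>

lemma config_move:
  assumes conf: "config U \<phi> (add_mset (X, u, c) C)" and "e \<in> S"
    and u: "net S \<phi> u = of_int (total X)"
    and e: "e = (u, v) \<and> \<phi> e = of_int (total X) \<or> e = (v, u) \<and> \<phi> e = - of_int (total X)"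
    and nz: "\<phi> e \<noteq> 0"
  shows "config U (\<phi>(e := 0)) (add_mset (X, v, c + w e) C)"
    and "price (\<phi>(e := 0)) (add_mset (X, v, c + w e) C) = price \<phi> (add_mset (X, u, c) C)"
proof -
  have "0 < \<phi> e" using conf nz \<open>e \<in> S\<close> unfolding config_def by force
  then have "move X u v (w e)" using e \<open>e \<in> S\<close> unfolding move_def by (auto simp del: of_int_sum)
  moreover have "der X u c" using conf by (simp add: config_def)
  ultimately have "der X v (c + w e)" by (rule_tac der.move)
  moreover have "net S (\<phi>(e := 0)) x
      = net S \<phi> x + of_int (total X) * (of_bool (v = x) - of_bool (u = x))" for x
    using e by (subst net_upd[OF finite_S \<open>e \<in> S\<close>]) (auto simp: algebra_simps simp del: of_int_sum)
  ultimately show "config U (\<phi>(e := 0)) (add_mset (X, v, c + w e) C)"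
    using conf unfolding config_def by (simp add: algebra_simps del: split_paired_All of_int_sum)
  have "{f \<in> S. \<phi> f \<noteq> 0} = insert e {f \<in> S. (\<phi>(e := 0)) f \<noteq> 0}" using nz \<open>e \<in> S\<close> by auto
  then show "price (\<phi>(e := 0)) (add_mset (X, v, c + w e) C) = price \<phi> (add_mset (X, u, c) C)"
    using finite_S by (simp add: price_def)
qed

lemma config_flow:
  assumes "config U \<phi> C" "\<And>e. e \<in> S \<Longrightarrow> 0 \<le> \<psi> e" "\<And>x. net S \<psi> x = net S \<phi> x"
    "\<And>e. e \<in> S \<Longrightarrow> \<phi> e = 0 \<Longrightarrow> \<psi> e = 0"
  shows "config U \<psi> C" and "price \<psi> C \<le> price \<phi> C"
proof -
  show "config U \<psi> C" using assms by (simp add: config_def)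
  have "(\<Sum>e\<in>{e \<in> S. \<psi> e \<noteq> 0}. w e) \<le> (\<Sum>e\<in>{e \<in> S. \<phi> e \<noteq> 0}. w e)"
  proof (rule sum_mono2)
    show "0 \<le> w e" if "e \<in> {e \<in> S. \<phi> e \<noteq> 0} - {e \<in> S. \<psi> e \<noteq> 0}" for e
      using w_pos[of e] that by simp
  qed (use assms(4) finite_S in auto)
  then show "price \<psi> C \<le> price \<phi> C" by (simp add: price_def)
qed

lemma config_at:
  assumes conf: "config U \<phi> (add_mset (X, u, c) C)" and "\<And>g. g \<in># C \<Longrightarrow> fst (snd g) \<noteq> u"
  shows "net S \<phi> u = of_int (total X)"
proof -
  have "(\<Sum>g\<in>#C. of_int (total (fst g)) * of_bool (fst (snd g) = u)) = (\<Sum>g\<in>#C. 0 :: real)"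
    using assms(2) by (intro arg_cong[where f = sum_mset] image_mset_cong) auto
  then show ?thesis using conf by (simp add: config_def del: of_int_sum)
qed

text \<open>A flow of minimal support is a forest, so that it has a leaf. The groups at the leaf are merged
  and pushed along its only edge.\<close>

lemma config_collapse:
  assumes "config U \<phi> C"
  shows "\<exists>v c. der U v c \<and> c \<le> price \<phi> C"
  using assms
\<comment> \<open>Groups plus support edges decrease in every step: a merge removes a group, whereas
  crossing a leaf edge, deleting a loop or cancelling a circulation removes an edge from the
  support.\<close>
proof (induction "size C + card {e \<in> S. \<phi> e \<noteq> 0}" arbitrary: \<phi> C rule: less_induct)
  case less
  note conf = less.prems
  define E where "E = {e \<in> S. \<phi> e \<noteq> 0}"
  have E: "finite E" "E \<subseteq> S" using finite_S by (auto simp: E_def)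
  have IH: ?case if "config U \<psi> D" "price \<psi> D \<le> price \<phi> C"
    "size D + card {e \<in> S. \<psi> e \<noteq> 0} < size C + card E" for \<psi> D
    using less.hyps[of D \<psi>] that unfolding E_def by fastforce
  have shrink: ?case if "config U \<psi> D" "price \<psi> D \<le> price \<phi> C" "size D = size C"
    "{e \<in> S. \<psi> e \<noteq> 0} \<subset> E" for \<psi> D
    using IH[of \<psi> D] that psubset_card_mono[OF E(1)] by simp
  have clear: "{f \<in> S. (\<phi>(e := 0)) f \<noteq> 0} \<subset> E" if "e \<in> E" for e
  proof -
    have eq: "{f \<in> S. (\<phi>(e := 0)) f \<noteq> 0} = E - {e}" unfolding E_def by auto
    show ?thesis unfolding eq using that by blast
  qed
  have "size C \<noteq> 0" using conf by (simp add: config_def)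
  then consider (single) "size C = 1" | (two) "2 \<le> size C" by linarith
  then show ?case
  proof cases
    case single
    then obtain g where one: "C = {#g#}" using size_1_singleton_mset by blast
    have "(\<Sum>g\<in>#C. of_bool (i \<in> fst g)) = (of_bool (i \<in> U) :: nat)" for i
      using conf by (simp add: config_def)
    then have "i \<in> fst g \<longleftrightarrow> i \<in> U" for i
      using one by (simp add: of_bool_eq_iff)
    then have "fst g = U" by blast
    then have "der U (fst (snd g)) (snd (snd g))" using conf one by (auto simp: config_def)
    moreover have "0 \<le> (\<Sum>e\<in>E. w e)"
    proof (rule sum_nonneg)
      fix e assume "e \<in> E" then show "0 \<le> w e" using w_pos[of e] E by auto
    qed
    ultimately show ?thesis using one
      by (intro exI[of _ "fst (snd g)"] exI[of _ "snd (snd g)"]) (simp add: price_def E_def)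
  next
    case two
    have split: "\<exists>h D. C = add_mset g (add_mset h D)" if "g \<in># C" for g
    proof -
      obtain C' where C': "C = add_mset g C'" using \<open>g \<in># C\<close> by (metis multi_member_split)
      then have "C' \<noteq> {#}" using two by auto
      then obtain h D where "C' = add_mset h D" by (metis multiset_cases)
      then show ?thesis using C' by blast
    qed
    have merge: ?thesis if "C = add_mset (A, v, a) (add_mset (B, v, b) D)" for A B v a b D
      using config_merge[of U \<phi> A v a B b D] conf that
      by (intro IH[of \<phi> "add_mset (A \<union> B, v, a + b) D"]) (auto simp: E_def)
    \<comment> \<open>A balanced group jumps to some other group and is merged with it. This is how
      different trees of the forest are joined at no cost.\<close>
    have zero: ?thesis if mem: "(X, u, c) \<in># C" and tot: "total X = 0" for X u c
    proof -
      obtain Y v b D where C: "C = add_mset (X, u, c) (add_mset (Y, v, b) D)"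
        using split[OF mem] by auto
      have "v \<in> V" using conf C der_props[of Y v b] by (auto simp: config_def)
      then have "config U \<phi> (add_mset (X, v, c) (add_mset (Y, v, b) D))"
        using config_jump conf tot unfolding C by blast
      from config_merge[OF this] show ?thesis
        by (intro IH[of \<phi> "add_mset (X \<union> Y, v, c + b) D"]) (auto simp: E_def C price_def)
    qed
    show ?thesis
    proof (cases "\<exists>X u c D. C = add_mset (X, u, c) D \<and> (\<exists>g\<in>#D. fst (snd g) = u)")
      case True
      then obtain X u c D g where "C = add_mset (X, u, c) D" "g \<in># D" "fst (snd g) = u" by blast
      moreover from this obtain D' where "D = add_mset g D'" by (metis multi_member_split)
      ultimately show ?thesis using merge[of X u c "fst g" "snd (snd g)" D'] by (cases g) auto
    next
      case False
      have at: "net S \<phi> u = of_int (total X)" if "C = add_mset (X, u, c) D" for X u c D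
        using config_at[of U \<phi> X u c D] conf that False by blast
      show ?thesis
      proof (cases "E = {}")
        case True
        obtain X u c where g: "(X, u, c) \<in># C"
          using conf by (metis config_def multiset_nonemptyE prod_cases3)
        then obtain D where "C = add_mset (X, u, c) D" by (metis multi_member_split)
        then have "net S \<phi> u = of_int (total X)" by (rule at)
        \<comment> \<open>Once no flow is left, every group is balanced, since it is alone at its
          vertex.\<close>
        moreover have "net S \<phi> u = 0"
          unfolding net_def using True by (intro sum.neutral) (auto simp: E_def)
        ultimately have "total X = 0" by (simp del: of_int_sum)
        then show ?thesis using zero g by simp
      next
        case ne: False
        \<comment> \<open>Degrees ignore directions. In a support without loops there is either a
          leaf, or all degrees differ from 1 and a circulation can be cancelled.\<close>
        consider (loop) e where "e \<in> E" "fst e = snd e"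
          | (leaf) x where "x \<in> fst ` E \<union> snd ` E" "card {e \<in> E. fst e = x \<or> snd e = x} = 1"
              "\<forall>e\<in>E. fst e \<noteq> snd e"
          | (cycle) "\<forall>e\<in>E. fst e \<noteq> snd e"
              "\<forall>x \<in> fst ` E \<union> snd ` E. card {e \<in> E. fst e = x \<or> snd e = x} \<noteq> 1"
          by blast
        then show ?thesis
        proof cases
          case loop
          then have "e \<in> S" using E by blast
          have "net S (\<phi>(e := 0)) x = net S \<phi> x" for x
            using loop by (subst net_upd[OF finite_S \<open>e \<in> S\<close>]) simp
          moreover have "0 \<le> (\<phi>(e := 0)) f" if "f \<in> S" for f
            using conf that by (auto simp: config_def)
          ultimately have new: "config U (\<phi>(e := 0)) C" "price (\<phi>(e := 0)) C \<le> price \<phi> C"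
            using config_flow[of U \<phi> C "\<phi>(e := 0)"] conf by auto
          from shrink[OF new refl clear[OF loop(1)]] show ?thesis .
        next
          case leaf
          obtain e where e: "{e \<in> E. fst e = x \<or> snd e = x} = {e}"
            by (rule card_1_singletonE[OF leaf(2)])
          have e_in: "e \<in> {e \<in> E. fst e = x \<or> snd e = x}" unfolding e by simp
          then have "e \<in> E" "e \<in> S" using E by auto
          have \<phi>: "0 < \<phi> e" using \<open>e \<in> E\<close> conf unfolding E_def config_def by force
          have "net S \<phi> x = net {e} \<phi> x"
            unfolding net_def
          proof (rule sum.mono_neutral_right)
            show "\<forall>f\<in>S - {e}. \<phi> f * (of_bool (fst f = x) - of_bool (snd f = x)) = 0"
            proof
              fix f assume f: "f \<in> S - {e}"
              then have "f \<notin> {e \<in> E. fst e = x \<or> snd e = x}" using e by simp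
              then show "\<phi> f * (of_bool (fst f = x) - of_bool (snd f = x)) = 0"
                using f by (auto simp: E_def)
            qed
          qed (use finite_S \<open>e \<in> S\<close> in auto)
          then have net: "net S \<phi> x = \<phi> e * (of_bool (fst e = x) - of_bool (snd e = x))"
            by (simp add: net_def)
          have ends: "fst e = x \<and> snd e \<noteq> x \<or> fst e \<noteq> x \<and> snd e = x"
            using e_in leaf(3) by auto
          then have "net S \<phi> x \<noteq> 0" using \<phi> net by auto
          \<comment> \<open>All flow at the leaf \<open>x\<close> runs through \<open>e\<close>, so
            the excess at \<open>x\<close> is not 0 and some group must sit there; it is the only
            one, and \<open>e\<close> carries its total.\<close>
          have "\<exists>g\<in>#C. fst (snd g) = x"
          proof (rule ccontr)
            assume "\<not> (\<exists>g\<in>#C. fst (snd g) = x)"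
            then have "(\<Sum>g\<in>#C. of_int (total (fst g)) * of_bool (fst (snd g) = x)) = (\<Sum>g\<in>#C. 0 :: real)"
              by (intro arg_cong[where f = sum_mset] image_mset_cong) auto
            then show False using \<open>net S \<phi> x \<noteq> 0\<close> conf by (simp add: config_def)
          qed
          then obtain X c where "(X, x, c) \<in># C" by auto
          then obtain D where C: "C = add_mset (X, x, c) D" by (metis multi_member_split)
          define v where "v = (if fst e = x then snd e else fst e)"
          have cond: "e = (x, v) \<and> \<phi> e = of_int (total X) \<or> e = (v, x) \<and> \<phi> e = - of_int (total X)"
            using ends net at[OF C] by (cases e) (auto simp: v_def simp del: of_int_sum)
          have new: "config U (\<phi>(e := 0)) (add_mset (X, v, c + w e) D)"
            "price (\<phi>(e := 0)) (add_mset (X, v, c + w e) D) = price \<phi> C"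
            using config_move[OF _ \<open>e \<in> S\<close> at[OF C] cond] conf \<phi> unfolding C by simp_all
          have "price (\<phi>(e := 0)) (add_mset (X, v, c + w e) D) \<le> price \<phi> C" using new(2) by simp
          then show ?thesis
            by (rule shrink[OF new(1) _ _ clear[OF \<open>e \<in> E\<close>]]) (simp add: C)
        next
          case cycle
          have "\<exists>\<psi> :: _ \<Rightarrow> real. (\<exists>e\<in>E. \<psi> e \<noteq> 0) \<and> (\<forall>x. net E \<psi> x = 0)"
            by (rule circulation_exists[OF E(1) ne bspec[OF cycle(1)] bspec[OF cycle(2)]])
          then obtain \<psi> :: "_ \<Rightarrow> real" where \<psi>: "\<exists>e\<in>E. \<psi> e \<noteq> 0" "\<forall>x. net E \<psi> x = 0"
            by (elim exE conjE)
          have "0 < \<phi> e" if "e \<in> E" for e using that conf unfolding E_def config_def by force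
          from cancel_circulation[of E \<phi> \<psi>, OF E(1) this \<psi>(1)] obtain a where
            a: "\<forall>e\<in>E. 0 \<le> \<phi> e + a * \<psi> e" "\<exists>e\<in>E. \<phi> e + a * \<psi> e = 0" by blast
          \<comment> \<open>Extended by 0 outside \<open>E\<close>, the circulation brings no new
            edge into the support, so the price cannot grow.\<close>
          define \<phi>' where "\<phi>' e = \<phi> e + a * (if e \<in> E then \<psi> e else 0)" for e
          have ext: "net S (\<lambda>e. if e \<in> E then \<psi> e else 0) x = 0" for x
          proof -
            have "net S (\<lambda>e. if e \<in> E then \<psi> e else 0) x = net E (\<lambda>e. if e \<in> E then \<psi> e else 0) x"
              using finite_S E(2) by (rule net_superset) simp
            also have "\<dots> = net E \<psi> x" by (rule net_cong) simp
            finally show ?thesis using \<psi>(2) by simp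
          qed
          have "net S \<phi>' x = net S \<phi> x" for x
            unfolding \<phi>'_def net_add net_scale ext by simp
          moreover have "0 \<le> \<phi>' e" if "e \<in> S" for e
            using a that conf by (auto simp: \<phi>'_def config_def)
          moreover have zero: "\<phi>' e = 0" if "e \<in> S" "\<phi> e = 0" for e
            using that by (simp add: \<phi>'_def E_def)
          ultimately have new: "config U \<phi>' C" "price \<phi>' C \<le> price \<phi> C"
            using config_flow[of U \<phi> C \<phi>'] conf by auto
          have "{e \<in> S. \<phi>' e \<noteq> 0} \<subset> E"
          proof -
            have "{e \<in> S. \<phi>' e \<noteq> 0} \<subseteq> E" using zero by (auto simp: E_def)
            moreover obtain e where "e \<in> E" "\<phi>' e = 0" using a by (auto simp: \<phi>'_def)
            ultimately show ?thesis by blast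
          qed
          from shrink[OF new refl this] show ?thesis .
        qed
      qed
    qed
  qed
qed

lemma sum_mset_image_sum:
  "(\<Sum>g\<in>#(\<Sum>j<n::nat. M j). f g) = (\<Sum>j<n. \<Sum>g\<in>#M j. f g)" for f :: "'c \<Rightarrow> 'd::comm_monoid_add"
  by (induction n) simp_all

lemma der_complete:
  assumes K: "K \<subseteq> S \<union> set vs" and flow: "unit_flow p s t (set vs) K \<phi>"
  shows "\<exists>v c. der items v c \<and> c \<le> sum w K"
proof -
  have ends: "pos (2 * j + 2) = fst (vs ! j)" "pos (2 * j + 3) = snd (vs ! j)"
    "amount (2 * j + 2) = - 1" "amount (2 * j + 3) = 1"
    "charge (2 * j + 2) = w (vs ! j)" "charge (2 * j + 3) = 0"
    "pos 0 = s" "pos 1 = t" "amount 0 = p" "amount 1 = - p" "charge 0 = 0" "charge 1 = 0" for j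
    by (auto simp: pos_def amount_def charge_def)
  define J where "J = {j. j < length vs \<and> vs ! j \<in> K \<and> \<phi> (vs ! j) = 1}"
  define g where "g i = ({i}, pos i, charge i)" for i
  \<comment> \<open>A discarded pair is balanced, so its position is arbitrary; \<open>s\<close> is
    merely a vertex at hand.\<close>
  define h where "h j = ({2 * j + 2, 2 * j + 3 :: nat}, s, 0 :: int)" for j
  define C where "C = {#g 0, g 1#} +
    (\<Sum>j<length vs. if j \<in> J then {#g (2 * j + 2), g (2 * j + 3)#} else {#h j#})"
  have sum_C: "(\<Sum>x\<in>#C. f x) = f (g 0) + f (g 1) +
      (\<Sum>j<length vs. if j \<in> J then f (g (2 * j + 2)) + f (g (2 * j + 3)) else f (h j))"
    for f :: "_ \<Rightarrow> 'd::comm_monoid_add"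
    unfolding C_def by (simp add: sum_mset_image_sum if_distrib ac_simps cong: if_cong)
  define \<psi> where "\<psi> e = (if e \<in> K then real_of_int (\<phi> e) else 0)" for e
  have nonneg: "0 \<le> \<phi> e" if "e \<in> K" for e using flow that unfolding unit_flow_def by blast
  have K_fin: "finite K" using K finite_S finite_subset[of K "S \<union> set vs"] by simp
  have K_split: "K = (K \<inter> S) \<union> (K \<inter> set vs)" "(K \<inter> S) \<inter> (K \<inter> set vs) = {}"
    using K S_vs by blast+
  have inj: "inj_on (\<lambda>j. vs ! j) J"
    using distinct_vs by (auto simp: J_def inj_on_def nth_eq_iff_index_eq)
  have J: "(\<lambda>j. vs ! j) ` J \<subseteq> K \<inter> set vs" "finite J" by (auto simp: J_def)
  have J_sum: "(\<Sum>j<length vs. if j \<in> J then f j else 0) = sum f J" for f :: "nat \<Rightarrow> 'd::comm_monoid_add"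
    by (rule sum.mono_neutral_cong_right) (auto simp: J_def)
  \<comment> \<open>Integrality is used here: a vulnerable edge carries 0 or 1, so it is either used
    in full or not at all.\<close>
  have outside: "\<phi> e = 0" if e: "e \<in> K \<inter> set vs - (\<lambda>j. vs ! j) ` J" for e
  proof -
    obtain j where "j < length vs" "e = vs ! j" using e by (auto simp: in_set_conv_nth)
    then have "\<phi> e \<noteq> 1" using e by (auto simp: J_def)
    moreover have "\<phi> e \<le> 1" using e flow unfolding unit_flow_def by blast
    ultimately show ?thesis using nonneg[of e] e by auto
  qed
  have w_nonneg: "0 \<le> w e" if "e \<in> S \<union> set vs" for e using w_pos[OF that] by simp
  have net_vs: "net (K \<inter> set vs) \<phi> x = (\<Sum>j\<in>J. of_bool (fst (vs ! j) = x) - of_bool (snd (vs ! j) = x))" for x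
  proof -
    have "net (K \<inter> set vs) \<phi> x = net ((\<lambda>j. vs ! j) ` J) \<phi> x"
      using J K_fin outside by (intro net_superset) auto
    also have "\<dots> = (\<Sum>j\<in>J. of_bool (fst (vs ! j) = x) - of_bool (snd (vs ! j) = x))"
      unfolding net_def sum.reindex[OF inj] by (intro sum.cong) (auto simp: J_def)
    finally show ?thesis .
  qed
  have net_K: "net K \<phi> x = net (K \<inter> S) \<phi> x + net (K \<inter> set vs) \<phi> x" for x
    using K_fin K_split(2) by (subst K_split(1), intro net_union) auto
  have net_\<psi>: "net S \<psi> x = of_int (net (K \<inter> S) \<phi> x)" for x
  proof -
    have "net S \<psi> x = net (K \<inter> S) \<psi> x"
      using finite_S by (intro net_superset) (auto simp: \<psi>_def)
    then show ?thesis by (simp add: net_def \<psi>_def)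
  qed
  have "config items \<psi> C"
    unfolding config_def
  proof (intro conjI allI ballI)
    show "C \<noteq> {#}" by (simp add: C_def)
    fix x assume "x \<in># C"
    then consider (two) "x = g 0 \<or> x = g 1"
      | (ends) j where "j < length vs" "x = g (2 * j + 2) \<or> x = g (2 * j + 3)"
      | (pair) j where "j < length vs" "x = h j"
      unfolding C_def by (auto simp: set_mset_sum split: if_splits)
    then consider i where "i \<in> items" "x = g i" | j where "j < length vs" "x = h j"
    proof cases
      case two
      then show ?thesis using that(1)[of 0] that(1)[of 1] by auto
    next
      case (ends j)
      then show ?thesis using that(1)[of "2 * j + 2"] that(1)[of "2 * j + 3"] by auto
    next
      case (pair j)
      then show ?thesis using that(2)[of j] by simp
    qed
    then show "der (fst x) (fst (snd x)) (snd (snd x))"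
      using der.single der.skip s_in by cases (auto simp: g_def h_def)
  next
    fix e assume "e \<in> S"
    then show "0 \<le> \<psi> e" using nonneg[of e] by (simp add: \<psi>_def)
  next
    fix i
    have "(\<Sum>x\<in>#C. of_bool (i \<in> fst x)) = (\<Sum>k\<in>items. of_bool (i = k) :: nat)"
      unfolding sum_C sum_items by (auto simp: g_def h_def intro!: sum.cong)
    also have "\<dots> = of_bool (i \<in> items)" by (simp add: of_bool_def)
    finally show "(\<Sum>x\<in>#C. of_bool (i \<in> fst x)) = (of_bool (i \<in> items) :: nat)" .
  next
    fix x
    have "(\<Sum>y\<in>#C. of_int (total (fst y)) * of_bool (fst (snd y) = x))
        = of_int p * of_bool (s = x) - of_int p * of_bool (t = x) +
          (\<Sum>j<length vs. if j \<in> J then of_bool (snd (vs ! j) = x) - of_bool (fst (vs ! j) = x) else 0 :: real)"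
      unfolding sum_C g_def h_def by (simp add: ends ends[simplified] cong: if_cong)
    also have "\<dots> = of_int (p * (of_bool (x = s) - of_bool (x = t)) - net (K \<inter> set vs) \<phi> x)"
      unfolding J_sum net_vs by (simp add: sum_subtractf eq_commute right_diff_distrib)
    also have "p * (of_bool (x = s) - of_bool (x = t)) = net K \<phi> x"
      using flow by (simp add: unit_flow_def)
    finally show "net S \<psi> x = (\<Sum>y\<in>#C. of_int (total (fst y)) * of_bool (fst (snd y) = x))"
      by (simp add: net_\<psi> net_K)
  qed
  from config_collapse[OF this] obtain v c where vc: "der items v c" "c \<le> price \<psi> C" by blast
  have "(\<Sum>x\<in>#C. snd (snd x)) = (\<Sum>j<length vs. if j \<in> J then w (vs ! j) else 0)"
    unfolding sum_C g_def h_def by (simp add: ends ends[simplified] cong: if_cong)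
  also have "\<dots> = sum w ((\<lambda>j. vs ! j) ` J)"
    unfolding J_sum sum.reindex[OF inj] by simp
  also have "\<dots> \<le> sum w (K \<inter> set vs)"
    using J K_fin w_nonneg by (intro sum_mono2) auto
  finally have 1: "(\<Sum>x\<in>#C. snd (snd x)) \<le> sum w (K \<inter> set vs)" .
  have 2: "sum w {e \<in> S. \<psi> e \<noteq> 0} \<le> sum w (K \<inter> S)"
    using K_fin w_nonneg by (intro sum_mono2) (auto simp: \<psi>_def)
  have "sum w K = sum w (K \<inter> S) + sum w (K \<inter> set vs)"
    using K_fin K_split(2) by (subst K_split(1), intro sum.union_disjoint) auto
  then have "c \<le> sum w K" using vc(2) 1 2 by (simp add: price_def)
  then show ?thesis using vc(1) by blast
qed

section \<open>Relocating a group: free jumps and shortest paths\<close>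

text \<open>\<open>pre X v c\<close>: the last rule applied is not one that relocates the group.\<close>

definition pre :: "nat set \<Rightarrow> 'v \<Rightarrow> int \<Rightarrow> bool" where
  "pre X v c \<longleftrightarrow> (\<exists>i\<in>items. X = {i} \<and> v = pos i \<and> c = charge i) \<or>
     (\<exists>j<length vs. X = {2 * j + 2, 2 * j + 3} \<and> v \<in> V \<and> c = 0) \<or>
     (\<exists>A B a b. A \<inter> B = {} \<and> X = A \<union> B \<and> der A v a \<and> der B v b \<and> c = a + b)"

lemma pre_in: "pre X v c \<Longrightarrow> v \<in> V"
  unfolding pre_def by (elim disjE exE bexE conjE) (auto simp: pos_in dest: der_props)

lemma pre_single: "i \<in> items \<Longrightarrow> pre {i} (pos i) (charge i)"
  unfolding pre_def by (intro disjI1) blast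

lemma pre_skip: "j < length vs \<Longrightarrow> v \<in> V \<Longrightarrow> pre {2 * j + 2, 2 * j + 3} v 0"
  unfolding pre_def by (rule disjI2, rule disjI1, rule exI[of _ j]) simp

lemma pre_merge: "der A v a \<Longrightarrow> der B v b \<Longrightarrow> A \<inter> B = {} \<Longrightarrow> pre (A \<union> B) v (a + b)"
  unfolding pre_def
  by (rule disjI2, rule disjI2, rule exI[of _ A], rule exI[of _ B], rule exI[of _ a], rule exI[of _ b]) simp

lemma der_cases:
  assumes "der X v c"
  obtains "pre X v c" | u a d where "der X u a" "move X u v d" "c = a + d"
    | u where "der X u c" "total X = 0" "v \<in> V"
  using assms
proof (cases rule: der.cases)
  case (single i)
  then show ?thesis using that(1) pre_single by simp
next
  case (skip j)
  then show ?thesis using that(1) pre_skip by simp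
next
  case (merge A a B b)
  then show ?thesis using that(1) pre_merge by simp
next
  case (move u c d)
  then show ?thesis using that(2) by blast
next
  case (jump u)
  then show ?thesis using that(3) by blast
qed

text \<open>A balanced group cannot \<open>move\<close>, so only jumps separate its derivation from
  the last rule that does not relocate, and jumps keep the cost. One exchange among all vertices
  therefore replaces a shortest-path computation.\<close>

lemma der_jump_pre:
  assumes "der X v c" "total X = 0"
  shows "\<exists>u\<in>V. pre X u c"
  using assms
proof (induction X v c rule: der.induct)
  case (single i)
  then show ?case using pre_single pos_in by blast
next
  case (skip j v)
  then show ?case using pre_skip by blast
next
  case (merge A v a B b)
  then have "pre (A \<union> B) v (a + b)" by (intro pre_merge)
  then show ?case using pre_in by blast
next
  case (move X u c v d)
  then show ?case by (simp add: move_def)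
next
  case (jump X u c v)
  then show ?case by simp
qed

text \<open>Bellman-Ford: as the weights are positive, a vertex whose distance is still wrong after \<open>r\<close>
  rounds is preceded by more than \<open>r\<close> vertices of smaller distance.\<close>

lemma bellman_ford:
  fixes f :: "nat \<Rightarrow> 'v \<Rightarrow> int"
  assumes tot: "total X \<noteq> 0"
    and base: "\<And>v c. pre X v c \<Longrightarrow> f 0 v \<le> c"
    and mono: "\<And>r v. r < card V \<Longrightarrow> v \<in> V \<Longrightarrow> f (Suc r) v \<le> f r v"
    and relax: "\<And>r u v d. r < card V \<Longrightarrow> move X u v d \<Longrightarrow> f (Suc r) v \<le> f r u + d"
    and "der X v c"
  shows "f (card V) v \<le> c"
proof -
  \<comment> \<open>Costs of derivations are nonnegative, so a least one exists at \<open>v\<close>;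
    taking \<open>nat\<close> turns this into minimization over the natural numbers.\<close>
  obtain c0 where c0: "der X v c0" and "\<And>b. der X v b \<Longrightarrow> nat c0 \<le> nat b"
    using ex_has_least_nat[of "der X v" c nat] \<open>der X v c\<close> by blast
  then have least: "c0 \<le> b" if "der X v b" for b
    using that der_props[of X v b] der_props[of X v c0] by fastforce
  have "f r v \<le> c \<or> r < card {u \<in> V. \<exists>a<c. der X u a}"
    if "r \<le> card V" "der X v c" "\<And>b. der X v b \<Longrightarrow> c \<le> b" for r v c
    using that
  proof (induction r arbitrary: v c)
    case 0
    from \<open>der X v c\<close> show ?case
    proof (cases rule: der_cases)
      case 1
      then show ?thesis using base by simp
    next
      case (2 u a d)
      then have "1 \<le> d" "u \<in> V"
        using w_pos[of "(u, v)"] w_pos[of "(v, u)"] der_props[of X u a] by (auto simp: move_def)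
      then have "u \<in> {u \<in> V. \<exists>a<c. der X u a}" using 2 by force
      then show ?thesis using finite_V by (auto simp: card_gt_0_iff)
    next
      case 3
      then show ?thesis using tot by simp
    qed
  next
    case (Suc r)
    from \<open>der X v c\<close> show ?case
    proof (cases rule: der_cases)
      case 1
      have "f q v \<le> f 0 v" if "q \<le> card V" for q
        using that
      proof (induction q)
        case (Suc q)
        then show ?case using mono[of q v] pre_in[OF 1] by simp
      qed simp
      then show ?thesis using base[OF 1] Suc.prems by fastforce
    next
      case (2 u a d)
      then have d: "1 \<le> d" "u \<in> V"
        using w_pos[of "(u, v)"] w_pos[of "(v, u)"] der_props[of X u a] by (auto simp: move_def)
      have min: "a \<le> b" if "der X u b" for b
        using Suc.prems(3)[OF der.move[OF that 2(2)]] 2(3) by simp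
      let ?A = "{x \<in> V. \<exists>b<a. der X x b}"
      have "f r u \<le> a \<or> r < card ?A" using Suc.prems(1) by (intro Suc.IH 2(1) min) auto
      moreover have "f (Suc r) v \<le> c" if "f r u \<le> a"
        using relax[of r u v d] Suc.prems 2 that by simp
      moreover have "Suc r < card {x \<in> V. \<exists>b<c. der X x b}" if "r < card ?A"
      proof -
        \<comment> \<open>The predecessor \<open>u\<close> is not cheaper than itself but is cheaper
          than \<open>v\<close>, so stepping back along an optimal derivation makes the set of
          cheaper vertices strictly smaller.\<close>
        have "u \<notin> ?A" using min by fastforce
        then have "card (insert u ?A) = Suc (card ?A)" using finite_V by simp
        moreover have "insert u ?A \<subseteq> {x \<in> V. \<exists>b<c. der X x b}"
        proof -
          have "a < c" using 2(3) d by simp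
          then show ?thesis using 2(1) d(2) by (auto intro: order.strict_trans)
        qed
        then have "card (insert u ?A) \<le> card {x \<in> V. \<exists>b<c. der X x b}"
          using finite_V by (intro card_mono) auto
        ultimately show ?thesis using that by simp
      qed
      ultimately show ?thesis by blast
    next
      case 3
      then show ?thesis using tot by simp
    qed
  qed
  \<comment> \<open>After \<open>card V\<close> rounds the second alternative would ask for more
    than \<open>card V\<close> cheaper vertices.\<close>
  from this[of "card V" v c0] have "f (card V) v \<le> c0 \<or> card V < card {u \<in> V. \<exists>a<c0. der X u a}"
    using c0 least by simp
  moreover have "card {u \<in> V. \<exists>a<c0. der X u a} \<le> card V"
    using finite_V by (intro card_mono) auto
  ultimately show ?thesis using least[OF \<open>der X v c\<close>] by simp
qed

end

section \<open>Timed triples\<close>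

text \<open>A triple of total correctness with an upper bound on the number of steps. The initial
  store is an explicit argument, so that postconditions may refer to it.\<close>

definition runs :: "com \<Rightarrow> store \<Rightarrow> nat \<Rightarrow> (store \<Rightarrow> bool) \<Rightarrow> bool" where
  "runs c \<sigma> T Q \<longleftrightarrow> (\<exists>t \<tau>. exec c \<sigma> t \<tau> \<and> t \<le> T \<and> Q \<tau>)"

lemma runs_mono: "runs c \<sigma> T Q \<Longrightarrow> T \<le> T' \<Longrightarrow> (\<And>\<tau>. Q \<tau> \<Longrightarrow> Q' \<tau>) \<Longrightarrow> runs c \<sigma> T' Q'"
  unfolding runs_def using le_trans by blast

lemma runs_Skip: "Q \<sigma> \<Longrightarrow> 1 \<le> T \<Longrightarrow> runs Skip \<sigma> T Q"
  unfolding runs_def using exec_Skip by blast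

lemma runs_Assign:
  "Q (\<sigma>(x := (\<sigma> x)(aval a \<sigma> := aval b \<sigma>))) \<Longrightarrow> acost a + acost b + 1 \<le> T
    \<Longrightarrow> runs (Assign x a b) \<sigma> T Q"
  unfolding runs_def using exec_Assign by blast

lemma runs_Seq:
  assumes "runs c \<sigma> T R" "\<And>\<rho>. R \<rho> \<Longrightarrow> runs d \<rho> T' Q"
  shows "runs (Seq c d) \<sigma> (T + T') Q"
proof -
  obtain t \<rho> where 1: "exec c \<sigma> t \<rho>" "t \<le> T" "R \<rho>" using assms(1) by (auto simp: runs_def)
  obtain t' \<tau> where 2: "exec d \<rho> t' \<tau>" "t' \<le> T'" "Q \<tau>"
    using assms(2)[OF 1(3)] by (auto simp: runs_def)
  show ?thesis
    unfolding runs_def using exec_Seq[OF 1(1) 2(1)] 1(2) 2(2,3) add_mono by blast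
qed

lemma runs_Seq_Assign:
  "runs d (\<sigma>(x := (\<sigma> x)(aval a \<sigma> := aval b \<sigma>))) T Q
    \<Longrightarrow> runs (Seq (Assign x a b) d) \<sigma> (acost a + acost b + 1 + T) Q"
  by (rule runs_Seq[OF runs_Assign[OF _ le_refl]]) auto

lemma runs_If:
  assumes "bval b \<sigma> \<Longrightarrow> runs c \<sigma> T Q" "\<not> bval b \<sigma> \<Longrightarrow> runs d \<sigma> T Q"
    and "bcost b + T + 1 \<le> T'"
  shows "runs (If b c d) \<sigma> T' Q"
proof (cases "bval b \<sigma>")
  case True
  then obtain t \<tau> where "exec c \<sigma> t \<tau>" "t \<le> T" "Q \<tau>" using assms by (auto simp: runs_def)
  then show ?thesis unfolding runs_def using exec_If_True[OF True] assms(3) by fastforce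
next
  case False
  then obtain t \<tau> where "exec d \<sigma> t \<tau>" "t \<le> T" "Q \<tau>" using assms by (auto simp: runs_def)
  then show ?thesis unfolding runs_def using exec_If_False[OF False] assms(3) by fastforce
qed

primrec writes :: "com \<Rightarrow> vname set" where
  "writes Skip = {}"
| "writes (Assign x a b) = {x}"
| "writes (Seq c d) = writes c \<union> writes d"
| "writes (If b c d) = writes c \<union> writes d"
| "writes (While b c) = writes c"

lemma exec_frame: "exec c \<sigma> t \<tau> \<Longrightarrow> x \<notin> writes c \<Longrightarrow> \<tau> x = \<sigma> x"
  by (induction rule: exec.induct) auto

definition agree :: "vname set \<Rightarrow> store \<Rightarrow> store \<Rightarrow> bool" where
  "agree W \<sigma> \<tau> \<longleftrightarrow> (\<forall>x. x \<notin> W \<longrightarrow> \<tau> x = \<sigma> x)"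

lemma agreeD: "agree W \<sigma> \<tau> \<Longrightarrow> x \<notin> W \<Longrightarrow> \<tau> x = \<sigma> x"
  by (simp add: agree_def)

text \<open>The frame rule: postconditions speak only of the arrays that a program changes, and
  everything else is recovered from its syntactic write set.\<close>

lemma runs_frame: "runs c \<sigma> T Q \<Longrightarrow> runs c \<sigma> T (\<lambda>\<tau>. Q \<tau> \<and> agree (writes c) \<sigma> \<tau>)"
  unfolding runs_def agree_def using exec_frame by blast

abbreviation Var :: "vname \<Rightarrow> aexp" where "Var x \<equiv> Cell x (Num 0)"
abbreviation Set :: "vname \<Rightarrow> aexp \<Rightarrow> com" where "Set x a \<equiv> Assign x (Num 0) a"

definition Eq :: "aexp \<Rightarrow> aexp \<Rightarrow> bexp" where
  "Eq a b = And (Not (Less a b)) (Not (Less b a))"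

lemma bval_Eq [simp]: "bval (Eq a b) \<sigma> \<longleftrightarrow> aval a \<sigma> = aval b \<sigma>"
  by (auto simp: Eq_def)

lemma bcost_Eq [simp]: "bcost (Eq a b) = 2 * acost a + 2 * acost b + 5"
  by (simp add: Eq_def)

definition For :: "vname \<Rightarrow> vname \<Rightarrow> com \<Rightarrow> com" where
  "For x y c = Seq (Set x (Num 0))
     (While (Less (Var x) (Var y)) (Seq c (Set x (Plus (Var x) (Num 1)))))"

lemma writes_For [simp]: "writes (For x y c) = insert x (writes c)"
  by (auto simp: For_def)

text \<open>Induction on the number \<open>k\<close> of iterations still to come. The test takes 6
  steps and the increment 6, which gives 12 per iteration; the first assignment (3) and the final
  failing test (6) give 9. The bound \<open>y\<close> is reread each time, so the body must not
  write it, and the invariant must not depend on the counter \<open>x\<close>, which is increased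
  after the body.\<close>

lemma runs_For:
  assumes bound: "\<sigma> y 0 = int N" and "x \<noteq> y" "x \<notin> writes c" "y \<notin> writes c"
    and indep: "\<And>i \<tau> f. Inv i \<tau> \<Longrightarrow> Inv i (\<tau>(x := f))"
    and init: "Inv 0 \<sigma>"
    and step: "\<And>i \<tau>. i < N \<Longrightarrow> Inv i \<tau> \<Longrightarrow> \<tau> x 0 = int i \<Longrightarrow> agree (insert x (writes c)) \<sigma> \<tau>
      \<Longrightarrow> runs c \<tau> (T i) (Inv (Suc i))"
  shows "runs (For x y c) \<sigma> ((\<Sum>i<N. T i) + 12 * N + 9)
    (\<lambda>\<tau>. Inv N \<tau> \<and> agree (insert x (writes c)) \<sigma> \<tau>)"
proof -
  let ?W = "insert x (writes c)" and ?b = "Less (Var x) (Var y)"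
  let ?c = "Seq c (Set x (Plus (Var x) (Num 1)))"
  have loop: "runs (While ?b ?c) \<tau> ((\<Sum>i\<in>{N - k..<N}. T i) + 12 * k + 6)
      (\<lambda>\<tau>. Inv N \<tau> \<and> agree ?W \<sigma> \<tau>)"
    if "k \<le> N" "Inv (N - k) \<tau>" "\<tau> x 0 = int (N - k)" "agree ?W \<sigma> \<tau>" for k \<tau>
    using that
  proof (induction k arbitrary: \<tau>)
    case 0
    then have "\<tau> y 0 = int N" using bound assms(2,4) by (simp add: agree_def)
    then have "exec (While ?b ?c) \<tau> (bcost ?b + 1) \<tau>"
      using 0 by (intro exec_While_False) simp
    then show ?case using 0 unfolding runs_def by fastforce
  next
    case (Suc k)
    let ?i = "N - Suc k"
    have "\<tau> y 0 = int N" using bound assms(2,4) Suc.prems by (simp add: agree_def)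
    then have b: "bval ?b \<tau>" using Suc.prems by simp
    have "runs c \<tau> (T ?i) (Inv (Suc ?i))" using Suc.prems by (intro step) auto
    from runs_frame[OF this] obtain t \<rho> where \<rho>: "exec c \<tau> t \<rho>" "t \<le> T ?i" "Inv (Suc ?i) \<rho>"
      "agree (writes c) \<tau> \<rho>"
      unfolding runs_def by blast
    define \<rho>' where "\<rho>' = \<rho>(x := (\<rho> x)(0 := \<rho> x 0 + 1))"
    have "exec (Set x (Plus (Var x) (Num 1))) \<rho> 6 \<rho>'"
      using exec_Assign[of x "Num 0" "Plus (Var x) (Num 1)" \<rho>]
      by (simp add: \<rho>'_def eval_nat_numeral)
    with \<rho>(1) have body: "exec ?c \<tau> (t + 6) \<rho>'" by (rule exec_Seq)
    have "Inv (N - k) \<rho>'" using indep[OF \<rho>(3)] Suc.prems(1) by (simp add: \<rho>'_def Suc_diff_Suc)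
    moreover have "\<rho>' x 0 = int (N - k)"
      using \<rho>(4) assms(3) Suc.prems by (simp add: \<rho>'_def agree_def)
    moreover have "agree ?W \<sigma> \<rho>'" using \<rho>(4) Suc.prems by (simp add: \<rho>'_def agree_def)
    ultimately have "runs (While ?b ?c) \<rho>' ((\<Sum>i\<in>{N - k..<N}. T i) + 12 * k + 6)
        (\<lambda>\<tau>. Inv N \<tau> \<and> agree ?W \<sigma> \<tau>)"
      using Suc by simp
    then obtain t' \<tau>' where \<tau>': "exec (While ?b ?c) \<rho>' t' \<tau>'"
      "t' \<le> (\<Sum>i\<in>{N - k..<N}. T i) + 12 * k + 6" "Inv N \<tau>'" "agree ?W \<sigma> \<tau>'"
      unfolding runs_def by blast
    have "exec (While ?b ?c) \<tau> (bcost ?b + (t + 6) + t' + 1) \<tau>'"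
      by (rule exec_While_True[OF b body \<tau>'(1)])
    moreover have "{N - Suc k..<N} = insert ?i {N - k..<N}" using Suc.prems(1) by auto
    then have "(\<Sum>i\<in>{N - Suc k..<N}. T i) = T ?i + (\<Sum>i\<in>{N - k..<N}. T i)"
      using Suc.prems(1) by simp
    ultimately show ?case
      using \<rho>(2) \<tau>' unfolding runs_def
      by (intro exI[of _ "bcost ?b + (t + 6) + t' + 1"] exI[of _ \<tau>']) simp
  qed
  have "runs (While ?b ?c) (\<sigma>(x := (\<sigma> x)(0 := 0))) ((\<Sum>i\<in>{N - N..<N}. T i) + 12 * N + 6)
      (\<lambda>\<tau>. Inv N \<tau> \<and> agree ?W \<sigma> \<tau>)"
    by (rule loop) (use init indep in \<open>auto simp: agree_def\<close>)
  then have "runs (While ?b ?c) (\<sigma>(x := (\<sigma> x)(aval (Num 0) \<sigma> := aval (Num 0) \<sigma>)))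
      ((\<Sum>i\<in>{N - N..<N}. T i) + 12 * N + 6) (\<lambda>\<tau>. Inv N \<tau> \<and> agree ?W \<sigma> \<tau>)" by simp
  from runs_Seq_Assign[OF this] show ?thesis
    unfolding For_def by (rule runs_mono) (simp_all add: atLeast0LessThan)
qed

lemma runs_For_const:
  assumes "\<sigma> y 0 = int N" "x \<noteq> y" "x \<notin> writes c" "y \<notin> writes c"
    and "\<And>i \<tau> f. Inv i \<tau> \<Longrightarrow> Inv i (\<tau>(x := f))" "Inv 0 \<sigma>"
    and "\<And>i \<tau>. i < N \<Longrightarrow> Inv i \<tau> \<Longrightarrow> \<tau> x 0 = int i \<Longrightarrow> agree (insert x (writes c)) \<sigma> \<tau>
      \<Longrightarrow> runs c \<tau> T (Inv (Suc i))"
  shows "runs (For x y c) \<sigma> (N * (T + 12) + 9)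
    (\<lambda>\<tau>. Inv N \<tau> \<and> agree (insert x (writes c)) \<sigma> \<tau>)"
  by (rule runs_mono[OF runs_For[where T = "\<lambda>_. T", OF assms]]) (simp_all add: algebra_simps)

lemma agree_mono: "agree W \<sigma> \<tau> \<Longrightarrow> W \<subseteq> W' \<Longrightarrow> agree W' \<sigma> \<tau>"
  by (auto simp: agree_def)

lemma runs_Seq_Assign_at:
  "runs d (\<sigma>(x := (\<sigma> x)(i := v))) T Q \<Longrightarrow> aval a \<sigma> = i \<Longrightarrow> aval b \<sigma> = v
    \<Longrightarrow> acost a + acost b + 1 + T \<le> T' \<Longrightarrow> runs (Seq (Assign x a b) d) \<sigma> T' Q"
  using runs_mono[OF runs_Seq_Assign[of d \<sigma> x a b T Q], of T' Q] by simp

lemma runs_Assign_at: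
  "Q (\<sigma>(x := (\<sigma> x)(i := v))) \<Longrightarrow> aval a \<sigma> = i \<Longrightarrow> aval b \<sigma> = v
    \<Longrightarrow> acost a + acost b + 1 \<le> T \<Longrightarrow> runs (Assign x a b) \<sigma> T Q"
  using runs_Assign[of Q \<sigma> x a b T] by simp

section \<open>Relaxation\<close>

definition lower :: "(int \<Rightarrow> int) \<Rightarrow> int \<Rightarrow> int \<Rightarrow> int \<Rightarrow> int" where
  "lower F i v = F(i := min (F i) v)"

definition Relax :: "aexp \<Rightarrow> aexp \<Rightarrow> com" where
  "Relax a b = If (Less b (Cell ''tab'' a)) (Assign ''tab'' a b) Skip"

lemma writes_Relax [simp]: "writes (Relax a b) = {''tab''}"
  by (simp add: Relax_def)

text \<open>The test and the assignment evaluate both expressions once each, hence the factors 2;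
  when the value is no improvement, \<open>lower\<close> is the identity and skipping is
  correct.\<close>

lemma runs_Relax:
  assumes "Q (\<sigma>(''tab'' := lower (\<sigma> ''tab'') (aval a \<sigma>) (aval b \<sigma>)))"
    and "2 * acost a + 2 * acost b + 4 \<le> T"
  shows "runs (Relax a b) \<sigma> T Q"
  unfolding Relax_def
proof (rule runs_If)
  assume "bval (Less b (Cell ''tab'' a)) \<sigma>"
  then show "runs (Assign ''tab'' a b) \<sigma> (acost a + acost b + 1) Q"
    using assms(1) by (intro runs_Assign) (simp_all add: lower_def min_def)
next
  assume "\<not> bval (Less b (Cell ''tab'' a)) \<sigma>"
  then have "lower (\<sigma> ''tab'') (aval a \<sigma>) (aval b \<sigma>) = \<sigma> ''tab''"
    by (simp add: lower_def min_def)
  with assms(1) have "Q \<sigma>" by (metis fun_upd_triv)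
  then show "runs Skip \<sigma> (acost a + acost b + 1) Q" by (rule runs_Skip) simp
qed (use assms(2) in simp)

section \<open>The program\<close>

abbreviation Here :: "aexp \<Rightarrow> aexp" where
  "Here a \<equiv> Plus (Cell ''row'' (Var ''X'')) a"

text \<open>\<open>L\<close> is one more than the budget, or 0 if that is negative, and plays the
  role of infinity in the table.\<close>

definition "Fill = For ''v'' ''n'' (Assign ''tab'' (Here (Var ''v'')) (Var ''L''))"

text \<open>The mask under construction is \<open>2^i + x\<close>; for \<open>x = 0\<close> it is
  the singleton of item \<open>i\<close>.\<close>

definition "Single = If (Eq (Var ''x'') (Num 0))
  (Relax (Here (Cell ''pos'' (Var ''i''))) (Cell ''cost'' (Var ''i''))) Skip"

text \<open>\<open>second\<close> marks the heads of vulnerable edges, and \<open>H\<close> is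
  \<open>2^(i-1)\<close>. So the test singles out the mask of the pair of items \<open>i - 1\<close>
  and \<open>i\<close>, the two ends of one edge.\<close>

definition "Discard = If (And (Eq (Cell ''second'' (Var ''i'')) (Num 1)) (Eq (Var ''x'') (Var ''H'')))
  (For ''v'' ''n'' (Relax (Here (Var ''v'')) (Num 0))) Skip"

text \<open>Sets of items are coded by bit masks. The machine has no bit operations; \<open>y \<le> X\<close> is a submask
  of \<open>X\<close> if and only if the numbers of bits of \<open>y\<close> and \<open>X - y\<close> add up to that of \<open>X\<close>.\<close>

definition "Merge = For ''y'' ''X''
  (If (And (Less (Num 0) (Var ''y''))
      (Eq (Plus (Cell ''bits'' (Var ''y'')) (Cell ''bits'' (Minus (Var ''X'') (Var ''y''))))
        (Cell ''bits'' (Var ''X''))))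
    (For ''v'' ''n'' (Relax (Here (Var ''v''))
      (Plus (Cell ''tab'' (Plus (Cell ''row'' (Var ''y'')) (Var ''v'')))
        (Cell ''tab'' (Plus (Cell ''row'' (Minus (Var ''X'') (Var ''y''))) (Var ''v''))))))
    Skip)"

definition "Jump = For ''u'' ''n'' (For ''v'' ''n''
  (Relax (Here (Var ''v'')) (Cell ''tab'' (Here (Var ''u'')))))"

text \<open>Bellman-Ford with \<open>n\<close> rounds over the safe edges. The arrays
  \<open>a\<close> and \<open>b\<close> hold tails and heads; exchanging them reverses all edges, as
  a group with negative total requires.\<close>

definition "Edges a b = For ''r'' ''n'' (For ''e'' ''m''
  (If (Eq (Cell ''vulnerable'' (Var ''e'')) (Num 0))
    (Relax (Here (Cell b (Var ''e'')))
      (Plus (Cell ''tab'' (Here (Cell a (Var ''e'')))) (Cell ''weight'' (Var ''e''))))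
    Skip))"

definition "Close = If (Eq (Cell ''sum'' (Var ''X'')) (Num 0)) Jump
  (If (Less (Num 0) (Cell ''sum'' (Var ''X'')))
    (Edges ''tail'' ''head'') (Edges ''head'' ''tail''))"

text \<open>The row address continues that of the preceding mask by \<open>n\<close>, in place of a
  product. Supply and bit count are inherited from \<open>x\<close>, the mask without its top item
  \<open>i\<close>.\<close>

definition "Setup = Seq (Set ''X'' (Plus (Var ''P'') (Var ''x'')))
  (Seq (Assign ''row'' (Var ''X'') (Plus (Cell ''row'' (Minus (Var ''X'') (Num 1))) (Var ''n'')))
  (Seq (Assign ''sum'' (Var ''X'') (Plus (Cell ''sum'' (Var ''x'')) (Cell ''gain'' (Var ''i''))))
    (Assign ''bits'' (Var ''X'') (Plus (Cell ''bits'' (Var ''x'')) (Num 1)))))"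

definition "Mask = Seq Setup (Seq Fill (Seq Single (Seq Discard (Seq Merge Close))))"

text \<open>Level \<open>i\<close> treats the masks from \<open>P = 2^i\<close> up to
  \<open>2 P - 1\<close>, whose top item is \<open>i\<close>. The old \<open>P\<close> survives as
  \<open>H\<close>, the bit of the preceding item.\<close>

definition "Level = Seq (For ''x'' ''P'' Mask)
  (Seq (Set ''H'' (Var ''P'')) (Set ''P'' (Plus (Var ''P'') (Var ''P''))))"

definition "Init = Seq (Set ''P'' (Num 1)) (Seq (Set ''H'' (Num 0))
  (Seq (Assign ''row'' (Num 0) (Num 0)) (Seq (Assign ''sum'' (Num 0) (Num 0)) (Assign ''bits'' (Num 0) (Num 0)))))"

definition "Ends = Seq (Assign ''pos'' (Num 0) (Var ''s'')) (Seq (Assign ''cost'' (Num 0) (Num 0))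
  (Seq (Assign ''gain'' (Num 0) (Var ''p'')) (Seq (Assign ''second'' (Num 0) (Num 0))
  (Seq (Assign ''pos'' (Num 1) (Var ''t'')) (Seq (Assign ''cost'' (Num 1) (Num 0))
  (Seq (Assign ''gain'' (Num 1) (Minus (Num 0) (Var ''p''))) (Assign ''second'' (Num 1) (Num 0))))))))"

definition "Item = Seq (Set ''c'' (Plus (Plus (Var ''j'') (Var ''j'')) (Num 2)))
  (Seq (Assign ''pos'' (Var ''c'') (Cell ''tail'' (Cell ''sel'' (Var ''j''))))
  (Seq (Assign ''cost'' (Var ''c'') (Cell ''weight'' (Cell ''sel'' (Var ''j''))))
  (Seq (Assign ''gain'' (Var ''c'') (Num (- 1)))
  (Seq (Assign ''second'' (Var ''c'') (Num 0))
  (Seq (Assign ''pos'' (Plus (Var ''c'') (Num 1)) (Cell ''head'' (Cell ''sel'' (Var ''j''))))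
  (Seq (Assign ''cost'' (Plus (Var ''c'') (Num 1)) (Num 0))
  (Seq (Assign ''gain'' (Plus (Var ''c'') (Num 1)) (Num 1))
    (Assign ''second'' (Plus (Var ''c'') (Num 1)) (Num 1)))))))))"

text \<open>Computes the maximum of 0 and \<open>y + 1\<close>, both for the flow value from
  \<open>k\<close> and for the strict cost limit from the budget.\<close>

definition "Clamp x y = If (Less (Var y) (Num 0)) (Set x (Num 0)) (Set x (Plus (Var y) (Num 1)))"

definition "Prep = Seq (Clamp ''p'' ''k'') (Seq (Clamp ''L'' ''l'') (Seq Ends
  (Seq (For ''j'' ''q'' Item) (Set ''I'' (Plus (Plus (Var ''q'') (Var ''q'')) (Num 2))))))"

text \<open>\<open>P - 1\<close> is the mask of all items, and the row address itself is the cell of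
  vertex 0. The answer is set but never reset, so that repeated calls accumulate.\<close>

definition "Check = If (Less (Cell ''tab'' (Cell ''row'' (Minus (Var ''P'') (Num 1)))) (Var ''L''))
  (Set ''answer'' (Num 1)) Skip"

definition "Core = Seq Prep (Seq Init (Seq (For ''i'' ''I'' Level) Check))"

section \<open>Bit masks\<close>

lemma set_decode_div2: "set_decode z = (if odd z then {0} else {}) \<union> Suc ` set_decode (z div 2)"
proof -
  have "i \<in> set_decode z \<longleftrightarrow> i \<in> (if odd z then {0} else {}) \<union> Suc ` set_decode (z div 2)" for i
    by (cases i) auto
  then show ?thesis by blast
qed

abbreviation pop :: "nat \<Rightarrow> nat" where "pop z \<equiv> card (set_decode z)"

lemma pop_div2: "pop z = z mod 2 + pop (z div 2)"
  by (subst set_decode_div2) (auto simp: card_image odd_iff_mod_2_eq_one card_insert_if)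

lemma pop_Suc: "pop (Suc z) \<le> Suc (pop z)"
proof (induction z rule: less_induct)
  case (less z)
  show ?case
  proof (cases "even z")
    case True
    then show ?thesis using pop_div2[of "Suc z"] pop_div2[of z] by (simp add: even_iff_mod_2_eq_zero)
  next
    case False
    then have "Suc z div 2 = Suc (z div 2)" "z div 2 < z" "Suc z mod 2 = 0" "z mod 2 = 1"
      by presburger+
    then show ?thesis using less[of "z div 2"] pop_div2[of "Suc z"] pop_div2[of z] by simp
  qed
qed

text \<open>Each carry of an addition loses a bit.\<close>

lemma pop_add:
  "pop (a + b) \<le> pop a + pop b \<and>
   (pop a + pop b \<le> pop (a + b) \<longrightarrow> set_decode a \<inter> set_decode b = {})"
proof (induction a arbitrary: b rule: less_induct)
  case (less a)
  show ?case
  proof (cases "a = 0")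
    case True
    then show ?thesis by simp
  next
    case False
    then have "a div 2 < a" by simp
    note IH = less[OF this, of "b div 2"]
    note pops = pop_div2[of "a + b"] pop_div2[of a] pop_div2[of b]
    show ?thesis
    proof (cases "odd a \<and> odd b")
      case True
      then have "(a + b) div 2 = Suc (a div 2 + b div 2)" "(a + b) mod 2 = 0" "a mod 2 = 1" "b mod 2 = 1"
        by presburger+
      then show ?thesis using IH pops pop_Suc[of "a div 2 + b div 2"] by simp
    next
      case False
      then have "(a + b) div 2 = a div 2 + b div 2" "(a + b) mod 2 = a mod 2 + b mod 2"
        by presburger+
      moreover have "set_decode a \<inter> set_decode b = {}"
        if "set_decode (a div 2) \<inter> set_decode (b div 2) = {}"
        using that False set_decode_div2[of a] set_decode_div2[of b] by auto
      ultimately show ?thesis using IH pops by simp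
    qed
  qed
qed

lemma set_decode_disjoint_add:
  assumes "set_decode a \<inter> set_decode b = {}"
  shows "set_decode (a + b) = set_decode a \<union> set_decode b"
proof -
  have "set_encode (set_decode a \<union> set_decode b) = a + b"
    using assms sum.union_disjoint[of "set_decode a" "set_decode b" "power (2 :: nat)"]
      set_decode_inverse[of a] set_decode_inverse[of b] by (simp add: set_encode_def)
  then show ?thesis by (metis finite_UnI finite_set_decode set_encode_inverse)
qed

lemma pop_split:
  assumes "pop y + pop (x - y) = pop x" "y \<le> x"
  shows "set_decode y \<inter> set_decode (x - y) = {}" "set_decode x = set_decode y \<union> set_decode (x - y)"
proof -
  show *: "set_decode y \<inter> set_decode (x - y) = {}" using pop_add[of y "x - y"] assms by simp
  show "set_decode x = set_decode y \<union> set_decode (x - y)"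
    using set_decode_disjoint_add[OF *] assms(2) by simp
qed

lemma pop_split_exists:
  assumes "A \<inter> B = {}" "set_decode x = A \<union> B" "A \<noteq> {}" "B \<noteq> {}"
  shows "\<exists>y. 0 < y \<and> y < x \<and> set_decode y = A \<and> set_decode (x - y) = B \<and>
    pop y + pop (x - y) = pop x"
proof -
  have fin: "finite A" "finite B" using assms(2) finite_set_decode[of x] by simp_all
  define y z where "y = set_encode A" and "z = set_encode B"
  have dec: "set_decode y = A" "set_decode z = B"
    using fin by (simp_all add: y_def z_def set_encode_inverse)
  have "set_decode x = set_decode (y + z)"
    using set_decode_disjoint_add[of y z] assms dec by simp
  then have x: "x = y + z" by (metis set_decode_inverse)
  have "y \<noteq> 0" "z \<noteq> 0" using dec assms(3,4) by auto
  moreover have "pop y + pop z = pop x" using dec assms fin by (simp add: card_Un_disjoint)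
  ultimately show ?thesis using dec x by (intro exI[of _ y]) simp
qed

section \<open>The table of the dynamic program\<close>

locale ftp_core = steiner "{..<n}" S w vs s t p
  for n :: nat and S w vs s t p +
  fixes es :: "(nat \<times> nat) list" and L :: int
  assumes S_es: "S \<subseteq> set es" and L_nonneg: "0 \<le> L" and es_V: "set es \<subseteq> {..<n} \<times> {..<n}"
begin

abbreviation dec :: "nat \<Rightarrow> nat set" where "dec \<equiv> set_decode"

definition cell :: "nat \<Rightarrow> nat \<Rightarrow> int" where
  "cell Z v = int (Z * n + v)"

lemma cell_inj: "v < n \<Longrightarrow> v' < n \<Longrightarrow> cell Z v = cell Z' v' \<longleftrightarrow> Z = Z' \<and> v = v'"
proof -
  assume *: "v < n" "v' < n"
  have "(Z * n + v) div n = Z" "(Z' * n + v') div n = Z'" using * by simp_all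
  then have "Z * n + v = Z' * n + v' \<longleftrightarrow> Z = Z' \<and> v = v'" by (metis add_left_imp_eq)
  then show ?thesis unfolding cell_def of_nat_eq_iff .
qed

text \<open>Entries equal to \<open>L\<close> mean that nothing affordable is known; only smaller
  ones have to be costs of derivations.\<close>

definition sound :: "nat \<Rightarrow> (int \<Rightarrow> int) \<Rightarrow> bool" where
  "sound X F \<longleftrightarrow> (\<forall>v<n. F (cell X v) \<le> L \<and> (F (cell X v) < L \<longrightarrow> der (dec X) v (F (cell X v))))"

definition complete :: "nat \<Rightarrow> (int \<Rightarrow> int) \<Rightarrow> bool" where
  "complete X F \<longleftrightarrow> (\<forall>v<n. \<forall>c. der (dec X) v c \<longrightarrow> F (cell X v) \<le> c)"

text \<open>The progress made on row \<open>X\<close> since the table \<open>F\<close>: rows of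
  smaller masks are frozen, row \<open>X\<close> only decreases and stays sound. Cells of later rows
  are left open, as they are filled when their turn comes.\<close>

definition improves :: "nat \<Rightarrow> (int \<Rightarrow> int) \<Rightarrow> (int \<Rightarrow> int) \<Rightarrow> bool" where
  "improves X F G \<longleftrightarrow> (\<forall>Z<X. \<forall>v<n. G (cell Z v) = F (cell Z v)) \<and>
     (\<forall>v<n. G (cell X v) \<le> F (cell X v)) \<and> sound X G"

lemma improves_refl: "sound X F \<Longrightarrow> improves X F F"
  by (simp add: improves_def)

lemma improves_trans: "improves X F G \<Longrightarrow> improves X G H \<Longrightarrow> improves X F H"
  unfolding improves_def by (metis order_trans)

lemma improves_le: "improves X F G \<Longrightarrow> v < n \<Longrightarrow> G (cell X v) \<le> F (cell X v)"
  by (simp add: improves_def)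

lemma improves_lower:
  assumes "improves X F G" "v < n" "b < L \<Longrightarrow> der (dec X) v b"
  shows "improves X F (lower G (cell X v) b)"
proof -
  have other: "lower G (cell X v) b (cell Z u) = G (cell Z u)"
    if "u < n" "Z \<noteq> X \<or> u \<noteq> v" for Z u
    using cell_inj[OF \<open>u < n\<close> \<open>v < n\<close>, of Z X] that by (auto simp: lower_def)
  have "lower G (cell X v) b (cell X u) \<le> F (cell X u) \<and>
      lower G (cell X v) b (cell X u) \<le> L \<and>
      (lower G (cell X v) b (cell X u) < L \<longrightarrow> der (dec X) u (lower G (cell X v) b (cell X u)))"
    if "u < n" for u
  proof -
    have "G (cell X u) \<le> F (cell X u)" "G (cell X u) \<le> L"
      "G (cell X u) < L \<longrightarrow> der (dec X) u (G (cell X u))"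
      using assms(1) that by (simp_all add: improves_def sound_def)
    then show ?thesis
      using other[OF that, of X] assms(3) by (cases "u = v") (auto simp: lower_def min_def)
  qed
  moreover have "\<forall>Z<X. \<forall>u<n. lower G (cell X v) b (cell Z u) = F (cell Z u)"
    using other assms(1) by (simp add: improves_def)
  ultimately show ?thesis by (simp add: improves_def sound_def)
qed

lemma runs_Relax_improves:
  assumes "improves X F (\<tau> ''tab'')" "aval a \<tau> = cell X v" "v < n"
    and "aval b \<tau> < L \<Longrightarrow> der (dec X) v (aval b \<tau>)"
    and "2 * acost a + 2 * acost b + 4 \<le> T"
    and "\<And>G. improves X F G \<Longrightarrow> G (cell X v) \<le> aval b \<tau> \<Longrightarrow> (\<And>i. G i \<le> \<tau> ''tab'' i)
      \<Longrightarrow> Q (\<tau>(''tab'' := G))"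
  shows "runs (Relax a b) \<tau> T Q"
  using assms improves_lower[OF assms(1,3), of "aval b \<tau>"]
  by (intro runs_Relax assms(6)) (auto simp: lower_def)

text \<open>Weights are tied down on safe edges only: those of vulnerable edges enter the
  computation through the costs of the items.\<close>

definition env :: "nat \<Rightarrow> store \<Rightarrow> bool" where
  "env X \<sigma> \<longleftrightarrow> \<sigma> ''X'' 0 = int X \<and> \<sigma> ''n'' 0 = int n \<and> \<sigma> ''m'' 0 = int (length es) \<and> \<sigma> ''L'' 0 = L \<and>
     (\<forall>e<length es. \<sigma> ''tail'' (int e) = int (fst (es ! e)) \<and> \<sigma> ''head'' (int e) = int (snd (es ! e)) \<and>
        (es ! e \<in> S \<longrightarrow> \<sigma> ''weight'' (int e) = w (es ! e)) \<and>
        (\<sigma> ''vulnerable'' (int e) = 0 \<longleftrightarrow> es ! e \<in> S)) \<and>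
     (\<forall>Z\<le>X. \<sigma> ''row'' (int Z) = int (Z * n) \<and> \<sigma> ''sum'' (int Z) = total (dec Z) \<and>
        \<sigma> ''bits'' (int Z) = int (pop Z))"

lemma env_agree:
  assumes "env X \<sigma>" "agree W \<sigma> \<tau>" "W \<subseteq> {''tab'', ''u'', ''v'', ''y'', ''e'', ''r''}"
  shows "env X \<tau>"
proof -
  have "\<tau> z = \<sigma> z" if "z \<notin> {''tab'', ''u'', ''v'', ''y'', ''e'', ''r''}" for z
    using assms(2,3) that unfolding agree_def by blast
  then show ?thesis using assms(1) unfolding env_def by simp
qed

section \<open>Correctness of the phases that compute one row\<close>

lemma runs_Fill:
  assumes env: "env X \<sigma>"
  shows "runs Fill \<sigma> (n * 21 + 9) (\<lambda>\<tau>. agree {''v'', ''tab''} \<sigma> \<tau> \<and>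
    (\<forall>Z<X. \<forall>v<n. \<tau> ''tab'' (cell Z v) = \<sigma> ''tab'' (cell Z v)) \<and> (\<forall>v<n. \<tau> ''tab'' (cell X v) = L))"
proof -
  define Inv where "Inv i \<tau> \<longleftrightarrow> (\<forall>Z<X. \<forall>v<n. \<tau> ''tab'' (cell Z v) = \<sigma> ''tab'' (cell Z v)) \<and>
      (\<forall>v<i. \<tau> ''tab'' (cell X v) = L)" for i and \<tau> :: store
  have "runs Fill \<sigma> (n * (9 + 12) + 9) (\<lambda>\<tau>. Inv n \<tau> \<and>
      agree (insert ''v'' (writes (Assign ''tab'' (Here (Var ''v'')) (Var ''L'')))) \<sigma> \<tau>)"
    unfolding Fill_def
  proof (rule runs_For_const)
    show "\<sigma> ''n'' 0 = int n" using env by (simp add: env_def)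
    fix i \<tau>
    assume i: "i < n" and inv: "Inv i \<tau>" and v: "\<tau> ''v'' 0 = int i"
      and ag: "agree (insert ''v'' (writes (Assign ''tab'' (Here (Var ''v'')) (Var ''L'')))) \<sigma> \<tau>"
    have "env X \<tau>" by (rule env_agree[OF env ag]) simp
    then have ev: "aval (Here (Var ''v'')) \<tau> = cell X i" "aval (Var ''L'') \<tau> = L"
      using v by (simp_all add: env_def cell_def)
    have "Inv (Suc i) (\<tau>(''tab'' := (\<tau> ''tab'')(cell X i := L)))"
      using inv i by (auto simp: Inv_def cell_inj less_Suc_eq)
    then show "runs (Assign ''tab'' (Here (Var ''v'')) (Var ''L'')) \<tau> 9 (Inv (Suc i))"
      by (intro runs_Assign) (simp_all only: ev, simp)
  qed (simp_all add: Inv_def)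
  then show ?thesis by (rule runs_mono) (auto simp: Inv_def)
qed

lemma runs_Single:
  assumes env: "env X \<sigma>" and snd: "sound X (\<sigma> ''tab'')"
    and "\<sigma> ''x'' 0 = int x" "\<sigma> ''i'' 0 = int i" "i \<in> items"
    and "\<sigma> ''pos'' (int i) = int (pos i)" "\<sigma> ''cost'' (int i) = charge i"
    and x: "x = 0 \<Longrightarrow> dec X = {i}"
  shows "runs Single \<sigma> 40 (\<lambda>\<tau>. agree {''tab''} \<sigma> \<tau> \<and> improves X (\<sigma> ''tab'') (\<tau> ''tab'') \<and>
    (x = 0 \<longrightarrow> \<tau> ''tab'' (cell X (pos i)) \<le> charge i))"
proof -
  let ?Q = "\<lambda>\<tau>. agree {''tab''} \<sigma> \<tau> \<and> improves X (\<sigma> ''tab'') (\<tau> ''tab'') \<and>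
    (x = 0 \<longrightarrow> \<tau> ''tab'' (cell X (pos i)) \<le> charge i)"
  let ?a = "Here (Cell ''pos'' (Var ''i''))" and ?b = "Cell ''cost'' (Var ''i'')"
  show ?thesis
    unfolding Single_def
  proof (rule runs_If[where T = 25])
    assume "bval (Eq (Var ''x'') (Num 0)) \<sigma>"
    then have "x = 0" using assms(3) by simp
    then have "dec X = {i}" using x by simp
    then have "der (dec X) (pos i) (charge i)" using assms(5) der.single by simp
    have here: "aval ?a \<sigma> = cell X (pos i)" and val: "aval ?b \<sigma> = charge i"
      using env assms(4,6,7) by (simp_all add: env_def cell_def)
    have "pos i < n" using pos_in[OF assms(5)] by simp
    then show "runs (Relax ?a ?b) \<sigma> 25 ?Q"
    proof (rule runs_Relax_improves[OF improves_refl[OF snd] here])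
      show "der (dec X) (pos i) (aval ?b \<sigma>)" unfolding val by fact
      show "2 * acost ?a + 2 * acost ?b + 4 \<le> 25" by simp
      fix G assume "improves X (\<sigma> ''tab'') G" "G (cell X (pos i)) \<le> aval ?b \<sigma>"
      then show "?Q (\<sigma>(''tab'' := G))" unfolding val by (simp add: agree_def)
    qed
  next
    assume "\<not> bval (Eq (Var ''x'') (Num 0)) \<sigma>"
    then have "?Q \<sigma>" using snd assms(3) by (simp add: agree_def improves_refl)
    then show "runs Skip \<sigma> 25 ?Q" by - (rule runs_Skip, assumption, simp)
  qed simp
qed

lemma runs_Discard:
  assumes env: "env X \<sigma>" and snd: "sound X (\<sigma> ''tab'')"
    and "\<sigma> ''x'' 0 = int x" "\<sigma> ''i'' 0 = int i" "\<sigma> ''H'' 0 = int h"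
    and "\<sigma> ''second'' (int i) = of_bool (odd i \<and> i \<noteq> 1)"
    and x: "odd i \<Longrightarrow> i \<noteq> 1 \<Longrightarrow> x = h \<Longrightarrow> \<exists>j<length vs. dec X = {2 * j + 2, 2 * j + 3}"
  shows "runs Discard \<sigma> (n * 40 + 40) (\<lambda>\<tau>. agree {''v'', ''tab''} \<sigma> \<tau> \<and>
    improves X (\<sigma> ''tab'') (\<tau> ''tab'') \<and>
    (odd i \<and> i \<noteq> 1 \<and> x = h \<longrightarrow> (\<forall>v<n. \<tau> ''tab'' (cell X v) \<le> 0)))"
proof -
  let ?Q = "\<lambda>\<tau>. agree {''v'', ''tab''} \<sigma> \<tau> \<and> improves X (\<sigma> ''tab'') (\<tau> ''tab'') \<and>
    (odd i \<and> i \<noteq> 1 \<and> x = h \<longrightarrow> (\<forall>v<n. \<tau> ''tab'' (cell X v) \<le> 0))"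
  show ?thesis
    unfolding Discard_def
  proof (rule runs_If[where T = "n * (18 + 12) + 9"])
    assume "bval (And (Eq (Cell ''second'' (Var ''i'')) (Num 1)) (Eq (Var ''x'') (Var ''H''))) \<sigma>"
    then have "odd i" "i \<noteq> 1" "x = h" using assms by (auto split: if_splits)
    then obtain j where j: "j < length vs" "dec X = {2 * j + 2, 2 * j + 3}" using x by blast
    have base: "der (dec X) v 0" if "v < n" for v using der.skip j that by simp
    let ?c = "Relax (Here (Var ''v'')) (Num 0)"
    define Inv where "Inv k \<tau> \<longleftrightarrow> improves X (\<sigma> ''tab'') (\<tau> ''tab'') \<and>
      (\<forall>v<k. \<tau> ''tab'' (cell X v) \<le> 0)" for k and \<tau> :: store
    have "runs (For ''v'' ''n'' ?c) \<sigma> (n * (18 + 12) + 9)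
        (\<lambda>\<tau>. Inv n \<tau> \<and> agree (insert ''v'' (writes ?c)) \<sigma> \<tau>)"
    proof (rule runs_For_const)
      show "\<sigma> ''n'' 0 = int n" using env by (simp add: env_def)
      show "Inv 0 \<sigma>" using snd by (simp add: Inv_def improves_refl)
      fix k \<tau>
      assume k: "k < n" and inv: "Inv k \<tau>" and v: "\<tau> ''v'' 0 = int k"
        and ag: "agree (insert ''v'' (writes ?c)) \<sigma> \<tau>"
      have "env X \<tau>" by (rule env_agree[OF env ag]) simp
      then have here: "aval (Here (Var ''v'')) \<tau> = cell X k" using v by (simp add: env_def cell_def)
      show "runs ?c \<tau> 18 (Inv (Suc k))"
      proof (rule runs_Relax_improves[OF _ here k])
        show "improves X (\<sigma> ''tab'') (\<tau> ''tab'')" using inv by (simp add: Inv_def)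
        show "der (dec X) k (aval (Num 0) \<tau>)" using base k by simp
        fix G assume G: "improves X (\<sigma> ''tab'') G" "G (cell X k) \<le> aval (Num 0) \<tau>"
          "\<And>i. G i \<le> \<tau> ''tab'' i"
        then show "Inv (Suc k) (\<tau>(''tab'' := G))"
          using inv by (auto simp: Inv_def less_Suc_eq intro: order_trans[OF G(3)])
      qed simp
    qed (simp_all add: Inv_def)
    then show "runs (For ''v'' ''n'' ?c) \<sigma> (n * (18 + 12) + 9) ?Q"
      by (rule runs_mono) (auto simp: Inv_def)
  next
    assume "\<not> bval (And (Eq (Cell ''second'' (Var ''i'')) (Num 1)) (Eq (Var ''x'') (Var ''H''))) \<sigma>"
    then have "?Q \<sigma>" using snd assms(3-6) by (auto simp: agree_def improves_refl)
    then show "runs Skip \<sigma> (n * (18 + 12) + 9) ?Q" by - (rule runs_Skip, assumption, simp)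
  qed simp
qed

text \<open>For \<open>0 < y < X\<close> both \<open>y\<close> and \<open>X - y\<close> are smaller
  than \<open>X\<close>, so their rows are finished and do not change meanwhile; this is why the
  bound may refer to the initial table. The mask \<open>y = 0\<close> is excluded since the row of
  the empty set contains no derivations.\<close>

lemma runs_Merge:
  assumes env: "env X \<sigma>" and snd: "sound X (\<sigma> ''tab'')"
    and below: "\<And>Z. 0 < Z \<Longrightarrow> Z < X \<Longrightarrow> sound Z (\<sigma> ''tab'')"
  shows "runs Merge \<sigma> (X * (n * 80 + 60) + 9) (\<lambda>\<tau>. agree {''y'', ''v'', ''tab''} \<sigma> \<tau> \<and>
    improves X (\<sigma> ''tab'') (\<tau> ''tab'') \<and>
    (\<forall>y<X. 0 < y \<and> pop y + pop (X - y) = pop X \<longrightarrow>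
      (\<forall>v<n. \<tau> ''tab'' (cell X v) \<le> \<sigma> ''tab'' (cell y v) + \<sigma> ''tab'' (cell (X - y) v))))"
proof -
  define F where "F = \<sigma> ''tab''"
  let ?val = "Plus (Cell ''tab'' (Plus (Cell ''row'' (Var ''y'')) (Var ''v'')))
        (Cell ''tab'' (Plus (Cell ''row'' (Minus (Var ''X'') (Var ''y''))) (Var ''v'')))"
  let ?c = "Relax (Here (Var ''v'')) ?val"
  let ?test = "And (Less (Num 0) (Var ''y''))
      (Eq (Plus (Cell ''bits'' (Var ''y'')) (Cell ''bits'' (Minus (Var ''X'') (Var ''y''))))
        (Cell ''bits'' (Var ''X'')))"
  let ?d = "If ?test (For ''v'' ''n'' ?c) Skip"
  define Inv where "Inv k \<tau> \<longleftrightarrow> improves X F (\<tau> ''tab'') \<and>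
      (\<forall>y<k. 0 < y \<and> pop y + pop (X - y) = pop X \<longrightarrow>
        (\<forall>v<n. \<tau> ''tab'' (cell X v) \<le> F (cell y v) + F (cell (X - y) v)))" for k and \<tau> :: store
  have "runs Merge \<sigma> (X * ((n * 68 + 46) + 12) + 9)
      (\<lambda>\<tau>. Inv X \<tau> \<and> agree (insert ''y'' (writes ?d)) \<sigma> \<tau>)"
    unfolding Merge_def
  proof (rule runs_For_const)
    show "\<sigma> ''X'' 0 = int X" using env by (simp add: env_def)
    show "Inv 0 \<sigma>" using snd by (simp add: Inv_def improves_refl F_def)
    fix y \<tau>
    assume y: "y < X" and inv: "Inv y \<tau>" and yv: "\<tau> ''y'' 0 = int y"
      and ag: "agree (insert ''y'' (writes ?d)) \<sigma> \<tau>"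
    have env': "env X \<tau>" by (rule env_agree[OF env ag]) simp
    have minus: "int X - int y = int (X - y)" using y by simp
    have test: "bval ?test \<tau> \<longleftrightarrow> 0 < y \<and> pop y + pop (X - y) = pop X"
      using env' yv y by (auto simp: env_def minus simp flip: of_nat_add simp del: of_nat_diff)
    show "runs ?d \<tau> (n * 68 + 46) (Inv (Suc y))"
    proof (rule runs_If[where T = "n * (52 + 12) + 9"])
      assume "bval ?test \<tau>"
      then have pop: "0 < y" "pop y + pop (X - y) = pop X" using test by simp_all
      then have dec: "dec y \<inter> dec (X - y) = {}" "dec X = dec y \<union> dec (X - y)"
        using pop_split[of y X] y by simp_all
      define Inv' where "Inv' k \<rho> \<longleftrightarrow> Inv y \<rho> \<and>
        (\<forall>v<k. \<rho> ''tab'' (cell X v) \<le> F (cell y v) + F (cell (X - y) v))" for k and \<rho> :: store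
      have "runs (For ''v'' ''n'' ?c) \<tau> (n * (52 + 12) + 9)
          (\<lambda>\<rho>. Inv' n \<rho> \<and> agree (insert ''v'' (writes ?c)) \<tau> \<rho>)"
      proof (rule runs_For_const)
        show "\<tau> ''n'' 0 = int n" using env' by (simp add: env_def)
        show "Inv' 0 \<tau>" using inv by (simp add: Inv'_def)
        fix v \<rho>
        assume v: "v < n" and inv': "Inv' v \<rho>" and vv: "\<rho> ''v'' 0 = int v"
          and ag': "agree (insert ''v'' (writes ?c)) \<tau> \<rho>"
        have env'': "env X \<rho>" by (rule env_agree[OF env' ag']) simp
        have yr: "\<rho> ''y'' 0 = int y" using agreeD[OF ag', of "''y''"] yv by simp
        have here: "aval (Here (Var ''v'')) \<rho> = cell X v"
          using env'' vv by (simp add: env_def cell_def)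
        have imp: "improves X F (\<rho> ''tab'')" using inv' by (simp add: Inv'_def Inv_def)
        have "aval ?val \<rho> = \<rho> ''tab'' (cell y v) + \<rho> ''tab'' (cell (X - y) v)"
          using env'' vv yr y by (simp add: env_def cell_def minus del: of_nat_diff)
        also have "\<dots> = F (cell y v) + F (cell (X - y) v)"
          using imp v y \<open>0 < y\<close> by (simp add: improves_def)
        finally have val: "aval ?val \<rho> = F (cell y v) + F (cell (X - y) v)" .
        have der: "der (dec X) v (aval ?val \<rho>)" if "aval ?val \<rho> < L"
        proof -
          \<comment> \<open>Entries are nonnegative, so a sum below \<open>L\<close> forces both
            summands below \<open>L\<close>, and both are then costs of genuine derivations.\<close>
          have entry: "0 \<le> F (cell Z v)" "F (cell Z v) < L \<Longrightarrow> der (dec Z) v (F (cell Z v))"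
            if "0 < Z" "Z < X" for Z
          proof -
            have *: "F (cell Z v) \<le> L" "F (cell Z v) < L \<Longrightarrow> der (dec Z) v (F (cell Z v))"
              using below[OF that] v by (simp_all add: sound_def F_def)
            then show "F (cell Z v) < L \<Longrightarrow> der (dec Z) v (F (cell Z v))" by blast
            show "0 \<le> F (cell Z v)"
              using * der_props[of "dec Z" v "F (cell Z v)"] L_nonneg by (cases "F (cell Z v) < L") auto
          qed
          have rest: "0 < X - y" "X - y < X" using y \<open>0 < y\<close> by simp_all
          have "F (cell y v) < L" "F (cell (X - y) v) < L"
            using \<open>aval ?val \<rho> < L\<close> val entry(1)[OF \<open>0 < y\<close> y] entry(1)[OF rest] by linarith+
          then have "der (dec y) v (F (cell y v))" "der (dec (X - y)) v (F (cell (X - y) v))"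
            using entry(2)[OF \<open>0 < y\<close> y] entry(2)[OF rest] by blast+
          from der.merge[OF this dec(1)] show ?thesis using dec(2) val by simp
        qed
        show "runs ?c \<rho> 52 (Inv' (Suc v))"
        proof (rule runs_Relax_improves[OF imp here v der])
          fix G assume G: "improves X F G" "G (cell X v) \<le> aval ?val \<rho>" "\<And>i. G i \<le> \<rho> ''tab'' i"
          then show "Inv' (Suc v) (\<rho>(''tab'' := G))"
            using inv' unfolding Inv'_def Inv_def val
            by (auto simp: less_Suc_eq intro: order_trans[OF G(3)])
        qed simp_all
      qed (simp_all add: Inv'_def Inv_def)
      then show "runs (For ''v'' ''n'' ?c) \<tau> (n * (52 + 12) + 9) (Inv (Suc y))"
        by (rule runs_mono) (auto simp: Inv'_def Inv_def less_Suc_eq)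
    next
      assume "\<not> bval ?test \<tau>"
      then have "Inv (Suc y) \<tau>" using inv test by (auto simp: Inv_def less_Suc_eq)
      then show "runs Skip \<tau> (n * (52 + 12) + 9) (Inv (Suc y))" by - (rule runs_Skip, assumption, simp)
    qed simp
  qed (simp_all add: Inv_def)
  then show ?thesis by (rule runs_mono) (auto simp: Inv_def F_def insert_commute)
qed


lemma improves_der:
  "improves X F G \<Longrightarrow> v < n \<Longrightarrow> G (cell X v) < L \<Longrightarrow> der (dec X) v (G (cell X v))"
  by (simp add: improves_def sound_def)

text \<open>The sweep may read entries that it has already lowered. This does no harm: the bound is
  relative to the initial row, and lowered entries are smaller still.\<close>

lemma runs_Jump:
  assumes env: "env X \<sigma>" and snd: "sound X (\<sigma> ''tab'')" and tot: "total (dec X) = 0"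
  shows "runs Jump \<sigma> (n * (n * 42 + 21) + 9) (\<lambda>\<tau>. agree {''u'', ''v'', ''tab''} \<sigma> \<tau> \<and>
    improves X (\<sigma> ''tab'') (\<tau> ''tab'') \<and>
    (\<forall>u<n. \<forall>v<n. \<tau> ''tab'' (cell X v) \<le> \<sigma> ''tab'' (cell X u)))"
proof -
  define F where "F = \<sigma> ''tab''"
  let ?val = "Cell ''tab'' (Here (Var ''u''))"
  let ?c = "Relax (Here (Var ''v'')) ?val"
  let ?d = "For ''v'' ''n'' ?c"
  define Inv where "Inv k \<tau> \<longleftrightarrow> improves X F (\<tau> ''tab'') \<and>
      (\<forall>u<k. \<forall>v<n. \<tau> ''tab'' (cell X v) \<le> F (cell X u))" for k and \<tau> :: store
  have "runs Jump \<sigma> (n * ((n * (30 + 12) + 9) + 12) + 9)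
      (\<lambda>\<tau>. Inv n \<tau> \<and> agree (insert ''u'' (writes ?d)) \<sigma> \<tau>)"
    unfolding Jump_def
  proof (rule runs_For_const)
    show "\<sigma> ''n'' 0 = int n" using env by (simp add: env_def)
    show "Inv 0 \<sigma>" using snd by (simp add: Inv_def improves_refl F_def)
    fix u \<tau>
    assume u: "u < n" and inv: "Inv u \<tau>" and uv: "\<tau> ''u'' 0 = int u"
      and ag: "agree (insert ''u'' (writes ?d)) \<sigma> \<tau>"
    have env': "env X \<tau>" by (rule env_agree[OF env ag]) simp
    define Inv' where "Inv' k \<rho> \<longleftrightarrow> Inv u \<rho> \<and> (\<forall>v<k. \<rho> ''tab'' (cell X v) \<le> F (cell X u))"
      for k and \<rho> :: store
    have "runs ?d \<tau> (n * (30 + 12) + 9) (\<lambda>\<rho>. Inv' n \<rho> \<and> agree (insert ''v'' (writes ?c)) \<tau> \<rho>)"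
    proof (rule runs_For_const)
      show "\<tau> ''n'' 0 = int n" using env' by (simp add: env_def)
      show "Inv' 0 \<tau>" using inv by (simp add: Inv'_def)
      fix v \<rho>
      assume v: "v < n" and inv': "Inv' v \<rho>" and vv: "\<rho> ''v'' 0 = int v"
        and ag': "agree (insert ''v'' (writes ?c)) \<tau> \<rho>"
      have env'': "env X \<rho>" by (rule env_agree[OF env' ag']) simp
      have ur: "\<rho> ''u'' 0 = int u" using agreeD[OF ag', of "''u''"] uv by simp
      have here: "aval (Here (Var ''v'')) \<rho> = cell X v"
        using env'' vv by (simp add: env_def cell_def)
      have val: "aval ?val \<rho> = \<rho> ''tab'' (cell X u)" using env'' ur by (simp add: env_def cell_def)
      have imp: "improves X F (\<rho> ''tab'')" using inv' by (simp add: Inv'_def Inv_def)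
      show "runs ?c \<rho> 30 (Inv' (Suc v))"
      proof (rule runs_Relax_improves[OF imp here v])
        assume "aval ?val \<rho> < L"
        then have "der (dec X) u (aval ?val \<rho>)"
          unfolding val by (rule improves_der[OF imp u])
        then show "der (dec X) v (aval ?val \<rho>)" by (rule der.jump[OF _ tot]) (use v in simp)
      next
        fix G assume G: "improves X F G" "G (cell X v) \<le> aval ?val \<rho>" "\<And>i. G i \<le> \<rho> ''tab'' i"
        have "G (cell X v) \<le> F (cell X u)" using G(2) improves_le[OF imp u] unfolding val by linarith
        then show "Inv' (Suc v) (\<rho>(''tab'' := G))"
          using G(1) inv' unfolding Inv'_def Inv_def
          by (auto simp: less_Suc_eq intro: order_trans[OF G(3)])
      qed simp
    qed (simp_all add: Inv'_def Inv_def)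
    then show "runs ?d \<tau> (n * (30 + 12) + 9) (Inv (Suc u))"
      by (rule runs_mono) (auto simp: Inv'_def Inv_def less_Suc_eq)
  qed (simp_all add: Inv_def)
  then show ?thesis by (rule runs_mono) (auto simp: Inv_def F_def insert_commute)
qed

text \<open>The ends \<open>A\<close> and \<open>B\<close> are parameters, which lets one proof
  serve both directions; \<open>moves\<close> says that they run in the direction in which the group
  travels.\<close>

lemma runs_Edges:
  assumes env: "env X \<sigma>" and snd: "sound X (\<sigma> ''tab'')" and tot: "total (dec X) \<noteq> 0"
    and names: "a \<notin> {''tab'', ''u'', ''v'', ''y'', ''e'', ''r''}" "b \<notin> {''tab'', ''u'', ''v'', ''y'', ''e'', ''r''}"
    and ends: "\<And>e. e < length es \<Longrightarrow> \<sigma> a (int e) = int (A e)" "\<And>e. e < length es \<Longrightarrow> \<sigma> b (int e) = int (B e)"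
    and bounds: "\<And>e. e < length es \<Longrightarrow> A e < n" "\<And>e. e < length es \<Longrightarrow> B e < n"
    and moves: "\<And>u v d. move (dec X) u v d \<longleftrightarrow>
      (\<exists>e<length es. es ! e \<in> S \<and> A e = u \<and> B e = v \<and> d = w (es ! e))"
    and base: "\<And>v c. pre (dec X) v c \<Longrightarrow> \<sigma> ''tab'' (cell X v) \<le> c"
  shows "runs (Edges a b) \<sigma> (n * (length es * 68 + 21) + 9) (\<lambda>\<tau>. agree {''r'', ''e'', ''tab''} \<sigma> \<tau> \<and>
    improves X (\<sigma> ''tab'') (\<tau> ''tab'') \<and> complete X (\<tau> ''tab''))"
proof -
  define F where "F = \<sigma> ''tab''"
  let ?val = "Plus (Cell ''tab'' (Here (Cell a (Var ''e'')))) (Cell ''weight'' (Var ''e''))"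
  let ?c = "Relax (Here (Cell b (Var ''e''))) ?val"
  let ?test = "Eq (Cell ''vulnerable'' (Var ''e'')) (Num 0)"
  let ?i = "If ?test ?c Skip"
  let ?d = "For ''e'' ''m'' ?i"
  \<comment> \<open>The history of row \<open>X\<close> after each round, as needed for
    \<open>bellman_ford\<close>. Relaxing in place is at least as good as relaxing from the row at
    the beginning of the round.\<close>
  define chain where "chain k G f \<longleftrightarrow> f 0 = (\<lambda>v. F (cell X v)) \<and>
      f k = (\<lambda>v. G (cell X v)) \<and> (\<forall>r<k. \<forall>v<n. f (Suc r) v \<le> f r v) \<and>
      (\<forall>r<k. \<forall>u v d. move (dec X) u v d \<longrightarrow> f (Suc r) v \<le> f r u + d)"
    for k G and f :: "nat \<Rightarrow> nat \<Rightarrow> int"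
  define Inv where "Inv k \<tau> \<longleftrightarrow> improves X F (\<tau> ''tab'') \<and> (\<exists>f. chain k (\<tau> ''tab'') f)"
    for k and \<tau> :: store
  have "runs (Edges a b) \<sigma> (n * ((length es * (56 + 12) + 9) + 12) + 9)
      (\<lambda>\<tau>. Inv n \<tau> \<and> agree (insert ''r'' (writes ?d)) \<sigma> \<tau>)"
    unfolding Edges_def
  proof (rule runs_For_const)
    show "\<sigma> ''n'' 0 = int n" using env by (simp add: env_def)
    show "Inv 0 \<sigma>"
      using snd by (auto simp: Inv_def improves_refl F_def chain_def)
    fix r \<tau>
    assume r: "r < n" and inv: "Inv r \<tau>" and rv: "\<tau> ''r'' 0 = int r"
      and ag: "agree (insert ''r'' (writes ?d)) \<sigma> \<tau>"
    have env': "env X \<tau>" by (rule env_agree[OF env ag]) simp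
    define F' where "F' = \<tau> ''tab''"
    have impF': "improves X F F'" using inv by (simp add: Inv_def F'_def)
    define Inv' where "Inv' k \<rho> \<longleftrightarrow> improves X F' (\<rho> ''tab'') \<and>
        (\<forall>e<k. es ! e \<in> S \<longrightarrow> \<rho> ''tab'' (cell X (B e)) \<le> F' (cell X (A e)) + w (es ! e))"
      for k and \<rho> :: store
    have "runs ?d \<tau> (length es * (56 + 12) + 9)
        (\<lambda>\<rho>. Inv' (length es) \<rho> \<and> agree (insert ''e'' (writes ?i)) \<tau> \<rho>)"
    proof (rule runs_For_const)
      show "\<tau> ''m'' 0 = int (length es)" using env' by (simp add: env_def)
      show "Inv' 0 \<tau>" using impF' by (auto simp: Inv'_def F'_def improves_def)
      fix e \<rho>
      assume e: "e < length es" and inv': "Inv' e \<rho>" and ev: "\<rho> ''e'' 0 = int e"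
        and ag': "agree (insert ''e'' (writes ?i)) \<tau> \<rho>"
      have env'': "env X \<rho>" by (rule env_agree[OF env' ag']) simp
      have test: "bval ?test \<rho> \<longleftrightarrow> es ! e \<in> S" using env'' ev e by (simp add: env_def)
      have imp: "improves X F' (\<rho> ''tab'')" using inv' by (simp add: Inv'_def)
      have "\<rho> a = \<sigma> a" "\<rho> b = \<sigma> b"
        using agreeD[OF ag, of a] agreeD[OF ag', of a] agreeD[OF ag, of b] agreeD[OF ag', of b] names
        by auto
      then have ab: "\<rho> a (int e) = int (A e)" "\<rho> b (int e) = int (B e)" using ends e by simp_all
      show "runs ?i \<rho> 56 (Inv' (Suc e))"
      proof (rule runs_If[where T = 42])
        assume "bval ?test \<rho>"
        then have eS: "es ! e \<in> S" using test by simp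
        have here: "aval (Here (Cell b (Var ''e''))) \<rho> = cell X (B e)"
          using env'' ev ab by (simp add: env_def cell_def)
        have val: "aval ?val \<rho> = \<rho> ''tab'' (cell X (A e)) + w (es ! e)"
          using env'' ev ab eS e by (simp add: env_def cell_def)
        show "runs ?c \<rho> 42 (Inv' (Suc e))"
        proof (rule runs_Relax_improves[OF imp here bounds(2)[OF e]])
          assume *: "aval ?val \<rho> < L"
          \<comment> \<open>Positive weights ensure that a relaxed value below \<open>L\<close>
            never stems from an entry that stands for infinity.\<close>
          have "1 \<le> w (es ! e)" using eS w_pos by simp
          then have "\<rho> ''tab'' (cell X (A e)) < L" using * val by simp
          then have "der (dec X) (A e) (\<rho> ''tab'' (cell X (A e)))"
            by (rule improves_der[OF imp bounds(1)[OF e]])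
          moreover have "move (dec X) (A e) (B e) (w (es ! e))" using moves e eS by blast
          ultimately show "der (dec X) (B e) (aval ?val \<rho>)" unfolding val by (rule der.move)
        next
          fix G assume G: "improves X F' G" "G (cell X (B e)) \<le> aval ?val \<rho>" "\<And>i. G i \<le> \<rho> ''tab'' i"
          have "G (cell X (B e)) \<le> F' (cell X (A e)) + w (es ! e)"
            using G(2) improves_le[OF imp bounds(1)[OF e]] unfolding val by linarith
          then show "Inv' (Suc e) (\<rho>(''tab'' := G))"
            using G(1) inv' unfolding Inv'_def
            by (auto simp: less_Suc_eq intro: order_trans[OF G(3)])
        qed simp
      next
        assume "\<not> bval ?test \<rho>"
        then have "Inv' (Suc e) \<rho>" using inv' test by (auto simp: Inv'_def less_Suc_eq)
        then show "runs Skip \<rho> 42 (Inv' (Suc e))" by - (rule runs_Skip, assumption, simp)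
      qed simp
    qed (simp_all add: Inv'_def)
    then show "runs ?d \<tau> (length es * (56 + 12) + 9) (Inv (Suc r))"
    proof (rule runs_mono)
      fix \<rho> assume "Inv' (length es) \<rho> \<and> agree (insert ''e'' (writes ?i)) \<tau> \<rho>"
      then have imp: "improves X F' (\<rho> ''tab'')"
        and rel: "\<And>e. e < length es \<Longrightarrow> es ! e \<in> S \<Longrightarrow>
          \<rho> ''tab'' (cell X (B e)) \<le> F' (cell X (A e)) + w (es ! e)"
        by (auto simp: Inv'_def)
      obtain f where c: "chain r F' f" using inv unfolding Inv_def F'_def by blast
      note c = c[unfolded chain_def]
      note f = c[THEN conjunct1] c[THEN conjunct2, THEN conjunct1]
        c[THEN conjunct2, THEN conjunct2, THEN conjunct1] c[THEN conjunct2, THEN conjunct2, THEN conjunct2]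
      define g where "g = f(Suc r := (\<lambda>v. \<rho> ''tab'' (cell X v)))"
      have "g 0 = (\<lambda>v. F (cell X v))" "g (Suc r) = (\<lambda>v. \<rho> ''tab'' (cell X v))"
        using f(1) by (simp_all add: g_def)
      moreover have "\<forall>k<Suc r. \<forall>v<n. g (Suc k) v \<le> g k v"
        using f(2,3) imp by (auto simp: g_def less_Suc_eq improves_def)
      moreover have "\<forall>k<Suc r. \<forall>u v d. move (dec X) u v d \<longrightarrow> g (Suc k) v \<le> g k u + d"
      proof (intro allI impI)
        fix k u v d assume k: "k < Suc r" and "move (dec X) u v d"
        show "g (Suc k) v \<le> g k u + d"
        proof (cases "k = r")
          case True
          obtain e where "e < length es" "es ! e \<in> S" "A e = u" "B e = v" "d = w (es ! e)"
            using moves \<open>move (dec X) u v d\<close> by blast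
          then show ?thesis using rel[of e] f(2) True by (simp add: g_def)
        next
          case False
          then show ?thesis using k f(4) \<open>move (dec X) u v d\<close> by (simp add: g_def)
        qed
      qed
      ultimately have "chain (Suc r) (\<rho> ''tab'') g" by (simp only: chain_def)
      then show "Inv (Suc r) \<rho>" using improves_trans[OF impF' imp] unfolding Inv_def by blast
    qed simp
  qed (simp_all add: Inv_def)
  then show ?thesis
  proof (rule runs_mono)
    fix \<tau> assume *: "Inv n \<tau> \<and> agree (insert ''r'' (writes ?d)) \<sigma> \<tau>"
    then obtain f where c: "chain n (\<tau> ''tab'') f" unfolding Inv_def by blast
    note c = c[unfolded chain_def]
    note f = c[THEN conjunct1] c[THEN conjunct2, THEN conjunct1]
      c[THEN conjunct2, THEN conjunct2, THEN conjunct1] c[THEN conjunct2, THEN conjunct2, THEN conjunct2]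
    have "f (card {..<n}) v \<le> c" if "der (dec X) v c" for v c
    proof (rule bellman_ford[where f = f, OF tot _ _ _ that])
      show "f 0 v \<le> c" if "pre (dec X) v c" for v c using base[OF that] f(1) by (simp add: F_def)
      show "f (Suc r) v \<le> f r v" if "r < card {..<n}" "v \<in> {..<n}" for r v using f(3) that by simp
      show "f (Suc r) v \<le> f r u + d" if "r < card {..<n}" "move (dec X) u v d" for r u v d
        using f(4) that by simp
    qed
    then have "complete X (\<tau> ''tab'')" using f(2) by (simp add: complete_def)
    then show "agree {''r'', ''e'', ''tab''} \<sigma> \<tau> \<and> improves X (\<sigma> ''tab'') (\<tau> ''tab'') \<and> complete X (\<tau> ''tab'')"
      using * by (simp add: Inv_def F_def)
  qed simp
qed

definition close_time :: nat where
  "close_time = n * (length es * 68 + n * 42 + 21) + 29"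

text \<open>A row that is below all costs of \<open>pre\<close> becomes complete by accounting for
  relocations: by jumps if the total is 0, and otherwise by shortest paths in the direction given by
  its sign. \<open>close_time\<close> dominates all three branches.\<close>

lemma runs_Close:
  assumes env: "env X \<sigma>" and snd: "sound X (\<sigma> ''tab'')"
    and base: "\<And>v c. pre (dec X) v c \<Longrightarrow> \<sigma> ''tab'' (cell X v) \<le> c"
  shows "runs Close \<sigma> close_time (\<lambda>\<tau>. agree {''u'', ''v'', ''r'', ''e'', ''tab''} \<sigma> \<tau> \<and>
    improves X (\<sigma> ''tab'') (\<tau> ''tab'') \<and> complete X (\<tau> ''tab''))"
proof -
  let ?Q = "\<lambda>\<tau>. agree {''u'', ''v'', ''r'', ''e'', ''tab''} \<sigma> \<tau> \<and>
    improves X (\<sigma> ''tab'') (\<tau> ''tab'') \<and> complete X (\<tau> ''tab'')"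
  have sum: "\<sigma> ''sum'' (\<sigma> ''X'' 0) = total (dec X)" using env by (simp add: env_def)
  have ends: "fst (es ! e) < n" "snd (es ! e) < n" if "e < length es" for e
    using es_V nth_mem[OF that] by (metis lessThan_iff mem_Times_iff subsetD)+
  have edge: "(u, v) \<in> S \<and> d = w (u, v) \<longleftrightarrow>
      (\<exists>e<length es. es ! e \<in> S \<and> fst (es ! e) = u \<and> snd (es ! e) = v \<and> d = w (es ! e))" for u v d
  proof
    assume uv: "(u, v) \<in> S \<and> d = w (u, v)"
    then have "(u, v) \<in> set es" using S_es by blast
    then obtain e where "e < length es" "es ! e = (u, v)" by (metis in_set_conv_nth)
    then show "\<exists>e<length es. es ! e \<in> S \<and> fst (es ! e) = u \<and> snd (es ! e) = v \<and> d = w (es ! e)"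
      using uv by (intro exI[of _ e]) simp
  next
    assume "\<exists>e<length es. es ! e \<in> S \<and> fst (es ! e) = u \<and> snd (es ! e) = v \<and> d = w (es ! e)"
    then obtain e where "es ! e \<in> S" "es ! e = (u, v)" "d = w (es ! e)" by (metis prod.collapse)
    then show "(u, v) \<in> S \<and> d = w (u, v)" by simp
  qed
  show ?thesis
    unfolding Close_def
  proof (rule runs_If[where T = "n * (length es * 68 + n * 42 + 21) + 9 + 6"])
    assume "bval (Eq (Cell ''sum'' (Var ''X'')) (Num 0)) \<sigma>"
    then have tot: "total (dec X) = 0" using sum by simp
    show "runs Jump \<sigma> (n * (length es * 68 + n * 42 + 21) + 9 + 6) ?Q"
    proof (rule runs_mono[OF runs_Jump[OF env snd tot]])
      fix \<tau> assume *: "agree {''u'', ''v'', ''tab''} \<sigma> \<tau> \<and> improves X (\<sigma> ''tab'') (\<tau> ''tab'') \<and>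
        (\<forall>u<n. \<forall>v<n. \<tau> ''tab'' (cell X v) \<le> \<sigma> ''tab'' (cell X u))"
      have "complete X (\<tau> ''tab'')"
        unfolding complete_def
      proof (intro allI impI)
        fix v c assume v: "v < n" and "der (dec X) v c"
        then obtain u where "u < n" "pre (dec X) u c" using der_jump_pre tot by blast
        then show "\<tau> ''tab'' (cell X v) \<le> c" using * v base[of u c] by (meson order_trans)
      qed
      moreover have "agree {''u'', ''v'', ''r'', ''e'', ''tab''} \<sigma> \<tau>" using * by (blast intro: agree_mono)
      ultimately show "?Q \<tau>" using * by simp
    qed (simp add: algebra_simps)
  next
    assume "\<not> bval (Eq (Cell ''sum'' (Var ''X'')) (Num 0)) \<sigma>"
    then have tot: "total (dec X) \<noteq> 0" using sum by simp
    show "runs (If (Less (Num 0) (Cell ''sum'' (Var ''X''))) (Edges ''tail'' ''head'') (Edges ''head'' ''tail''))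
        \<sigma> (n * (length es * 68 + n * 42 + 21) + 9 + 6) ?Q"
    proof (rule runs_If[where T = "n * (length es * 68 + n * 42 + 21) + 9"])
      assume "bval (Less (Num 0) (Cell ''sum'' (Var ''X''))) \<sigma>"
      then have pos: "0 < total (dec X)" using sum by simp
      have "runs (Edges ''tail'' ''head'') \<sigma> (n * (length es * 68 + 21) + 9)
          (\<lambda>\<tau>. agree {''r'', ''e'', ''tab''} \<sigma> \<tau> \<and> improves X (\<sigma> ''tab'') (\<tau> ''tab'') \<and> complete X (\<tau> ''tab''))"
      proof (rule runs_Edges[OF env snd tot])
        fix u v d
        show "move (dec X) u v d \<longleftrightarrow>
          (\<exists>e<length es. es ! e \<in> S \<and> fst (es ! e) = u \<and> snd (es ! e) = v \<and> d = w (es ! e))"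
          unfolding edge[symmetric] using pos by (simp add: move_def)
      qed (use env ends base in \<open>simp_all add: env_def\<close>)
      then show "runs (Edges ''tail'' ''head'') \<sigma> (n * (length es * 68 + n * 42 + 21) + 9) ?Q"
      proof (rule runs_mono)
        fix \<tau> assume *: "agree {''r'', ''e'', ''tab''} \<sigma> \<tau> \<and> improves X (\<sigma> ''tab'') (\<tau> ''tab'') \<and>
          complete X (\<tau> ''tab'')"
        then have "agree {''u'', ''v'', ''r'', ''e'', ''tab''} \<sigma> \<tau>" by (blast intro: agree_mono)
        with * show "?Q \<tau>" by simp
      qed (simp add: algebra_simps)
    next
      assume "\<not> bval (Less (Num 0) (Cell ''sum'' (Var ''X''))) \<sigma>"
      then have neg: "total (dec X) < 0" using sum tot by simp
      have "runs (Edges ''head'' ''tail'') \<sigma> (n * (length es * 68 + 21) + 9)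
          (\<lambda>\<tau>. agree {''r'', ''e'', ''tab''} \<sigma> \<tau> \<and> improves X (\<sigma> ''tab'') (\<tau> ''tab'') \<and> complete X (\<tau> ''tab''))"
      proof (rule runs_Edges[OF env snd tot])
        fix u v d
        show "move (dec X) u v d \<longleftrightarrow>
          (\<exists>e<length es. es ! e \<in> S \<and> snd (es ! e) = u \<and> fst (es ! e) = v \<and> d = w (es ! e))"
        proof -
          have "move (dec X) u v d \<longleftrightarrow> (v, u) \<in> S \<and> d = w (v, u)" using neg by (simp add: move_def)
          then show ?thesis unfolding edge by blast
        qed
      qed (use env ends base in \<open>simp_all add: env_def\<close>)
      then show "runs (Edges ''head'' ''tail'') \<sigma> (n * (length es * 68 + n * 42 + 21) + 9) ?Q"
      proof (rule runs_mono)
        fix \<tau> assume *: "agree {''r'', ''e'', ''tab''} \<sigma> \<tau> \<and> improves X (\<sigma> ''tab'') (\<tau> ''tab'') \<and>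
          complete X (\<tau> ''tab'')"
        then have "agree {''u'', ''v'', ''r'', ''e'', ''tab''} \<sigma> \<tau>" by (blast intro: agree_mono)
        with * show "?Q \<tau>" by simp
      qed (simp add: algebra_simps)
    qed simp
  qed (simp add: close_time_def)
qed

end

section \<open>Filling the rows in the order of the masks\<close>

lemma set_decode_top:
  assumes "x < 2 ^ i"
  shows "set_decode (2 ^ i + x) = insert i (set_decode x)" "i \<notin> set_decode x" "set_decode x \<subseteq> {..<i}"
proof -
  show sub: "set_decode x \<subseteq> {..<i}"
  proof
    fix j assume "j \<in> set_decode x"
    then have "x div 2 ^ j \<noteq> 0" by (intro notI) (simp add: set_decode_def)
    then have "2 ^ j \<le> x" by (metis div_less not_le)
    then have "(2::nat) ^ j < 2 ^ i" using assms by linarith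
    then show "j \<in> {..<i}" by simp
  qed
  then show "i \<notin> set_decode x" by blast
  then show "set_decode (2 ^ i + x) = insert i (set_decode x)" by (rule set_decode_plus_power_2)
qed

lemma set_decode_eq_singleton: "set_decode x = {j} \<Longrightarrow> x = 2 ^ j"
  using set_decode_inverse[of x] by (simp add: set_encode_def)

lemma set_decode_eq_empty: "set_decode x = {} \<Longrightarrow> x = 0"
  using set_decode_inverse[of x] by simp

context ftp_core
begin

definition inputs :: "store \<Rightarrow> bool" where
  "inputs \<sigma> \<longleftrightarrow> \<sigma> ''n'' 0 = int n \<and> \<sigma> ''m'' 0 = int (length es) \<and> \<sigma> ''L'' 0 = L \<and>
     (\<forall>e<length es. \<sigma> ''tail'' (int e) = int (fst (es ! e)) \<and> \<sigma> ''head'' (int e) = int (snd (es ! e)) \<and>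
        (es ! e \<in> S \<longrightarrow> \<sigma> ''weight'' (int e) = w (es ! e)) \<and>
        (\<sigma> ''vulnerable'' (int e) = 0 \<longleftrightarrow> es ! e \<in> S))"

definition prepared :: "nat \<Rightarrow> store \<Rightarrow> bool" where
  "prepared k \<sigma> \<longleftrightarrow> (\<forall>i<k. \<sigma> ''pos'' (int i) = int (pos i) \<and> \<sigma> ''cost'' (int i) = charge i \<and>
     \<sigma> ''gain'' (int i) = amount i \<and> \<sigma> ''second'' (int i) = of_bool (odd i \<and> i \<noteq> 1))"

text \<open>Mask 0 needs an address, a supply and a bit count, from which those of later masks are
  computed, but no entries in the table.\<close>

definition filled :: "nat \<Rightarrow> store \<Rightarrow> bool" where
  "filled X \<sigma> \<longleftrightarrow> (\<forall>Z<X. \<sigma> ''row'' (int Z) = int (Z * n) \<and> \<sigma> ''sum'' (int Z) = total (dec Z) \<and>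
        \<sigma> ''bits'' (int Z) = int (pop Z)) \<and>
     (\<forall>Z<X. 0 < Z \<longrightarrow> sound Z (\<sigma> ''tab'') \<and> complete Z (\<sigma> ''tab''))"

definition stage :: "nat \<Rightarrow> store \<Rightarrow> bool" where
  "stage i \<sigma> \<longleftrightarrow> inputs \<sigma> \<and> prepared (2 * length vs + 2) \<sigma> \<and> \<sigma> ''P'' 0 = 2 ^ i \<and>
     \<sigma> ''H'' 0 = int (if i = 0 then 0 else 2 ^ (i - 1))"

lemma stage_agree:
  assumes "stage i \<sigma>" "agree W \<sigma> \<tau>"
    "W \<subseteq> {''x'', ''i'', ''X'', ''row'', ''sum'', ''bits'', ''tab'', ''u'', ''v'', ''y'', ''e'', ''r''}"
  shows "stage i \<tau>"
proof -
  have "\<tau> z = \<sigma> z"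
    if "z \<notin> {''x'', ''i'', ''X'', ''row'', ''sum'', ''bits'', ''tab'', ''u'', ''v'', ''y'', ''e'', ''r''}" for z
    using agreeD[OF assms(2) contra_subsetD[OF assms(3) that]] .
  then show ?thesis using assms(1) unfolding stage_def inputs_def prepared_def by simp
qed

lemma env_step:
  assumes st: "stage i \<sigma>" and fill: "filled X \<sigma>" and ag: "agree {''X'', ''row'', ''sum'', ''bits''} \<sigma> \<tau>"
    and X: "\<tau> ''X'' 0 = int X"
    and upd: "\<tau> ''row'' = (\<sigma> ''row'')(int X := int (X * n))"
      "\<tau> ''sum'' = (\<sigma> ''sum'')(int X := total (dec X))"
      "\<tau> ''bits'' = (\<sigma> ''bits'')(int X := int (pop X))"
  shows "env X \<tau>"
proof -
  have same: "\<tau> z = \<sigma> z" if "z \<notin> {''X'', ''row'', ''sum'', ''bits''}" for z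
    using ag that by (simp add: agree_def)
  have "\<tau> ''row'' (int Z) = int (Z * n) \<and> \<tau> ''sum'' (int Z) = total (dec Z) \<and>
      \<tau> ''bits'' (int Z) = int (pop Z)" if "Z \<le> X" for Z
  proof (cases "Z = X")
    case True
    then show ?thesis by (simp add: upd)
  next
    case False
    then have "Z < X" using that by simp
    then show ?thesis using fill False by (simp add: filled_def upd)
  qed
  moreover have "inputs \<tau>" using st same by (simp add: stage_def inputs_def)
  ultimately show ?thesis using X by (simp add: env_def inputs_def)
qed

lemma runs_Setup:
  assumes st: "stage i \<sigma>" and fill: "filled X \<sigma>" and X: "X = 2 ^ i + x" "x < 2 ^ i"
    and i: "i \<in> items" "\<sigma> ''i'' 0 = int i" and x: "\<sigma> ''x'' 0 = int x"
  shows "runs Setup \<sigma> 40 (\<lambda>\<tau>. env X \<tau> \<and> agree {''X'', ''row'', ''sum'', ''bits''} \<sigma> \<tau>)"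
proof -
  note dec = set_decode_top[OF X(2), folded X(1)]
  have "0 < X" "x < X" using X by simp_all
  have tot: "total (dec X) = total (dec x) + amount i" and pop: "pop X = Suc (pop x)"
    using dec by simp_all
  have P: "\<sigma> ''P'' 0 = 2 ^ i" using st by (simp add: stage_def)
  have pred: "int X - 1 = int (X - 1)" using \<open>0 < X\<close> by simp
  have row: "\<sigma> ''row'' (int (X - 1)) = int ((X - 1) * n)"
  proof -
    have "X - 1 < X" using \<open>0 < X\<close> by simp
    then show ?thesis using fill unfolding filled_def by blast
  qed
  have old: "\<sigma> ''sum'' (int x) = total (dec x)" "\<sigma> ''bits'' (int x) = int (pop x)"
    using fill \<open>x < X\<close> by (simp_all add: filled_def)
  have gain: "\<sigma> ''gain'' (int i) = amount i" and n: "\<sigma> ''n'' 0 = int n"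
    using st i(1) by (simp_all add: stage_def prepared_def inputs_def)
  have next_row: "int ((X - 1) * n) + int n = int (X * n)"
    using \<open>0 < X\<close> by (cases X) simp_all
  define \<sigma>1 where "\<sigma>1 = \<sigma>(''X'' := (\<sigma> ''X'')(0 := int X))"
  define \<sigma>2 where "\<sigma>2 = \<sigma>1(''row'' := (\<sigma>1 ''row'')(int X := int (X * n)))"
  define \<sigma>3 where "\<sigma>3 = \<sigma>2(''sum'' := (\<sigma>2 ''sum'')(int X := total (dec X)))"
  define \<sigma>4 where "\<sigma>4 = \<sigma>3(''bits'' := (\<sigma>3 ''bits'')(int X := int (pop X)))"
  let ?Q = "\<lambda>\<tau>. env X \<tau> \<and> agree {''X'', ''row'', ''sum'', ''bits''} \<sigma> \<tau>"
  let ?bits = "Assign ''bits'' (Var ''X'') (Plus (Cell ''bits'' (Var ''x'')) (Num 1))"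
  let ?sum = "Assign ''sum'' (Var ''X'') (Plus (Cell ''sum'' (Var ''x'')) (Cell ''gain'' (Var ''i'')))"
  let ?row = "Assign ''row'' (Var ''X'') (Plus (Cell ''row'' (Minus (Var ''X'') (Num 1))) (Var ''n''))"
  have ag: "agree {''X'', ''row'', ''sum'', ''bits''} \<sigma> \<sigma>4"
    by (simp add: agree_def \<sigma>1_def \<sigma>2_def \<sigma>3_def \<sigma>4_def)
  have "env X \<sigma>4"
    by (rule env_step[OF st fill ag]) (simp_all add: \<sigma>1_def \<sigma>2_def \<sigma>3_def \<sigma>4_def)
  with ag have Q: "?Q \<sigma>4" by blast
  have "runs ?bits \<sigma>3 8 ?Q"
  proof (rule runs_Assign_at[of ?Q])
    show "?Q (\<sigma>3(''bits'' := (\<sigma>3 ''bits'')(int X := int (pop X))))" using Q unfolding \<sigma>4_def .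
  qed (simp_all add: x old pop \<sigma>1_def \<sigma>2_def \<sigma>3_def)
  then have seq: "runs (Seq ?sum ?bits) \<sigma>2 18 ?Q"
    unfolding \<sigma>3_def
    by (rule runs_Seq_Assign_at) (simp_all add: x old i(2) gain tot \<sigma>1_def \<sigma>2_def)
  have val: "aval (Plus (Cell ''row'' (Minus (Var ''X'') (Num 1))) (Var ''n'')) \<sigma>1 = int (X * n)"
  proof -
    have "aval (Plus (Cell ''row'' (Minus (Var ''X'') (Num 1))) (Var ''n'')) \<sigma>1
        = \<sigma> ''row'' (int X - 1) + int n"
      by (simp add: \<sigma>1_def n)
    then show ?thesis unfolding pred row next_row .
  qed
  have "runs (Seq ?row (Seq ?sum ?bits)) \<sigma>1 29 ?Q"
    by (rule runs_Seq_Assign_at[OF seq[unfolded \<sigma>2_def] _ val]) (simp_all add: \<sigma>1_def)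
  then show ?thesis
    unfolding Setup_def \<sigma>1_def by (rule runs_Seq_Assign_at) (simp_all add: P x X(1))
qed

lemma sound_cong: "(\<And>v. v < n \<Longrightarrow> F (cell Z v) = G (cell Z v)) \<Longrightarrow> sound Z F \<longleftrightarrow> sound Z G"
  by (simp add: sound_def)

lemma complete_cong: "(\<And>v. v < n \<Longrightarrow> F (cell Z v) = G (cell Z v)) \<Longrightarrow> complete Z F \<longleftrightarrow> complete Z G"
  by (simp add: complete_def)

definition mask_time :: "nat \<Rightarrow> nat" where
  "mask_time X = 40 + (n * 21 + 9 + (40 + (n * 40 + 40 + (X * (n * 80 + 60) + 9 + close_time))))"

text \<open>The three forms of \<open>pre\<close> are matched by the three phases. A singleton has
  \<open>x = 0\<close>. In a discarded pair the top item \<open>i\<close> is the head, so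
  \<open>x = 2^(i-1)\<close> is the tail. A merge of derivable, hence nonempty, sets is found at the
  mask \<open>y\<close> of one of them, and the rows of both parts are complete.\<close>

lemma pre_le:
  assumes X: "X = 2 ^ i + x" "x < 2 ^ i"
    and complete: "\<And>Z. 0 < Z \<Longrightarrow> Z < X \<Longrightarrow> complete Z F"
    and single: "x = 0 \<Longrightarrow> G (cell X (pos i)) \<le> charge i"
    and discard: "odd i \<Longrightarrow> i \<noteq> 1 \<Longrightarrow> x = 2 ^ (i - 1) \<Longrightarrow> \<forall>v<n. G (cell X v) \<le> 0"
    and merge: "\<And>y v. y < X \<Longrightarrow> 0 < y \<Longrightarrow> pop y + pop (X - y) = pop X \<Longrightarrow> v < n
      \<Longrightarrow> G (cell X v) \<le> F (cell y v) + F (cell (X - y) v)"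
    and "pre (dec X) v c"
  shows "G (cell X v) \<le> c"
proof -
  note dec = set_decode_top[OF X(2), folded X(1)]
  from \<open>pre (dec X) v c\<close> show ?thesis
    unfolding pre_def
  proof (elim disjE bexE exE conjE)
    fix k assume single: "dec X = {k}" "v = pos k" "c = charge k"
    then have "k = i" "dec x = {}" using dec by auto
    then show ?thesis using single assms(4) set_decode_eq_empty by simp
  next
    fix j assume skip: "dec X = {2 * j + 2, 2 * j + 3}" "v \<in> {..<n}" "c = 0"
    have x: "dec x = dec X - {i}" using dec(1,2) by (simp add: insert_Diff_if)
    have "i \<in> dec X" unfolding dec(1) by simp
    then have "i = 2 * j + 2 \<or> i = 2 * j + 3" unfolding skip(1) by simp
    moreover have "i \<noteq> 2 * j + 2"
    proof
      assume i: "i = 2 * j + 2"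
      have "2 * j + 3 \<in> dec x" unfolding x skip(1) i by simp
      then have "2 * j + 3 < i" using dec(3) by blast
      then show False using i by simp
    qed
    ultimately have i: "i = 2 * j + 3" by simp
    have "dec x = {2 * j + 2}" unfolding x skip(1) i by auto
    then have "x = 2 ^ (2 * j + 2)" by (rule set_decode_eq_singleton)
    then have "x = 2 ^ (i - 1)" unfolding i by simp
    then show ?thesis using discard skip(2,3) i by simp
  next
    fix A B a b
    assume merge: "A \<inter> B = {}" "dec X = A \<union> B" "der A v a" "der B v b" "c = a + b"
    then have "A \<noteq> {}" "B \<noteq> {}" "v < n" using der_props[of A v a] der_props[of B v b] by auto
    then obtain y where y: "0 < y" "y < X" "dec y = A" "dec (X - y) = B" "pop y + pop (X - y) = pop X"
      using pop_split_exists[OF merge(1,2)] by blast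
    have "F (cell y v) \<le> a" using complete[of y] y merge \<open>v < n\<close> by (simp add: complete_def)
    moreover have "F (cell (X - y) v) \<le> b"
      using complete[of "X - y"] y merge \<open>v < n\<close> by (simp add: complete_def)
    ultimately show ?thesis using assms(6)[OF y(2,1,5) \<open>v < n\<close>] merge(5) by linarith
  qed
qed

text \<open>\<open>Q1\<close>, \<open>Q2\<close> and \<open>Q3\<close> collect the upper bounds that
  the phases establish. Since later phases only lower row \<open>X\<close>, none of them is lost
  before the row is closed.\<close>

lemma runs_Mask:
  assumes st: "stage i \<sigma>" and fill: "filled (2 ^ i + x) \<sigma>" and x: "x < 2 ^ i" "\<sigma> ''x'' 0 = int x"
    and i: "i \<in> items" "\<sigma> ''i'' 0 = int i"
  shows "runs Mask \<sigma> (mask_time (2 ^ i + x)) (filled (Suc (2 ^ i + x)))"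
proof -
  define X where "X = 2 ^ i + x"
  note fill = fill[folded X_def]
  note dec = set_decode_top[OF x(1), folded X_def]
  have "0 < X" by (simp add: X_def)
  let ?W0 = "{''X'', ''row'', ''sum'', ''bits''}" and ?vt = "{''v'', ''tab''}"
  define same where "same \<tau> \<longleftrightarrow> env X \<tau> \<and> \<tau> ''x'' 0 = int x \<and> \<tau> ''i'' 0 = int i \<and>
    \<tau> ''H'' 0 = int (if i = 0 then 0 else 2 ^ (i - 1)) \<and> prepared (2 * length vs + 2) \<tau>" for \<tau>
  have same_agree: "same \<tau>" if old: "same \<rho>" and ag: "agree W \<rho> \<tau>"
    and sub: "W \<subseteq> {''tab'', ''u'', ''v'', ''y'', ''e'', ''r''}" for \<rho> \<tau> W
  proof -
    have "env X \<tau>" using old env_agree[OF _ ag sub] by (simp add: same_def)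
    moreover have "\<tau> z = \<rho> z" if "z \<notin> {''tab'', ''u'', ''v'', ''y'', ''e'', ''r''}" for z
      using agreeD[OF ag contra_subsetD[OF sub that]] .
    ultimately show ?thesis using old unfolding same_def prepared_def by simp
  qed
  define F where "F = \<sigma> ''tab''"
  have below: "sound Z F \<and> complete Z F" if "0 < Z" "Z < X" for Z
    using fill that by (simp add: filled_def F_def)
  define R where "R \<tau> \<longleftrightarrow> same \<tau> \<and> (\<forall>Z<X. \<forall>v<n. \<tau> ''tab'' (cell Z v) = F (cell Z v)) \<and> sound X (\<tau> ''tab'')"
    for \<tau>
  have R_below: "sound Z (\<tau> ''tab'') \<and> complete Z (\<tau> ''tab'')" if "R \<tau>" "0 < Z" "Z < X" for \<tau> Z
    using below[OF that(2,3)] that sound_cong[of "\<tau> ''tab''" Z F] complete_cong[of "\<tau> ''tab''" Z F]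
    by (simp add: R_def)
  have R_step: "R \<tau>" if "R \<rho>" "improves X (\<rho> ''tab'') (\<tau> ''tab'')" "agree W \<rho> \<tau>"
    "W \<subseteq> {''tab'', ''u'', ''v'', ''y'', ''e'', ''r''}" for \<rho> \<tau> W
    using that same_agree[of \<rho> W \<tau>] by (simp add: R_def improves_def)
  have env: "env X \<tau>" if "R \<tau>" for \<tau> using that by (simp add: R_def same_def)
  have snd: "sound X (\<tau> ''tab'')" if "R \<tau>" for \<tau> using that by (simp add: R_def)
  have facts: "\<tau> ''x'' 0 = int x" "\<tau> ''i'' 0 = int i" "\<tau> ''H'' 0 = int (if i = 0 then 0 else 2 ^ (i - 1))"
    "\<tau> ''pos'' (int i) = int (pos i)" "\<tau> ''cost'' (int i) = charge i"
    "\<tau> ''second'' (int i) = of_bool (odd i \<and> i \<noteq> 1)" if "R \<tau>" for \<tau>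
    using that i(1) by (auto simp: R_def same_def prepared_def)
  define Q1 where "Q1 \<tau> \<longleftrightarrow> R \<tau> \<and> (x = 0 \<longrightarrow> \<tau> ''tab'' (cell X (pos i)) \<le> charge i)" for \<tau>
  define Q2 where "Q2 \<tau> \<longleftrightarrow> Q1 \<tau> \<and>
    (odd i \<and> i \<noteq> 1 \<and> x = 2 ^ (i - 1) \<longrightarrow> (\<forall>v<n. \<tau> ''tab'' (cell X v) \<le> 0))" for \<tau>
  define Q3 where "Q3 \<tau> \<longleftrightarrow> Q2 \<tau> \<and> (\<forall>y<X. 0 < y \<and> pop y + pop (X - y) = pop X \<longrightarrow>
    (\<forall>v<n. \<tau> ''tab'' (cell X v) \<le> F (cell y v) + F (cell (X - y) v)))" for \<tau>
  have posn: "pos i < n" using pos_in[OF i(1)] by simp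
  have "runs Setup \<sigma> 40 (\<lambda>\<tau>. same \<tau> \<and> \<tau> ''tab'' = F)"
  proof (rule runs_mono[OF runs_Setup[OF st fill X_def x(1) i x(2)]])
    fix \<tau> assume *: "env X \<tau> \<and> agree ?W0 \<sigma> \<tau>"
    then have "stage i \<tau>" "\<And>z. z \<notin> ?W0 \<Longrightarrow> \<tau> z = \<sigma> z" using stage_agree[OF st, of ?W0 \<tau>] agreeD by auto
    then show "same \<tau> \<and> \<tau> ''tab'' = F" using * x i by (simp add: same_def stage_def F_def)
  qed simp
  moreover have "runs Fill \<tau> (n * 21 + 9) R" if "same \<tau> \<and> \<tau> ''tab'' = F" for \<tau>
  proof (rule runs_mono[OF runs_Fill[of X]])
    show "env X \<tau>" using that by (simp add: same_def)
    fix \<rho> assume *: "agree ?vt \<tau> \<rho> \<and>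
      (\<forall>Z<X. \<forall>v<n. \<rho> ''tab'' (cell Z v) = \<tau> ''tab'' (cell Z v)) \<and> (\<forall>v<n. \<rho> ''tab'' (cell X v) = L)"
    then have "same \<rho>" using same_agree[of \<tau> ?vt \<rho>] that by simp
    then show "R \<rho>" using * that by (simp add: R_def sound_def)
  qed simp
  moreover have "runs Single \<tau> 40 Q1" if R: "R \<tau>" for \<tau>
  proof (rule runs_mono[OF runs_Single[OF env[OF R] snd[OF R] facts(1,2)[OF R] i(1) facts(4,5)[OF R]]])
    show "dec X = {i}" if "x = 0" using dec(1) that by simp
    fix \<rho> assume *: "agree {''tab''} \<tau> \<rho> \<and> improves X (\<tau> ''tab'') (\<rho> ''tab'') \<and>
      (x = 0 \<longrightarrow> \<rho> ''tab'' (cell X (pos i)) \<le> charge i)"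
    then show "Q1 \<rho>" using R_step[OF R, of \<rho> "{''tab''}"] by (simp add: Q1_def)
  qed simp
  moreover have "runs Discard \<tau> (n * 40 + 40) Q2" if Q: "Q1 \<tau>" for \<tau>
  proof -
    have R: "R \<tau>" using Q by (simp add: Q1_def)
    show ?thesis
    proof (rule runs_mono[OF runs_Discard[OF env[OF R] snd[OF R] facts(1,2,3,6)[OF R]]])
      assume "odd i" "i \<noteq> 1" and xi: "x = (if i = 0 then 0 else 2 ^ (i - 1))"
      then have "i = 2 * (i div 2 - 1) + 3" "i \<noteq> 0" by presburger+
      then obtain j where j: "i = 2 * j + 3" by blast
      have "dec x = {i - 1}"
        using xi \<open>i \<noteq> 0\<close> set_decode_top(1)[of 0 "i - 1"] by simp
      then have "dec X = {2 * j + 2, 2 * j + 3}" using dec(1) j by auto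
      moreover have "j < length vs" using i(1) j by simp
      ultimately show "\<exists>j<length vs. dec X = {2 * j + 2, 2 * j + 3}" by blast
    next
      fix \<rho> assume *: "agree ?vt \<tau> \<rho> \<and> improves X (\<tau> ''tab'') (\<rho> ''tab'') \<and>
        (odd i \<and> i \<noteq> 1 \<and> x = (if i = 0 then 0 else 2 ^ (i - 1)) \<longrightarrow> (\<forall>v<n. \<rho> ''tab'' (cell X v) \<le> 0))"
      then have "R \<rho>" using R_step[OF R, of \<rho> ?vt] by simp
      moreover have "\<rho> ''tab'' (cell X (pos i)) \<le> \<tau> ''tab'' (cell X (pos i))"
        using * improves_le posn by blast
      then have "x = 0 \<longrightarrow> \<rho> ''tab'' (cell X (pos i)) \<le> charge i" using Q by (auto simp: Q1_def)
      moreover have "odd i \<and> i \<noteq> 1 \<and> x = 2 ^ (i - 1) \<longrightarrow> (\<forall>v<n. \<rho> ''tab'' (cell X v) \<le> 0)"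
        using * by (auto split: if_splits)
      ultimately show "Q2 \<rho>" by (simp add: Q2_def Q1_def)
    qed simp
  qed
  moreover have "runs Merge \<tau> (X * (n * 80 + 60) + 9) Q3" if Q: "Q2 \<tau>" for \<tau>
  proof -
    have R: "R \<tau>" using Q by (simp add: Q2_def Q1_def)
    show ?thesis
    proof (rule runs_mono[OF runs_Merge[OF env[OF R] snd[OF R]]])
      show "sound Z (\<tau> ''tab'')" if "0 < Z" "Z < X" for Z using R_below[OF R that] by simp
      fix \<rho> assume *: "agree {''y'', ''v'', ''tab''} \<tau> \<rho> \<and> improves X (\<tau> ''tab'') (\<rho> ''tab'') \<and>
        (\<forall>y<X. 0 < y \<and> pop y + pop (X - y) = pop X \<longrightarrow>
          (\<forall>v<n. \<rho> ''tab'' (cell X v) \<le> \<tau> ''tab'' (cell y v) + \<tau> ''tab'' (cell (X - y) v)))"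
      have "R \<rho>" using R_step[OF R, of \<rho> "{''y'', ''v'', ''tab''}"] * by simp
      moreover have le: "\<rho> ''tab'' (cell X v) \<le> \<tau> ''tab'' (cell X v)" if "v < n" for v
        using * improves_le that by blast
      have "x = 0 \<longrightarrow> \<rho> ''tab'' (cell X (pos i)) \<le> charge i"
        using Q le[OF posn] by (auto simp: Q2_def Q1_def)
      moreover have "odd i \<and> i \<noteq> 1 \<and> x = 2 ^ (i - 1) \<longrightarrow> (\<forall>v<n. \<rho> ''tab'' (cell X v) \<le> 0)"
        using Q by (auto simp: Q2_def intro: order_trans[OF le])
      moreover have "\<tau> ''tab'' (cell y v) = F (cell y v)" if "y < X" "v < n" for y v
        using R that by (simp add: R_def)
      then have "\<forall>y<X. 0 < y \<and> pop y + pop (X - y) = pop X \<longrightarrow>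
          (\<forall>v<n. \<rho> ''tab'' (cell X v) \<le> F (cell y v) + F (cell (X - y) v))"
        using * by simp
      ultimately show "Q3 \<rho>" by (simp add: Q3_def Q2_def Q1_def)
    qed simp
  qed
  moreover have "runs Close \<tau> close_time (filled (Suc X))" if Q: "Q3 \<tau>" for \<tau>
  proof -
    have R: "R \<tau>" using Q by (simp add: Q3_def Q2_def Q1_def)
    show ?thesis
    proof (rule runs_mono[OF runs_Close[OF env[OF R] snd[OF R]]])
      fix v c assume "pre (dec X) v c"
      then show "\<tau> ''tab'' (cell X v) \<le> c"
      proof (rule pre_le[OF X_def x(1), rotated -1])
        show "complete Z F" if "0 < Z" "Z < X" for Z using below[OF that] by simp
      qed (use Q in \<open>simp_all add: Q3_def Q2_def Q1_def\<close>)
    next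
      fix \<rho> assume *: "agree {''u'', ''v'', ''r'', ''e'', ''tab''} \<tau> \<rho> \<and>
        improves X (\<tau> ''tab'') (\<rho> ''tab'') \<and> complete X (\<rho> ''tab'')"
      then have R': "R \<rho>" using R_step[OF R, of \<rho> "{''u'', ''v'', ''r'', ''e'', ''tab''}"] by simp
      have "sound Z (\<rho> ''tab'') \<and> complete Z (\<rho> ''tab'')" if "0 < Z" "Z < Suc X" for Z
        using R_below[OF R' that(1)] snd[OF R'] * that(2) by (cases "Z = X") auto
      moreover have "\<forall>Z<Suc X. \<rho> ''row'' (int Z) = int (Z * n) \<and> \<rho> ''sum'' (int Z) = total (dec Z) \<and>
        \<rho> ''bits'' (int Z) = int (pop Z)"
        using env[OF R'] by (simp add: env_def less_Suc_eq_le)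
      ultimately show "filled (Suc X) \<rho>" unfolding filled_def by blast
    qed simp
  qed
  ultimately have "runs Mask \<sigma> (mask_time X) (filled (Suc X))"
    unfolding Mask_def mask_time_def by (intro runs_Seq)
  then show ?thesis unfolding X_def .
qed

end

section \<open>The whole table and its running time\<close>

lemma set_decode_full: "set_decode (2 ^ k - 1) = {..<k}"
proof -
  have "set_encode {..<k} = 2 ^ k - 1"
    using sum_power2[of k] by (simp add: set_encode_def atLeast0LessThan)
  then show ?thesis using set_encode_inverse[of "{..<k}"] by simp
qed

context ftp_core
begin

lemma n_pos: "0 < n"
  using s_in by auto

text \<open>Each monomial of \<open>mask_time\<close> is at most \<open>N * n ^ 3\<close>, and its
  coefficients add up to 499.\<close>

lemma mask_time_le:
  assumes "X \<le> N" "1 \<le> N" "length es \<le> n * n"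
  shows "mask_time X \<le> 500 * (N * n ^ 3)"
proof -
  define K where "K = N * n ^ 3"
  have 3: "n ^ 3 = n * (n * n)" by (simp add: power3_eq_cube)
  have "1 \<le> n" using n_pos by simp
  then have "n * 1 \<le> n * (n * n)" by (intro mult_le_mono) simp_all
  then have n: "n \<le> n ^ 3" using 3 by simp
  have nn: "n * n \<le> n ^ 3" using \<open>1 \<le> n\<close> 3 by simp
  have nm: "n * length es \<le> n ^ 3" using assms(3) 3 by simp
  have one: "1 \<le> n ^ 3" using \<open>1 \<le> n\<close> n by linarith
  have low: "a \<le> K" if "a \<le> n ^ 3" for a
    using mult_le_mono[OF assms(2) that] by (simp add: K_def)
  have "X * n \<le> K" "X * 1 \<le> K" unfolding K_def by (intro mult_le_mono assms n one)+
  moreover have "1 \<le> K" "n \<le> K" "n * n \<le> K" "n * length es \<le> K" by (intro low one n nn nm)+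
  ultimately have "mask_time X \<le> 500 * K"
    unfolding mask_time_def close_time_def by (simp add: algebra_simps)
  then show ?thesis by (simp add: K_def)
qed

lemma writes_Mask:
  "writes Mask \<subseteq> {''X'', ''row'', ''sum'', ''bits'', ''tab'', ''u'', ''v'', ''y'', ''e'', ''r''}"
  by (simp add: Mask_def Setup_def Fill_def Single_def Discard_def Merge_def Close_def Jump_def Edges_def)

lemma notin_writes_Mask: "''x'' \<notin> writes Mask" "''P'' \<notin> writes Mask"
  by (rule contra_subsetD[OF writes_Mask], simp)+

lemma inputs_cong:
  "(\<And>y. y \<in> {''n'', ''m'', ''L'', ''tail'', ''head'', ''weight'', ''vulnerable''} \<Longrightarrow> \<tau> y = \<sigma> y)
    \<Longrightarrow> inputs \<tau> \<longleftrightarrow> inputs \<sigma>"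
  by (simp add: inputs_def)

lemma prepared_cong:
  "(\<And>y. y \<in> {''pos'', ''cost'', ''gain'', ''second''} \<Longrightarrow> \<tau> y = \<sigma> y) \<Longrightarrow> prepared k \<tau> \<longleftrightarrow> prepared k \<sigma>"
  by (simp add: prepared_def)

lemma filled_cong:
  "(\<And>y. y \<in> {''row'', ''sum'', ''bits'', ''tab''} \<Longrightarrow> \<tau> y = \<sigma> y) \<Longrightarrow> filled X \<tau> \<longleftrightarrow> filled X \<sigma>"
  by (simp add: filled_def)

lemma other_upd:
  "z \<notin> {''n'', ''m'', ''L'', ''tail'', ''head'', ''weight'', ''vulnerable''} \<Longrightarrow>
    inputs (\<tau>(z := f)) \<longleftrightarrow> inputs \<tau>"
  "z \<notin> {''pos'', ''cost'', ''gain'', ''second''} \<Longrightarrow> prepared k (\<tau>(z := f)) \<longleftrightarrow> prepared k \<tau>"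
  "z \<notin> {''row'', ''sum'', ''bits'', ''tab''} \<Longrightarrow> filled X (\<tau>(z := f)) \<longleftrightarrow> filled X \<tau>"
  by (rule inputs_cong prepared_cong filled_cong, rule fun_upd_other, rule notI, simp)+

text \<open>\<open>N\<close> is the number of all masks, an upper bound both for the
  \<open>2^i\<close> masks of this level and for each single mask in the time of its merges.\<close>

lemma runs_Level:
  assumes st: "stage i \<sigma>" and fill: "filled (2 ^ i) \<sigma>" and i: "i \<in> items" "\<sigma> ''i'' 0 = int i"
    and m: "length es \<le> n * n" and N: "N = 4 ^ (length vs + 1)"
  shows "runs Level \<sigma> (N * (500 * (N * n ^ 3) + 12) + 20) (\<lambda>\<tau>. stage (Suc i) \<tau> \<and> filled (2 ^ Suc i) \<tau>)"
proof -
  have "(2::nat) ^ Suc i \<le> 2 ^ (2 * length vs + 2)" using i(1) by (intro power_increasing) auto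
  also have "\<dots> = N" unfolding N using power_mult[of "2::nat" 2 "length vs + 1"] by simp
  finally have iN: "2 ^ Suc i \<le> N" .
  define Inv where "Inv k \<tau> \<longleftrightarrow> stage i \<tau> \<and> \<tau> ''i'' 0 = int i \<and> filled (2 ^ i + k) \<tau>" for k \<tau>
  have first: "runs (For ''x'' ''P'' Mask) \<sigma> (2 ^ i * (500 * (N * n ^ 3) + 12) + 9)
      (\<lambda>\<tau>. Inv (2 ^ i) \<tau> \<and> agree (insert ''x'' (writes Mask)) \<sigma> \<tau>)"
  proof (rule runs_For_const)
    show "\<sigma> ''P'' 0 = int (2 ^ i)" using st by (simp add: stage_def)
    show "Inv 0 \<sigma>" using assms by (simp add: Inv_def)
    show "Inv k (\<tau>(''x'' := f))" if "Inv k \<tau>" for k \<tau> f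
      using that by (simp add: Inv_def stage_def other_upd)
    fix k \<tau> assume k: "k < 2 ^ i" and inv: "Inv k \<tau>" and x: "\<tau> ''x'' 0 = int k"
    have st': "stage i \<tau>" and i': "\<tau> ''i'' 0 = int i" and fill': "filled (2 ^ i + k) \<tau>"
      using inv by (simp_all add: Inv_def)
    show "runs Mask \<tau> (500 * (N * n ^ 3)) (Inv (Suc k))"
    proof (rule runs_mono[OF runs_frame[OF runs_Mask[OF st' fill' k x i(1) i']]])
      have "2 ^ i + k \<le> N" "1 \<le> N" using k iN by simp_all
      then show "mask_time (2 ^ i + k) \<le> 500 * (N * n ^ 3)" using mask_time_le m by blast
      fix \<rho> assume *: "filled (Suc (2 ^ i + k)) \<rho> \<and> agree (writes Mask) \<tau> \<rho>"
      then have ag: "agree {''X'', ''row'', ''sum'', ''bits'', ''tab'', ''u'', ''v'', ''y'', ''e'', ''r''} \<tau> \<rho>"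
        using agree_mono[OF _ writes_Mask] by blast
      have "stage i \<rho>" by (rule stage_agree[OF st' ag]) simp
      moreover have "\<rho> ''i'' 0 = int i" using agreeD[OF ag, of "''i''"] i' by simp
      ultimately show "Inv (Suc k) \<rho>" using * by (simp add: Inv_def)
    qed
  qed (simp_all add: notin_writes_Mask)
  have second: "runs (Seq (Set ''H'' (Var ''P'')) (Set ''P'' (Plus (Var ''P'') (Var ''P'')))) \<tau> 11
      (\<lambda>\<tau>. stage (Suc i) \<tau> \<and> filled (2 ^ Suc i) \<tau>)" if inv: "Inv (2 ^ i) \<tau>" for \<tau>
  proof -
    have P: "\<tau> ''P'' 0 = 2 ^ i" using inv by (simp add: Inv_def stage_def)
    define \<tau>1 where "\<tau>1 = \<tau>(''H'' := (\<tau> ''H'')(0 := 2 ^ i))"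
    define \<tau>2 where "\<tau>2 = \<tau>1(''P'' := (\<tau>1 ''P'')(0 := 2 ^ Suc i))"
    let ?Q = "\<lambda>\<tau>. stage (Suc i) \<tau> \<and> filled (2 ^ Suc i) \<tau>"
    have "stage (Suc i) \<tau>2"
      using inv by (simp add: Inv_def stage_def other_upd \<tau>2_def \<tau>1_def)
    moreover have "filled (2 ^ i + 2 ^ i) \<tau>2"
      using inv by (simp add: Inv_def other_upd \<tau>2_def \<tau>1_def)
    ultimately have Q: "?Q \<tau>2" by (simp add: mult_2)
    have "runs (Set ''P'' (Plus (Var ''P'') (Var ''P''))) \<tau>1 7 ?Q"
    proof (rule runs_Assign_at[of ?Q])
      show "?Q (\<tau>1(''P'' := (\<tau>1 ''P'')(0 := 2 ^ Suc i)))" using Q unfolding \<tau>2_def .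
    qed (simp_all add: \<tau>1_def P)
    then show ?thesis unfolding \<tau>1_def by (rule runs_Seq_Assign_at) (simp_all add: P)
  qed
  have "runs Level \<sigma> (2 ^ i * (500 * (N * n ^ 3) + 12) + 9 + 11)
      (\<lambda>\<tau>. stage (Suc i) \<tau> \<and> filled (2 ^ Suc i) \<tau>)"
    unfolding Level_def by (rule runs_Seq[OF first], rule second) simp
  then show ?thesis
  proof (rule runs_mono)
    have "2 ^ i \<le> N" using iN by simp
    then have "2 ^ i * (500 * (N * n ^ 3) + 12) \<le> N * (500 * (N * n ^ 3) + 12)"
      by (rule mult_le_mono1)
    then show "2 ^ i * (500 * (N * n ^ 3) + 12) + 9 + 11 \<le> N * (500 * (N * n ^ 3) + 12) + 20"
      by linarith
  qed
qed

lemma runs_Init: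
  assumes "inputs \<sigma>" "prepared (2 * length vs + 2) \<sigma>"
  shows "runs Init \<sigma> 15 (\<lambda>\<tau>. stage 0 \<tau> \<and> filled 1 \<tau>)"
  unfolding Init_def
  by (rule runs_Seq_Assign_at[where T = 12 and i = 0 and v = 1],
      rule runs_Seq_Assign_at[where T = 9 and i = 0 and v = 0],
      rule runs_Seq_Assign_at[where T = 6 and i = 0 and v = 0],
      rule runs_Seq_Assign_at[where T = 3 and i = 0 and v = 0],
      rule runs_Assign_at[where i = 0 and v = 0])
    (use assms in \<open>simp_all add: stage_def filled_def inputs_def prepared_def\<close>)

lemma prepared_2:
  assumes "\<tau> ''pos'' 0 = int s" "\<tau> ''pos'' 1 = int t" "\<tau> ''cost'' 0 = 0" "\<tau> ''cost'' 1 = 0"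
    "\<tau> ''gain'' 0 = p" "\<tau> ''gain'' 1 = - p" "\<tau> ''second'' 0 = 0" "\<tau> ''second'' 1 = 0"
  shows "prepared 2 \<tau>"
  using assms by (auto simp: prepared_def less_2_cases_iff pos_def charge_def amount_def)

lemma runs_Ends:
  assumes "\<sigma> ''s'' 0 = int s" "\<sigma> ''t'' 0 = int t" "\<sigma> ''p'' 0 = p"
  shows "runs Ends \<sigma> 40 (prepared 2)"
  unfolding Ends_def
  by (rule runs_Seq_Assign_at[where T = 36 and i = 0 and v = "int s"],
      rule runs_Seq_Assign_at[where T = 32 and i = 0 and v = 0],
      rule runs_Seq_Assign_at[where T = 28 and i = 0 and v = p],
      rule runs_Seq_Assign_at[where T = 24 and i = 0 and v = 0],
      rule runs_Seq_Assign_at[where T = 20 and i = 1 and v = "int t"],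
      rule runs_Seq_Assign_at[where T = 16 and i = 1 and v = 0],
      rule runs_Seq_Assign_at[where T = 8 and i = 1 and v = "- p"],
      rule runs_Assign_at[where i = 1 and v = 0], rule prepared_2)
    (use assms in simp_all)

lemma prepared_step:
  assumes "prepared (2 * j + 2) \<sigma>"
    "\<tau> ''pos'' = (\<sigma> ''pos'')(int (2 * j + 2) := int (fst (vs ! j)), int (2 * j + 3) := int (snd (vs ! j)))"
    "\<tau> ''cost'' = (\<sigma> ''cost'')(int (2 * j + 2) := w (vs ! j), int (2 * j + 3) := 0)"
    "\<tau> ''gain'' = (\<sigma> ''gain'')(int (2 * j + 2) := - 1, int (2 * j + 3) := 1)"
    "\<tau> ''second'' = (\<sigma> ''second'')(int (2 * j + 2) := 0, int (2 * j + 3) := 1)"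
  shows "prepared (2 * Suc j + 2) \<tau>"
proof -
  have ends: "pos (2 * j + 2) = fst (vs ! j)" "pos (2 * j + 3) = snd (vs ! j)"
    "amount (2 * j + 2) = - 1" "amount (2 * j + 3) = 1"
    "charge (2 * j + 2) = w (vs ! j)" "charge (2 * j + 3) = 0"
    by (auto simp: pos_def amount_def charge_def)
  have "\<tau> ''pos'' (int i) = int (pos i) \<and> \<tau> ''cost'' (int i) = charge i \<and>
      \<tau> ''gain'' (int i) = amount i \<and> \<tau> ''second'' (int i) = of_bool (odd i \<and> i \<noteq> 1)"
    if i: "i < 2 * Suc j + 2" for i
  proof -
    have "i < 2 * j + 2 \<or> i = 2 * j + 2 \<or> i = 2 * j + 3" using i by arith
    then consider "i < 2 * j + 2" | "i = 2 * j + 2" | "i = 2 * j + 3" by blast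
    then show ?thesis
    proof cases
      case 1
      then have "int i \<noteq> int (2 * j + 2)" "int i \<noteq> int (2 * j + 3)" by linarith+
      then show ?thesis using assms(1) 1 unfolding assms(2-5) prepared_def by simp
    next
      case 2
      show ?thesis unfolding assms(2-5) 2 ends by simp
    next
      case 3
      show ?thesis unfolding assms(2-5) 3 ends by simp
    qed
  qed
  then show ?thesis unfolding prepared_def by blast
qed

lemma runs_Item:
  assumes prep: "prepared (2 * j + 2) \<sigma>" and j: "\<sigma> ''j'' 0 = int j"
    and sel: "\<sigma> ''sel'' (int j) = e" "\<sigma> ''tail'' e = int (fst (vs ! j))" "\<sigma> ''head'' e = int (snd (vs ! j))"
      "\<sigma> ''weight'' e = w (vs ! j)"
  shows "runs Item \<sigma> 67 (prepared (2 * Suc j + 2))"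
proof -
  have idx: "int j + int j + 2 = int (2 * j + 2)" "int (2 * j + 2) + 1 = int (2 * j + 3)" by simp_all
  show ?thesis
    unfolding Item_def
    by (rule runs_Seq_Assign_at[where T = 58 and i = 0 and v = "int (2 * j + 2)"],
        rule runs_Seq_Assign_at[where T = 51 and i = "int (2 * j + 2)" and v = "int (fst (vs ! j))"],
        rule runs_Seq_Assign_at[where T = 44 and i = "int (2 * j + 2)" and v = "w (vs ! j)"],
        rule runs_Seq_Assign_at[where T = 40 and i = "int (2 * j + 2)" and v = "- 1"],
        rule runs_Seq_Assign_at[where T = 36 and i = "int (2 * j + 2)" and v = 0],
        rule runs_Seq_Assign_at[where T = 27 and i = "int (2 * j + 3)" and v = "int (snd (vs ! j))"],
        rule runs_Seq_Assign_at[where T = 21 and i = "int (2 * j + 3)" and v = 0],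
        rule runs_Seq_Assign_at[where T = 15 and i = "int (2 * j + 3)" and v = 1],
        rule runs_Assign_at[where i = "int (2 * j + 3)" and v = 1], rule prepared_step[OF prep])
      (simp_all add: j sel idx del: of_nat_add of_nat_mult of_nat_Suc)
qed

end

lemma writes_Clamp [simp]: "writes (Clamp x y) = {x}"
  by (simp add: Clamp_def)

lemma runs_Clamp:
  assumes "\<And>\<tau>. \<tau> = \<sigma>(x := (\<sigma> x)(0 := max 0 (\<sigma> y 0 + 1))) \<Longrightarrow> Q \<tau>"
  shows "runs (Clamp x y) \<sigma> 11 Q"
proof -
  define \<tau> where "\<tau> = \<sigma>(x := (\<sigma> x)(0 := max 0 (\<sigma> y 0 + 1)))"
  have Q: "Q \<tau>" using assms by (simp add: \<tau>_def)
  show ?thesis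
    unfolding Clamp_def
  proof (rule runs_If[where T = 6])
    assume "bval (Less (Var y) (Num 0)) \<sigma>"
    then have "max 0 (\<sigma> y 0 + 1) = 0" by simp
    then have "Q (\<sigma>(x := (\<sigma> x)(0 := 0)))" using Q by (simp add: \<tau>_def)
    then show "runs (Set x (Num 0)) \<sigma> 6 Q" by - (rule runs_Assign_at, assumption, simp_all)
  next
    assume "\<not> bval (Less (Var y) (Num 0)) \<sigma>"
    then have "max 0 (\<sigma> y 0 + 1) = \<sigma> y 0 + 1" by simp
    then have "Q (\<sigma>(x := (\<sigma> x)(0 := \<sigma> y 0 + 1)))" using Q by (simp add: \<tau>_def)
    then show "runs (Set x (Plus (Var y) (Num 1))) \<sigma> 6 Q"
      by - (rule runs_Assign_at, assumption, simp_all)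
  qed simp
qed

context ftp_core
begin

text \<open>What \<open>Core\<close> expects to find: \<open>sel\<close> holds the positions in the
  input of the edges \<open>vs\<close>, and the values \<open>p\<close> and \<open>L\<close> are
  still implicit in \<open>k\<close> and the budget.\<close>

definition raw :: "store \<Rightarrow> bool" where
  "raw \<sigma> \<longleftrightarrow> \<sigma> ''n'' 0 = int n \<and> \<sigma> ''m'' 0 = int (length es) \<and>
     (\<forall>e<length es. \<sigma> ''tail'' (int e) = int (fst (es ! e)) \<and> \<sigma> ''head'' (int e) = int (snd (es ! e)) \<and>
        \<sigma> ''weight'' (int e) = w (es ! e) \<and> (\<sigma> ''vulnerable'' (int e) = 0 \<longleftrightarrow> es ! e \<in> S)) \<and>
     \<sigma> ''s'' 0 = int s \<and> \<sigma> ''t'' 0 = int t \<and>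
     max 0 (\<sigma> ''k'' 0 + 1) = p \<and> max 0 (\<sigma> ''l'' 0 + 1) = L \<and> \<sigma> ''q'' 0 = int (length vs) \<and>
     (\<forall>j<length vs. \<exists>e<length es. \<sigma> ''sel'' (int j) = int e \<and> es ! e = vs ! j)"

lemma raw_agree:
  assumes "raw \<sigma>" "agree W \<sigma> \<tau>"
    "W \<subseteq> {''p'', ''L'', ''pos'', ''cost'', ''gain'', ''second'', ''c'', ''j''}"
  shows "raw \<tau>"
proof -
  have "\<tau> z = \<sigma> z" if "z \<notin> {''p'', ''L'', ''pos'', ''cost'', ''gain'', ''second'', ''c'', ''j''}" for z
    using agreeD[OF assms(2) contra_subsetD[OF assms(3) that]] .
  then show ?thesis using assms(1) unfolding raw_def by simp
qed

lemma writes_Ends: "writes Ends \<subseteq> {''pos'', ''cost'', ''gain'', ''second''}"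
  by (simp add: Ends_def)

lemma writes_Item: "writes Item \<subseteq> {''c'', ''pos'', ''cost'', ''gain'', ''second''}"
  by (simp add: Item_def)

lemma runs_Prep:
  assumes raw: "raw \<sigma>"
  shows "runs Prep \<sigma> (79 * length vs + 80)
    (\<lambda>\<tau>. inputs \<tau> \<and> prepared (2 * length vs + 2) \<tau> \<and> \<tau> ''I'' 0 = int (2 * length vs + 2))"
proof -
  define Q1 where "Q1 \<tau> \<longleftrightarrow> raw \<tau> \<and> \<tau> ''p'' 0 = p" for \<tau>
  define Q2 where "Q2 \<tau> \<longleftrightarrow> raw \<tau> \<and> \<tau> ''p'' 0 = p \<and> \<tau> ''L'' 0 = L" for \<tau>
  define Q3 where "Q3 k \<tau> \<longleftrightarrow> raw \<tau> \<and> \<tau> ''L'' 0 = L \<and> prepared (2 * k + 2) \<tau>" for k \<tau>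
  have 1: "runs (Clamp ''p'' ''k'') \<sigma> 11 Q1"
  proof (rule runs_Clamp)
    fix \<tau> assume \<tau>: "\<tau> = \<sigma>(''p'' := (\<sigma> ''p'')(0 := max 0 (\<sigma> ''k'' 0 + 1)))"
    then have "agree {''p''} \<sigma> \<tau>" by (simp add: agree_def)
    then have "raw \<tau>" using raw raw_agree by simp
    then show "Q1 \<tau>" using \<tau> raw by (simp add: Q1_def raw_def)
  qed
  have 2: "runs (Clamp ''L'' ''l'') \<tau> 11 Q2" if "Q1 \<tau>" for \<tau>
  proof (rule runs_Clamp)
    fix \<rho> assume \<rho>: "\<rho> = \<tau>(''L'' := (\<tau> ''L'')(0 := max 0 (\<tau> ''l'' 0 + 1)))"
    then have "agree {''L''} \<tau> \<rho>" by (simp add: agree_def)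
    then have "raw \<rho>" using \<open>Q1 \<tau>\<close> raw_agree[of \<tau> "{''L''}" \<rho>] by (simp add: Q1_def)
    then show "Q2 \<rho>" using \<rho> \<open>Q1 \<tau>\<close> by (simp add: Q2_def Q1_def raw_def)
  qed
  have 3: "runs Ends \<tau> 40 (Q3 0)" if "Q2 \<tau>" for \<tau>
  proof -
    have "\<tau> ''s'' 0 = int s" "\<tau> ''t'' 0 = int t" "\<tau> ''p'' 0 = p" "raw \<tau>" "\<tau> ''L'' 0 = L"
      using that by (simp_all add: Q2_def raw_def)
    note facts = this
    show ?thesis
    proof (rule runs_mono[OF runs_frame[OF runs_Ends[of \<tau>, OF facts(1,2,3)]]])
      fix \<rho> assume *: "prepared 2 \<rho> \<and> agree (writes Ends) \<tau> \<rho>"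
      then have ag: "agree {''pos'', ''cost'', ''gain'', ''second''} \<tau> \<rho>"
        using agree_mono[OF _ writes_Ends] by blast
      have "raw \<rho>" by (rule raw_agree[OF facts(4) ag]) simp
      moreover have "\<rho> ''L'' 0 = L" using agreeD[OF ag, of "''L''"] facts(5) by simp
      ultimately show "Q3 0 \<rho>" using * by (simp add: Q3_def numeral_2_eq_2)
    qed simp
  qed
  have 4: "runs (For ''j'' ''q'' Item) \<tau> (length vs * (67 + 12) + 9)
      (\<lambda>\<rho>. Q3 (length vs) \<rho> \<and> agree (insert ''j'' (writes Item)) \<tau> \<rho>)" if "Q3 0 \<tau>" for \<tau>
  proof (rule runs_For_const)
    show "\<tau> ''q'' 0 = int (length vs)" using that by (simp add: Q3_def raw_def)
    show "Q3 0 \<tau>" by fact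
    show "''j'' \<notin> writes Item" "''q'' \<notin> writes Item"
      by (rule contra_subsetD[OF writes_Item], simp)+
    show "Q3 k (\<rho>(''j'' := f))" if "Q3 k \<rho>" for k \<rho> f
    proof -
      have "agree {''j''} \<rho> (\<rho>(''j'' := f))" by (simp add: agree_def)
      then have "raw (\<rho>(''j'' := f))" using that raw_agree[of \<rho> "{''j''}" "\<rho>(''j'' := f)"] by (simp add: Q3_def)
      then show ?thesis using that by (simp add: Q3_def other_upd)
    qed
    fix j \<rho> assume j: "j < length vs" and inv: "Q3 j \<rho>" and jv: "\<rho> ''j'' 0 = int j"
    have raw': "raw \<rho>" and prep: "prepared (2 * j + 2) \<rho>" and L': "\<rho> ''L'' 0 = L"
      using inv by (simp_all add: Q3_def)
    obtain e where e: "e < length es" "\<rho> ''sel'' (int j) = int e" "es ! e = vs ! j"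
      using raw' j unfolding raw_def by blast
    have "\<rho> ''tail'' (int e) = int (fst (vs ! j))" "\<rho> ''head'' (int e) = int (snd (vs ! j))"
      "\<rho> ''weight'' (int e) = w (vs ! j)"
      using raw' e(1) unfolding raw_def e(3)[symmetric] by simp_all
    note item = runs_Item[OF prep jv e(2) this]
    show "runs Item \<rho> 67 (Q3 (Suc j))"
    proof (rule runs_mono[OF runs_frame[OF item]])
      fix \<pi> assume *: "prepared (2 * Suc j + 2) \<pi> \<and> agree (writes Item) \<rho> \<pi>"
      then have ag: "agree {''c'', ''pos'', ''cost'', ''gain'', ''second''} \<rho> \<pi>"
        using agree_mono[OF _ writes_Item] by blast
      have "raw \<pi>" by (rule raw_agree[OF raw' ag]) simp
      moreover have "\<pi> ''L'' 0 = L" using agreeD[OF ag, of "''L''"] L' by simp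
      ultimately show "Q3 (Suc j) \<pi>" using * by (simp add: Q3_def)
    qed simp
  qed simp
  have 5: "runs (Set ''I'' (Plus (Plus (Var ''q'') (Var ''q'')) (Num 2))) \<tau> 9
      (\<lambda>\<tau>. inputs \<tau> \<and> prepared (2 * length vs + 2) \<tau> \<and> \<tau> ''I'' 0 = int (2 * length vs + 2))"
    (is "runs _ _ _ ?Q") if "Q3 (length vs) \<tau> \<and> agree (insert ''j'' (writes Item)) \<rho> \<tau>" for \<tau> \<rho>
  proof (rule runs_Assign_at[of ?Q _ _ 0 "int (2 * length vs + 2)"])
    have "inputs \<tau>" using that by (simp add: Q3_def raw_def inputs_def)
    then show "?Q (\<tau>(''I'' := (\<tau> ''I'')(0 := int (2 * length vs + 2))))"
      using that by (simp add: Q3_def other_upd)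
    show "aval (Plus (Plus (Var ''q'') (Var ''q'')) (Num 2)) \<tau> = int (2 * length vs + 2)"
      using that by (simp add: Q3_def raw_def)
  qed simp_all
  have "runs Prep \<sigma> (11 + (11 + (40 + (length vs * (67 + 12) + 9 + 9))))
      (\<lambda>\<tau>. inputs \<tau> \<and> prepared (2 * length vs + 2) \<tau> \<and> \<tau> ''I'' 0 = int (2 * length vs + 2))"
    unfolding Prep_def
    by (rule runs_Seq[OF 1], rule runs_Seq[OF 2], assumption, rule runs_Seq[OF 3], assumption,
        rule runs_Seq[OF 4], assumption, rule 5)
  then show ?thesis by (rule runs_mono) simp_all
qed

definition affordable :: bool where
  "affordable \<longleftrightarrow> (\<exists>v c. der items v c \<and> c < L)"

lemma writes_Level:
  "writes Level \<subseteq> {''x'', ''H'', ''P'', ''X'', ''row'', ''sum'', ''bits'', ''tab'', ''u'', ''v'', ''y'', ''e'', ''r''}"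
proof -
  have "writes Mask \<subseteq>
      {''x'', ''H'', ''P'', ''X'', ''row'', ''sum'', ''bits'', ''tab'', ''u'', ''v'', ''y'', ''e'', ''r''}"
    by (rule subset_trans[OF writes_Mask]) simp
  then show ?thesis by (simp add: Level_def)
qed

text \<open>The set of all items is balanced, so any derivation for it can jump to vertex 0; looking
  at this one cell suffices.\<close>

lemma runs_Check:
  assumes st: "stage (2 * length vs + 2) \<tau>" and fill: "filled (2 ^ (2 * length vs + 2)) \<tau>"
    and ans: "\<tau> ''answer'' 0 = a"
  shows "runs Check \<tau> 20 (\<lambda>\<rho>. \<rho> ''answer'' 0 = (if affordable then 1 else a))"
proof -
  define N where "N = (2::nat) ^ (2 * length vs + 2)"
  have "1 < N" unfolding N_def by (rule one_less_power) simp_all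
  then have N: "0 < N - 1" "N - 1 < N" "1 \<le> N" by simp_all
  have dec: "dec (N - 1) = items" unfolding N_def by (rule set_decode_full)
  have row: "\<tau> ''row'' (int (N - 1)) = cell (N - 1) 0"
  proof -
    have "\<tau> ''row'' (int (N - 1)) = int ((N - 1) * n)"
      using fill N(2) unfolding filled_def N_def[symmetric] by blast
    then show ?thesis by (simp only: cell_def add_0_right)
  qed
  have snd: "sound (N - 1) (\<tau> ''tab'')" and comp: "complete (N - 1) (\<tau> ''tab'')"
    using fill N(1,2) unfolding filled_def N_def[symmetric] by blast+
  have zero: "total items = 0"
    unfolding sum_items by (simp add: amount_def)
  have P: "\<tau> ''P'' 0 - 1 = int (N - 1)" using st N(3) by (simp add: stage_def N_def)
  have test: "\<tau> ''tab'' (cell (N - 1) 0) < L \<longleftrightarrow> affordable"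
  proof
    assume "\<tau> ''tab'' (cell (N - 1) 0) < L"
    then show "affordable" using snd n_pos dec unfolding sound_def affordable_def by metis
  next
    assume "affordable"
    then obtain v c where vc: "der items v c" "c < L" unfolding affordable_def by blast
    have "der items 0 c" by (rule der.jump[OF vc(1) zero]) (use n_pos in simp)
    then have "\<tau> ''tab'' (cell (N - 1) 0) \<le> c" using comp n_pos dec unfolding complete_def by metis
    then show "\<tau> ''tab'' (cell (N - 1) 0) < L" using vc(2) by simp
  qed
  have L': "\<tau> ''L'' 0 = L" using st by (simp add: stage_def inputs_def)
  let ?b = "Less (Cell ''tab'' (Cell ''row'' (Minus (Var ''P'') (Num 1)))) (Var ''L'')"
  let ?Q = "\<lambda>\<rho>. \<rho> ''answer'' 0 = (if affordable then 1 else a)"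
  have b: "bval ?b \<tau> \<longleftrightarrow> affordable"
    using P row L' test by (simp del: of_nat_diff)
  show ?thesis
    unfolding Check_def
  proof (rule runs_If[where T = 3])
    assume "bval ?b \<tau>"
    then have yes: "affordable" using b by blast
    show "runs (Set ''answer'' (Num 1)) \<tau> 3 ?Q"
      by (rule runs_Assign_at[of ?Q _ _ 0 1]) (simp_all add: yes)
  next
    assume "\<not> bval ?b \<tau>"
    then have "?Q \<tau>" using b ans by simp
    then show "runs Skip \<tau> 3 ?Q" by - (rule runs_Skip, assumption, simp)
  qed simp
qed

text \<open>With \<open>N = 4^(u+1)\<close>, where \<open>u\<close> is the length of
  \<open>vs\<close>: at most \<open>N\<close> levels, at most \<open>N\<close> masks in each, and
  about \<open>500 * N * n ^ 3\<close> steps per mask. This gives \<open>N^3 = 64^(u+1)\<close>; the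
  lower-order terms are absorbed by doubling 500.\<close>

lemma runs_Core:
  assumes raw: "raw \<sigma>" and m: "length es \<le> n * n"
  shows "runs Core \<sigma> (1000 * 64 ^ (length vs + 1) * n ^ 3)
    (\<lambda>\<tau>. \<tau> ''answer'' 0 = (if affordable then 1 else \<sigma> ''answer'' 0))"
proof -
  define N where "N = (4::nat) ^ (length vs + 1)"
  define a where "a = \<sigma> ''answer'' 0"
  have N: "(2::nat) ^ (2 * length vs + 2) = N"
    unfolding N_def using power_mult[of "2::nat" 2 "length vs + 1"] by simp
  define Q0 where "Q0 \<tau> \<longleftrightarrow> inputs \<tau> \<and> prepared (2 * length vs + 2) \<tau> \<and>
    \<tau> ''I'' 0 = int (2 * length vs + 2) \<and> \<tau> ''answer'' 0 = a" for \<tau>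
  define Q1 where "Q1 k \<tau> \<longleftrightarrow> stage k \<tau> \<and> filled (2 ^ k) \<tau> \<and>
    \<tau> ''I'' 0 = int (2 * length vs + 2) \<and> \<tau> ''answer'' 0 = a" for k \<tau>
  have 1: "runs Prep \<sigma> (79 * length vs + 80) Q0"
  proof (rule runs_mono[OF runs_frame[OF runs_Prep[OF raw]]])
    have "''answer'' \<notin> writes Prep" by (simp add: Prep_def Ends_def Item_def)
    then show "Q0 \<tau>" if "(inputs \<tau> \<and> prepared (2 * length vs + 2) \<tau> \<and>
      \<tau> ''I'' 0 = int (2 * length vs + 2)) \<and> agree (writes Prep) \<sigma> \<tau>" for \<tau>
      using that by (simp add: Q0_def a_def agree_def)
  qed simp
  have 2: "runs Init \<tau> 15 (Q1 0)" if "Q0 \<tau>" for \<tau>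
  proof -
    have "inputs \<tau>" "prepared (2 * length vs + 2) \<tau>" using that by (simp_all add: Q0_def)
    note init = runs_Init[OF this]
    show ?thesis
    proof (rule runs_mono[OF runs_frame[OF init]])
      have "''answer'' \<notin> writes Init" "''I'' \<notin> writes Init" by (simp_all add: Init_def)
      then show "Q1 0 \<rho>" if "(stage 0 \<rho> \<and> filled 1 \<rho>) \<and> agree (writes Init) \<tau> \<rho>" for \<rho>
        using that \<open>Q0 \<tau>\<close> by (simp add: Q0_def Q1_def agree_def)
    qed simp
  qed
  let ?T = "N * (500 * (N * n ^ 3) + 12) + 20"
  have 3: "runs (For ''i'' ''I'' Level) \<tau> ((2 * length vs + 2) * (?T + 12) + 9)
      (\<lambda>\<rho>. Q1 (2 * length vs + 2) \<rho> \<and> agree (insert ''i'' (writes Level)) \<tau> \<rho>)" if "Q1 0 \<tau>" for \<tau>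
  proof (rule runs_For_const)
    show "\<tau> ''I'' 0 = int (2 * length vs + 2)" using that by (simp add: Q1_def)
    show "Q1 0 \<tau>" by fact
    show "''i'' \<notin> writes Level" "''I'' \<notin> writes Level"
      by (rule contra_subsetD[OF writes_Level], simp)+
    show "Q1 k (\<rho>(''i'' := f))" if "Q1 k \<rho>" for k \<rho> f
      using that by (simp add: Q1_def stage_def other_upd)
    fix k \<rho> assume k: "k < 2 * length vs + 2" and inv: "Q1 k \<rho>" and iv: "\<rho> ''i'' 0 = int k"
    have "stage k \<rho>" "filled (2 ^ k) \<rho>" "k \<in> items" using inv k by (simp_all add: Q1_def)
    note level = runs_Level[OF this iv m N_def]
    show "runs Level \<rho> ?T (Q1 (Suc k))"
    proof (rule runs_mono[OF runs_frame[OF level]])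
      fix \<pi> assume *: "(stage (Suc k) \<pi> \<and> filled (2 ^ Suc k) \<pi>) \<and> agree (writes Level) \<rho> \<pi>"
      then have ag: "agree (writes Level) \<rho> \<pi>" by blast
      have "\<pi> ''I'' = \<rho> ''I''" "\<pi> ''answer'' = \<rho> ''answer''"
        by (rule agreeD[OF ag contra_subsetD[OF writes_Level]], simp)+
      then show "Q1 (Suc k) \<pi>" using * inv by (simp add: Q1_def)
    qed simp
  qed simp
  have 4: "runs Check \<tau> 20 (\<lambda>\<rho>. \<rho> ''answer'' 0 = (if affordable then 1 else a))"
    if "Q1 (2 * length vs + 2) \<tau> \<and> agree (insert ''i'' (writes Level)) \<rho> \<tau>" for \<tau> \<rho>
    using that by (intro runs_Check) (simp_all add: Q1_def)
  have "runs Core \<sigma> (79 * length vs + 80 + (15 + ((2 * length vs + 2) * (?T + 12) + 9 + 20)))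
      (\<lambda>\<rho>. \<rho> ''answer'' 0 = (if affordable then 1 else a))"
    unfolding Core_def
    by (rule runs_Seq[OF 1], rule runs_Seq[OF 2], assumption, rule runs_Seq[OF 3], assumption, rule 4)
  then show ?thesis
  proof (rule runs_mono)
    define M where "M = N * (N * (N * n ^ 3))"
    have "length vs < 2 ^ length vs" by (rule less_exp)
    also have "(2::nat) ^ length vs \<le> 4 ^ length vs" by (intro power_mono) simp_all
    finally have "length vs < 4 ^ length vs" .
    moreover have "N = 4 * 4 ^ length vs" by (simp add: N_def)
    ultimately have q: "2 * length vs + 2 \<le> N" by linarith
    have "1 \<le> n ^ 3" using n_pos by simp
    then have one: "1 \<le> N * n ^ 3" using q by simp
    have "N * 1 \<le> N * (N * n ^ 3)" using one by (rule mult_le_mono2)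
    then have le: "N \<le> N * (N * n ^ 3)" by (simp only: mult_1_right)
    have "1 \<le> N" using q by simp
    then have "1 * (N * (N * n ^ 3)) \<le> M" unfolding M_def by (rule mult_le_mono1)
    then have NM2: "N * (N * n ^ 3) \<le> M" by (simp only: mult_1)
    with le have NM: "N \<le> M" by (rule le_trans)
    have NN: "N * N \<le> M" unfolding M_def using one by (intro mult_le_mono2) simp
    have "(2 * length vs + 2) * (?T + 12) \<le> N * (?T + 12)" using q by (rule mult_le_mono1)
    also have "\<dots> = 500 * M + 12 * (N * N) + 32 * N" by (simp add: M_def algebra_simps)
    finally have "79 * length vs + 80 + (15 + ((2 * length vs + 2) * (?T + 12) + 9 + 20)) \<le> 1000 * M"
      using q NM NM2 NN by linarith
    also have "M = 64 ^ (length vs + 1) * n ^ 3"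
    proof -
      have "N * N * N = 64 ^ (length vs + 1)" unfolding N_def by (simp flip: power_mult_distrib)
      then show ?thesis by (simp add: M_def mult.assoc)
    qed
    finally show "79 * length vs + 80 + (15 + ((2 * length vs + 2) * (?T + 12) + 9 + 20))
        \<le> 1000 * 64 ^ (length vs + 1) * n ^ 3" by simp
  qed (simp add: a_def)
qed

end

section \<open>Correctness of the answer for fixed vulnerable edges\<close>

lemma has_st_path_iff:
  assumes "ftp_instance I" "A \<subseteq> parcs (graph I)"
  shows "has_st_path I A \<longleftrightarrow> (source I, target I) \<in> A\<^sup>*"
proof -
  let ?V = "pverts (graph I)" and ?s = "source I" and ?t = "target I"
  have fin: "pair_fin_digraph (graph I)" and ends: "?s \<in> ?V" using assms by (simp_all add: ftp_instance_def)
  have AV: "A \<subseteq> ?V \<times> ?V"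
  proof
    interpret pair_fin_digraph "graph I" by (rule fin)
    fix e assume "e \<in> A"
    then have "(fst e, snd e) \<in> parcs (graph I)" using assms(2) by auto
    from in_arcsD1[OF this] in_arcsD2[OF this] have "fst e \<in> ?V" "snd e \<in> ?V" .
    then show "e \<in> ?V \<times> ?V" by (simp add: mem_Times_iff)
  qed
  let ?G = "\<lparr>pverts = ?V, parcs = A\<rparr>"
  have "pair_wf_digraph ?G"
    using AV by unfold_locales (auto simp: subset_iff)
  then interpret pair_wf_digraph ?G .
  \<comment> \<open>A path is a walk, and a walk can be shortened to one without repeated vertices;
    walks in turn amount to plain reachability.\<close>
  have "has_st_path I A \<longleftrightarrow> (\<exists>p. awalk ?s p ?t)"
    unfolding has_st_path_def
  proof
    assume "\<exists>p. apath ?s p ?t"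
    then obtain p where "apath ?s p ?t" by blast
    then show "\<exists>p. awalk ?s p ?t" by (intro exI[of _ p]) (rule awalkI_apath)
  next
    assume "\<exists>p. awalk ?s p ?t"
    then obtain p where "awalk ?s p ?t" by blast
    from apath_awalk_to_apath[OF this] show "\<exists>p. apath ?s p ?t" by (rule exI)
  qed
  also have "\<dots> \<longleftrightarrow> (?s, ?t) \<in> rtrancl_on ?V A"
    unfolding reachable_awalk[symmetric] reachable_def by simp
  also have "\<dots> \<longleftrightarrow> (?s, ?t) \<in> A\<^sup>*"
  proof
    assume "(?s, ?t) \<in> rtrancl_on ?V A"
    then show "(?s, ?t) \<in> A\<^sup>*"
      by (rule rtrancl_on_rtranclI)
  next
    assume "(?s, ?t) \<in> A\<^sup>*"
    then show "(?s, ?t) \<in> rtrancl_on ?V A"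
    proof (induction rule: rtrancl_induct)
      case base
      then show ?case using ends by simp
    next
      case (step y z)
      then have "z \<in> ?V" using AV by blast
      with step.IH step.hyps(2) show ?case by (rule rtrancl_on_into_rtrancl_on)
    qed
  qed
  finally show ?thesis .
qed

context ftp_core
begin

text \<open>Flow duality combined with soundness and completeness of derivations. For
  \<open>l < 0\<close> the limit \<open>L\<close> is 0, and as costs are nonnegative nothing is
  affordable, just as no set of edges fits the budget.\<close>

lemma affordable_iff:
  assumes "p = max 0 (k + 1)" "L = max 0 (l + 1)"
  shows "affordable \<longleftrightarrow> (\<exists>K. K \<subseteq> S \<union> set vs \<and> sum w K \<le> l \<and> robust k s t (set vs) K)"
proof -
  have fin: "finite K" if "K \<subseteq> S \<union> set vs" for K
    using finite_subset[OF that] finite_S by simp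
  show ?thesis
  proof
    assume affordable
    then obtain v c where vc: "der items v c" "c < L" unfolding affordable_def by blast
    then have "c \<le> l" using der_props[OF vc(1)] assms(2) by auto
    obtain K \<phi> where K: "K \<subseteq> S \<union> set vs" "sum w K \<le> c" "unit_flow p s t (set vs) K \<phi>"
      using der_sound[OF vc(1)] by blast
    then have "robust k s t (set vs) K"
      using robust_iff_unit_flow[OF fin[OF K(1)]] assms(1) by blast
    then show "\<exists>K. K \<subseteq> S \<union> set vs \<and> sum w K \<le> l \<and> robust k s t (set vs) K"
      using K(1,2) \<open>c \<le> l\<close> by (intro exI[of _ K]) simp
  next
    assume "\<exists>K. K \<subseteq> S \<union> set vs \<and> sum w K \<le> l \<and> robust k s t (set vs) K"
    then obtain K where K: "K \<subseteq> S \<union> set vs" "sum w K \<le> l" "robust k s t (set vs) K" by blast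
    then obtain \<phi> where "unit_flow p s t (set vs) K \<phi>"
      using robust_iff_unit_flow[OF fin[OF K(1)]] assms(1) by blast
    then obtain v c where "der items v c" "c \<le> sum w K" using der_complete[OF K(1)] by blast
    moreover have "c < L" using calculation K(2) assms(2) by simp
    ultimately show affordable unfolding affordable_def by blast
  qed
qed

end

section \<open>Trying sets of vulnerable edges\<close>

definition "Gather = Seq (Set ''q'' (Num 0)) (For ''z'' ''m''
  (If (Eq (Cell ''vulnerable'' (Var ''z'')) (Num 1))
    (Seq (Assign ''sel'' (Var ''q'') (Var ''z'')) (Set ''q'' (Plus (Var ''q'') (Num 1)))) Skip))"

locale ftp_input =
  fixes I :: "nat ftp" and es :: "(nat \<times> nat) list"
  assumes inst: "ftp_instance I" and verts: "pverts (graph I) = {..<num_verts I}"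
    and distinct_es: "distinct es" and set_es: "set es = parcs (graph I)"
begin

abbreviation n :: nat where "n \<equiv> num_verts I"
abbreviation m :: nat where "m \<equiv> num_edges I"

lemma length_es: "length es = m"
  using distinct_card[OF distinct_es] set_es by (simp add: num_edges_def)

lemma es_bounds: "set es \<subseteq> {..<n} \<times> {..<n}"
proof
  interpret pair_fin_digraph "graph I" using inst by (simp add: ftp_instance_def)
  fix e assume "e \<in> set es"
  then have "(fst e, snd e) \<in> parcs (graph I)" using set_es by simp
  from in_arcsD1[OF this] in_arcsD2[OF this]
  have "fst e \<in> pverts (graph I)" "snd e \<in> pverts (graph I)" .
  then show "e \<in> {..<n} \<times> {..<n}" unfolding verts by (simp add: mem_Times_iff)
qed

lemma m_le: "m \<le> n * n"
proof -
  have "card (set es) \<le> card ({..<n} \<times> {..<n})" using es_bounds by (intro card_mono) auto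
  then show ?thesis using set_es by (simp add: num_edges_def card_cartesian_product)
qed

lemma n_positive: "0 < n"
  using inst verts by (auto simp: ftp_instance_def)

lemma parts: "safe I \<union> vulnerable I = set es" "safe I \<inter> vulnerable I = {}"
  using inst set_es by (simp_all add: ftp_instance_def)

definition solvable_with :: "(nat \<times> nat) list \<Rightarrow> bool" where
  "solvable_with vs \<longleftrightarrow> (\<exists>K. ftp_solution I K \<and> K \<inter> vulnerable I \<subseteq> set vs)"

text \<open>The part of the store that holds the input. It leaves out \<open>sel\<close>,
  \<open>q\<close> and \<open>answer\<close>, which change between calls of
  \<open>Core\<close>.\<close>

definition loaded :: "store \<Rightarrow> bool" where
  "loaded \<sigma> \<longleftrightarrow> \<sigma> ''n'' 0 = int n \<and> \<sigma> ''m'' 0 = int m \<and>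
     (\<forall>e<m. \<sigma> ''tail'' (int e) = int (fst (es ! e)) \<and> \<sigma> ''head'' (int e) = int (snd (es ! e)) \<and>
        \<sigma> ''weight'' (int e) = int (weight I (es ! e)) \<and>
        \<sigma> ''vulnerable'' (int e) = of_bool (es ! e \<in> vulnerable I)) \<and>
     \<sigma> ''s'' 0 = int (source I) \<and> \<sigma> ''t'' 0 = int (target I) \<and>
     \<sigma> ''k'' 0 = faults I \<and> \<sigma> ''l'' 0 = budget I"

lemma loaded_encode: "loaded (encode I es)"
  by (simp add: loaded_def encode_def scalar_def array_def length_es)

lemma loaded_cong:
  assumes "loaded \<sigma>"
    "\<And>z. z \<in> {''n'', ''m'', ''tail'', ''head'', ''weight'', ''vulnerable'', ''s'', ''t'', ''k'', ''l''}
      \<Longrightarrow> \<tau> z = \<sigma> z"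
  shows "loaded \<tau>"
  using assms by (simp add: loaded_def)

lemma core_interpretation:
  assumes "distinct vs" "set vs \<subseteq> vulnerable I"
  shows "ftp_core n (safe I) (\<lambda>e. int (weight I e)) vs (source I) (target I) es (max 0 (budget I + 1))"
proof unfold_locales
  show "finite {..<n}" by simp
  show "safe I \<subseteq> {..<n} \<times> {..<n}" "set vs \<subseteq> {..<n} \<times> {..<n}"
    using es_bounds parts(1) assms(2) by blast+
  show "1 \<le> int (weight I e)" if "e \<in> safe I \<union> set vs" for e
  proof -
    have "e \<in> parcs (graph I)" using that parts(1) set_es assms(2) by blast
    then have "1 \<le> weight I e" using inst by (simp add: ftp_instance_def)
    then show ?thesis by simp
  qed
  show "safe I \<inter> set vs = {}" using parts(2) assms(2) by blast
  show "distinct vs" by fact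
  show "source I \<in> {..<n}" "target I \<in> {..<n}"
    using inst unfolding verts[symmetric] by (simp_all add: ftp_instance_def)
  show "safe I \<subseteq> set es" using parts(1) by blast
  show "set es \<subseteq> {..<n} \<times> {..<n}" by (rule es_bounds)
qed simp

text \<open>A solution whose vulnerable edges lie in \<open>vs\<close> can only lose edges of
  \<open>vs\<close>. So the remaining vulnerable edges may be deleted from the instance.\<close>

lemma solution_iff:
  assumes "set vs \<subseteq> vulnerable I"
  shows "solvable_with vs \<longleftrightarrow> (\<exists>K. K \<subseteq> safe I \<union> set vs \<and> sum (\<lambda>e. int (weight I e)) K \<le> budget I \<and>
    robust (faults I) (source I) (target I) (set vs) K)"
proof -
  have "ftp_solution I K \<and> K \<inter> vulnerable I \<subseteq> set vs \<longleftrightarrow>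
      K \<subseteq> safe I \<union> set vs \<and> sum (\<lambda>e. int (weight I e)) K \<le> budget I \<and>
      robust (faults I) (source I) (target I) (set vs) K" for K
  proof (cases "K \<subseteq> safe I \<union> set vs")
    case True
    then have K: "K \<subseteq> parcs (graph I)" using parts(1) set_es assms by blast
    have cut: "K \<inter> vulnerable I = K \<inter> set vs" using True parts(2) assms by blast
    have "has_st_path I (K - F) \<longleftrightarrow> (source I, target I) \<in> (K - F)\<^sup>*" for F
      by (rule has_st_path_iff[OF inst]) (use K in blast)
    then show ?thesis using True K cut by (simp add: ftp_solution_def robust_def)
  next
    case False
    have "\<not> (ftp_solution I K \<and> K \<inter> vulnerable I \<subseteq> set vs)"
    proof
      assume "ftp_solution I K \<and> K \<inter> vulnerable I \<subseteq> set vs"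
      then have "K \<subseteq> set es" "K \<inter> vulnerable I \<subseteq> set vs" by (simp_all add: ftp_solution_def set_es)
      then show False using False parts(1) by blast
    qed
    then show ?thesis using False by blast
  qed
  then show ?thesis unfolding solvable_with_def by simp
qed

lemma runs_Core_input:
  assumes load: "loaded \<sigma>" and vs: "distinct vs" "set vs \<subseteq> vulnerable I"
    and q: "\<sigma> ''q'' 0 = int (length vs)"
    and sel: "\<And>j. j < length vs \<Longrightarrow> \<exists>e<m. \<sigma> ''sel'' (int j) = int e \<and> es ! e = vs ! j"
  shows "runs Core \<sigma> (1000 * 64 ^ (length vs + 1) * n ^ 3)
    (\<lambda>\<tau>. \<tau> ''answer'' 0 = (if solvable_with vs then 1 else \<sigma> ''answer'' 0))"
proof -
  interpret C: ftp_core n "safe I" "\<lambda>e. int (weight I e)" vs "source I" "target I"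
    "max 0 (faults I + 1)" es "max 0 (budget I + 1)"
    by (rule core_interpretation[OF vs])
  have part: "es ! e \<in> vulnerable I \<longleftrightarrow> es ! e \<notin> safe I" if "e < m" for e
  proof -
    have "es ! e \<in> set es" using that length_es by simp
    then show ?thesis using parts by blast
  qed
  have "C.raw \<sigma>"
    unfolding C.raw_def length_es
  proof (intro conjI allI impI)
    fix j assume "j < length vs"
    then show "\<exists>e<m. \<sigma> ''sel'' (int j) = int e \<and> es ! e = vs ! j" by (rule sel)
  qed (use load q part in \<open>simp_all add: loaded_def\<close>)
  moreover have "length es \<le> n * n" using m_le length_es by simp
  moreover have "C.affordable \<longleftrightarrow> solvable_with vs"
    unfolding solution_iff[OF vs(2)] by (rule C.affordable_iff) (rule refl)+
  ultimately show ?thesis using C.runs_Core by simp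
qed

definition vulnerable_indices :: "nat \<Rightarrow> nat list" where
  "vulnerable_indices k = filter (\<lambda>e. es ! e \<in> vulnerable I) [0..<k]"

lemma vulnerable_indices_m:
  "distinct (map ((!) es) (vulnerable_indices m))"
  "set (map ((!) es) (vulnerable_indices m)) = vulnerable I"
  "length (vulnerable_indices m) = num_vulnerable I"
proof -
  show d: "distinct (map ((!) es) (vulnerable_indices m))"
    using distinct_es length_es
    by (auto simp: distinct_map vulnerable_indices_def inj_on_def nth_eq_iff_index_eq)
  show s: "set (map ((!) es) (vulnerable_indices m)) = vulnerable I"
  proof (intro equalityI subsetI)
    fix x assume x: "x \<in> vulnerable I"
    then have "x \<in> set es" using parts(1) by blast
    then obtain e where "e < m" "es ! e = x" using length_es by (metis in_set_conv_nth)
    then show "x \<in> set (map ((!) es) (vulnerable_indices m))"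
      using x by (auto simp: vulnerable_indices_def)
  qed (auto simp: vulnerable_indices_def)
  show "length (vulnerable_indices m) = num_vulnerable I"
    using distinct_card[OF d] unfolding s by (simp add: num_vulnerable_def)
qed

lemma runs_Gather:
  assumes load: "loaded \<sigma>"
  shows "runs Gather \<sigma> (37 * m + 12) (\<lambda>\<tau>. loaded \<tau> \<and> \<tau> ''answer'' 0 = \<sigma> ''answer'' 0 \<and>
    \<tau> ''q'' 0 = int (num_vulnerable I) \<and>
    (\<forall>j<num_vulnerable I. \<tau> ''sel'' (int j) = int (vulnerable_indices m ! j)))"
proof -
  let ?b = "Eq (Cell ''vulnerable'' (Var ''z'')) (Num 1)"
  let ?c = "Seq (Assign ''sel'' (Var ''q'') (Var ''z'')) (Set ''q'' (Plus (Var ''q'') (Num 1)))"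
  define Inv where "Inv k \<tau> \<longleftrightarrow> loaded \<tau> \<and> \<tau> ''answer'' 0 = \<sigma> ''answer'' 0 \<and>
    \<tau> ''q'' 0 = int (length (vulnerable_indices k)) \<and>
    (\<forall>j<length (vulnerable_indices k). \<tau> ''sel'' (int j) = int (vulnerable_indices k ! j))" for k \<tau>
  have load_upd: "loaded (\<tau>(z := f))" if "loaded \<tau>"
    "z \<notin> {''n'', ''m'', ''tail'', ''head'', ''weight'', ''vulnerable'', ''s'', ''t'', ''k'', ''l''}" for \<tau> z f
    by (rule loaded_cong[OF that(1)], rule fun_upd_other, rule notI) (use that(2) in simp)
  have loop: "runs (For ''z'' ''m'' (If ?b ?c Skip)) \<tau> (m * (25 + 12) + 9)
      (\<lambda>\<rho>. Inv m \<rho> \<and> agree (insert ''z'' (writes (If ?b ?c Skip))) \<tau> \<rho>)" if "Inv 0 \<tau>" for \<tau>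
  proof (rule runs_For_const)
    show "\<tau> ''m'' 0 = int m" using that by (simp add: Inv_def loaded_def)
    show "Inv 0 \<tau>" by fact
    show "Inv k (\<rho>(''z'' := f))" if "Inv k \<rho>" for k \<rho> f
      using that by (simp add: Inv_def load_upd)
    fix k \<rho> assume k: "k < m" and inv: "Inv k \<rho>" and z: "\<rho> ''z'' 0 = int k"
    have vul: "\<rho> ''vulnerable'' (int k) = of_bool (es ! k \<in> vulnerable I)"
      using inv k by (simp add: Inv_def loaded_def)
    show "runs (If ?b ?c Skip) \<rho> 25 (Inv (Suc k))"
    proof (rule runs_If[where T = 11])
      assume "bval ?b \<rho>"
      then have "es ! k \<in> vulnerable I" using vul z by (auto split: if_splits)
      then have idx: "vulnerable_indices (Suc k) = vulnerable_indices k @ [k]"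
        by (simp add: vulnerable_indices_def)
      let ?q = "length (vulnerable_indices k)"
      have q: "\<rho> ''q'' 0 = int ?q" using inv by (simp add: Inv_def)
      define \<rho>1 where "\<rho>1 = \<rho>(''sel'' := (\<rho> ''sel'')(int ?q := int k))"
      define \<rho>2 where "\<rho>2 = \<rho>1(''q'' := (\<rho>1 ''q'')(0 := int ?q + 1))"
      have "loaded \<rho>2" unfolding \<rho>2_def \<rho>1_def using inv by (intro load_upd) (simp_all add: Inv_def)
      then have Q: "Inv (Suc k) \<rho>2"
        using inv by (simp add: Inv_def idx \<rho>2_def \<rho>1_def nth_append less_Suc_eq)
      have "runs (Set ''q'' (Plus (Var ''q'') (Num 1))) \<rho>1 6 (Inv (Suc k))"
        by (rule runs_Assign_at[of "Inv (Suc k)" \<rho>1 "''q''" 0 "int ?q + 1", OF Q[unfolded \<rho>2_def]])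
          (simp_all add: \<rho>1_def q)
      then show "runs ?c \<rho> 11 (Inv (Suc k))"
        unfolding \<rho>1_def by (rule runs_Seq_Assign_at) (simp_all add: q z)
    next
      assume "\<not> bval ?b \<rho>"
      then have "es ! k \<notin> vulnerable I" using vul z by auto
      then have "vulnerable_indices (Suc k) = vulnerable_indices k" by (simp add: vulnerable_indices_def)
      then have "Inv (Suc k) \<rho>" using inv by (simp add: Inv_def)
      then show "runs Skip \<rho> 11 (Inv (Suc k))" by - (rule runs_Skip, assumption, simp)
    qed simp
  qed simp_all
  have "Inv 0 (\<sigma>(''q'' := (\<sigma> ''q'')(0 := 0)))"
    using load by (simp add: Inv_def load_upd vulnerable_indices_def)
  from loop[OF this] have "runs Gather \<sigma> (3 + (m * (25 + 12) + 9))
      (\<lambda>\<rho>. Inv m \<rho> \<and> agree (insert ''z'' (writes (If ?b ?c Skip))) (\<sigma>(''q'' := (\<sigma> ''q'')(0 := 0))) \<rho>)"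
    unfolding Gather_def by (rule runs_Seq_Assign_at) simp_all
  then show ?thesis
    by (rule runs_mono) (simp_all add: Inv_def vulnerable_indices_m(3))
qed

lemma ftp_yes_iff: "ftp_yes I \<longleftrightarrow> solvable_with (map ((!) es) (vulnerable_indices m))"
  unfolding ftp_yes_def solvable_with_def vulnerable_indices_m(2) by blast

lemma vulnerable_indices_less: "j < num_vulnerable I \<Longrightarrow> vulnerable_indices m ! j < m"
  using nth_mem[of j "vulnerable_indices m"] vulnerable_indices_m(3) by (simp add: vulnerable_indices_def)

text \<open>\<open>Core\<close> may discard vulnerable edges, so a single call with all of them
  decides the instance. The constant is 1000 for \<open>Core\<close> plus 37 and 12 for gathering,
  as \<open>m \<le> n ^ 3\<close>.\<close>

lemma runs_all:
  assumes load: "loaded \<sigma>"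
  shows "runs (Seq Gather Core) \<sigma> (1049 * 64 ^ (num_vulnerable I + 1) * n ^ 3)
    (\<lambda>\<tau>. \<tau> ''answer'' 0 = (if ftp_yes I then 1 else \<sigma> ''answer'' 0))"
proof -
  let ?u = "num_vulnerable I"
  have "runs (Seq Gather Core) \<sigma> (37 * m + 12 + 1000 * 64 ^ (?u + 1) * n ^ 3)
      (\<lambda>\<tau>. \<tau> ''answer'' 0 = (if ftp_yes I then 1 else \<sigma> ''answer'' 0))"
  proof (rule runs_Seq[OF runs_Gather[OF load]])
    fix \<tau> assume *: "loaded \<tau> \<and> \<tau> ''answer'' 0 = \<sigma> ''answer'' 0 \<and> \<tau> ''q'' 0 = int ?u \<and>
      (\<forall>j<?u. \<tau> ''sel'' (int j) = int (vulnerable_indices m ! j))"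
    let ?vs = "map ((!) es) (vulnerable_indices m)"
    have "runs Core \<tau> (1000 * 64 ^ (length ?vs + 1) * n ^ 3)
        (\<lambda>\<rho>. \<rho> ''answer'' 0 = (if solvable_with ?vs then 1 else \<tau> ''answer'' 0))"
    proof (rule runs_Core_input)
      show "\<exists>e<m. \<tau> ''sel'' (int j) = int e \<and> es ! e = ?vs ! j" if "j < length ?vs" for j
        using * that vulnerable_indices_less[of j] vulnerable_indices_m(3)
        by (intro exI[of _ "vulnerable_indices m ! j"]) simp
    qed (use * vulnerable_indices_m in simp_all)
    then show "runs Core \<tau> (1000 * 64 ^ (?u + 1) * n ^ 3)
        (\<lambda>\<rho>. \<rho> ''answer'' 0 = (if ftp_yes I then 1 else \<sigma> ''answer'' 0))"
      by (rule runs_mono) (simp_all add: * ftp_yes_iff vulnerable_indices_m(3))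
  qed
  then show ?thesis
  proof (rule runs_mono)
    have "n ^ 3 = n * (n * n)" by (simp add: power3_eq_cube)
    moreover have "1 * (n * n) \<le> n * (n * n)" using n_positive by (intro mult_le_mono1) simp
    ultimately have "m \<le> n ^ 3" using m_le by linarith
    moreover have "1 \<le> n ^ 3" using n_positive by simp
    moreover have "1 * n ^ 3 \<le> 64 ^ (?u + 1) * n ^ 3" by (intro mult_le_mono1) simp
    ultimately show "37 * m + 12 + 1000 * 64 ^ (?u + 1) * n ^ 3 \<le> 1049 * 64 ^ (?u + 1) * n ^ 3"
      by linarith
  qed
qed

end

text \<open>The cells \<open>0, \<dots>, d - 1\<close> of \<open>sel\<close> are an odometer to base \<open>m\<close>. A reading denotes a set of
  \<open>d\<close> vulnerable edges if it is increasing; cell \<open>- 1\<close> is a sentinel. There are \<open>M = m\<^sup>d\<close> readings,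
  and \<open>Grow\<close> multiplies \<open>M\<close> by \<open>m\<close> for the next round.\<close>

definition "Clear = Seq (Set ''q'' (Var ''d'')) (Seq (Assign ''sel'' (Num (- 1)) (Num (- 1)))
  (For ''z'' ''q'' (Assign ''sel'' (Var ''z'') (Num 0))))"

definition "Test = Seq (Set ''valid'' (Num 1)) (For ''z'' ''q''
  (If (And (Eq (Cell ''vulnerable'' (Cell ''sel'' (Var ''z''))) (Num 1))
      (Less (Cell ''sel'' (Minus (Var ''z'') (Num 1))) (Cell ''sel'' (Var ''z''))))
    Skip (Set ''valid'' (Num 0))))"

definition "Increment = Seq (Set ''carry'' (Num 1)) (For ''z'' ''q''
  (If (Eq (Var ''carry'') (Num 1))
    (If (Less (Plus (Cell ''sel'' (Var ''z'')) (Num 1)) (Var ''m''))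
      (Seq (Assign ''sel'' (Var ''z'') (Plus (Cell ''sel'' (Var ''z'')) (Num 1))) (Set ''carry'' (Num 0)))
      (Assign ''sel'' (Var ''z'') (Num 0)))
    Skip))"

definition "Attempt = Seq Test (Seq (If (Eq (Var ''valid'') (Num 1)) Core Skip) Increment)"

definition "Grow = Seq (Set ''A'' (Num 0)) (Seq (For ''z'' ''m'' (Set ''A'' (Plus (Var ''A'') (Var ''M''))))
  (Set ''M'' (Var ''A'')))"

definition "Round = Seq Clear (Seq (For ''g'' ''M'' Attempt) Grow)"

text \<open>The number of vulnerable edges is saved in \<open>U\<close> because \<open>q\<close>
  becomes the size of the current selection. Sizes run from 0 to the number of vulnerable edges
  inclusive, hence the added 1. After a success the remaining iterations cost a constant
  each.\<close>

definition "Search = Seq Gather (Seq (Set ''U'' (Plus (Var ''q'') (Num 1))) (Seq (Set ''M'' (Num 1))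
  (For ''d'' ''U'' (If (Eq (Var ''answer'') (Num 0)) Round Skip))))"

lemma writes_Core: "writes Core \<subseteq> {''p'', ''L'', ''pos'', ''cost'', ''gain'', ''second'', ''c'', ''j'', ''I'',
    ''P'', ''H'', ''row'', ''sum'', ''bits'', ''x'', ''i'', ''X'', ''tab'', ''u'', ''v'', ''y'', ''e'', ''r'',
    ''answer''}"
  by (simp add: Core_def Prep_def Init_def Level_def Check_def Ends_def Item_def Mask_def Setup_def
      Fill_def Single_def Discard_def Merge_def Close_def Jump_def Edges_def)

section \<open>The odometer and the search by size\<close>

context ftp_input
begin

definition enc :: "nat \<Rightarrow> (nat \<Rightarrow> nat) \<Rightarrow> nat" where
  "enc r f = (\<Sum>j<r. f j * m ^ j)"

lemma enc_less: "(\<And>j. j < r \<Longrightarrow> f j < m) \<Longrightarrow> enc r f < m ^ r"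
proof (induction r)
  case (Suc r)
  then have "enc r f < m ^ r" and "Suc (f r) \<le> m" by (simp_all add: Suc_leI)
  then have "enc r f + f r * m ^ r < Suc (f r) * m ^ r" by simp
  also have "\<dots> \<le> m * m ^ r" using \<open>Suc (f r) \<le> m\<close> by (rule mult_le_mono1)
  finally show ?case by (simp add: enc_def)
qed (simp add: enc_def)

lemma enc_inj:
  assumes "enc r f = enc r g" "\<And>j. j < r \<Longrightarrow> f j < m" "\<And>j. j < r \<Longrightarrow> g j < m" "j < r"
  shows "f j = g j"
  using assms
proof (induction r)
  case (Suc r)
  have less: "enc r f < m ^ r" "enc r g < m ^ r" using Suc.prems(2,3) by (simp_all add: enc_less)
  have eq: "f r * m ^ r + enc r f = g r * m ^ r + enc r g"
    using Suc.prems(1) by (simp add: enc_def add.commute)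
  have div: "(a * m ^ r + b) div m ^ r = a \<and> (a * m ^ r + b) mod m ^ r = b" if b: "b < m ^ r" for a b
  proof -
    have "m ^ r \<noteq> 0" using b by (intro notI) simp
    then have "(a * m ^ r + b) div m ^ r = a + b div m ^ r" by (rule div_mult_self3)
    then show ?thesis using b by simp
  qed
  have "f r = g r" "enc r f = enc r g"
    using div[OF less(1), of "f r"] div[OF less(2), of "g r"] unfolding eq by auto
  then show ?case using Suc.IH Suc.prems by (cases "j = r") simp_all
qed simp

definition digits :: "nat \<Rightarrow> (nat \<Rightarrow> nat) \<Rightarrow> store \<Rightarrow> bool" where
  "digits r f \<sigma> \<longleftrightarrow> loaded \<sigma> \<and> \<sigma> ''q'' 0 = int r \<and> \<sigma> ''sel'' (- 1) = - 1 \<and>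
     (\<forall>j<r. \<sigma> ''sel'' (int j) = int (f j) \<and> f j < m)"

lemma digits_cong:
  assumes "digits r f \<sigma>"
    "\<And>z. z \<in> {''n'', ''m'', ''tail'', ''head'', ''weight'', ''vulnerable'', ''s'', ''t'', ''k'', ''l'', ''q'', ''sel''}
      \<Longrightarrow> \<tau> z = \<sigma> z"
  shows "digits r f \<tau>"
  using assms by (simp add: digits_def loaded_def)

lemma digits_upd:
  "digits r f \<sigma> \<Longrightarrow> z \<notin> {''n'', ''m'', ''tail'', ''head'', ''weight'', ''vulnerable'', ''s'', ''t'', ''k'', ''l'', ''q'', ''sel''}
    \<Longrightarrow> digits r f (\<sigma>(z := h))"
  by (rule digits_cong, assumption, rule fun_upd_other, rule notI) simp

lemma loaded_upd:
  "loaded \<sigma> \<Longrightarrow> z \<notin> {''n'', ''m'', ''tail'', ''head'', ''weight'', ''vulnerable'', ''s'', ''t'', ''k'', ''l''}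
    \<Longrightarrow> loaded (\<sigma>(z := h))"
  by (rule loaded_cong, assumption, rule fun_upd_other, rule notI) simp

lemma runs_Clear:
  assumes load: "loaded \<sigma>" and d: "\<sigma> ''d'' 0 = int r" and r: "r \<le> m"
  shows "runs Clear \<sigma> (16 * r + 16) (digits r (\<lambda>_. 0))"
proof -
  define Inv where "Inv k \<tau> \<longleftrightarrow> loaded \<tau> \<and> \<tau> ''q'' 0 = int r \<and> \<tau> ''sel'' (- 1) = - 1 \<and>
    (\<forall>j<k. \<tau> ''sel'' (int j) = 0)" for k and \<tau> :: store
  let ?c = "Assign ''sel'' (Var ''z'') (Num 0)"
  have loop: "runs (For ''z'' ''q'' ?c) \<tau> (r * (4 + 12) + 9)
      (\<lambda>\<rho>. Inv r \<rho> \<and> agree (insert ''z'' (writes ?c)) \<tau> \<rho>)" if "Inv 0 \<tau>" for \<tau>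
  proof (rule runs_For_const)
    show "\<tau> ''q'' 0 = int r" using that by (simp add: Inv_def)
    show "Inv 0 \<tau>" by fact
    show "Inv k (\<rho>(''z'' := f))" if "Inv k \<rho>" for k \<rho> f using that by (simp add: Inv_def loaded_upd)
    fix k \<rho> assume k: "k < r" and inv: "Inv k \<rho>" and z: "\<rho> ''z'' 0 = int k"
    show "runs ?c \<rho> 4 (Inv (Suc k))"
      by (rule runs_Assign_at[of "Inv (Suc k)" _ _ "int k" 0])
        (use inv z in \<open>simp_all add: Inv_def loaded_upd less_Suc_eq\<close>)
  qed simp_all
  define \<sigma>1 where "\<sigma>1 = \<sigma>(''q'' := (\<sigma> ''q'')(0 := int r))"
  define \<sigma>2 where "\<sigma>2 = \<sigma>1(''sel'' := (\<sigma>1 ''sel'')(- 1 := - 1))"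
  have "Inv 0 \<sigma>2" using load by (simp add: Inv_def \<sigma>2_def \<sigma>1_def loaded_upd)
  note loop = loop[OF this]
  have "runs (Seq (Assign ''sel'' (Num (- 1)) (Num (- 1))) (For ''z'' ''q'' ?c)) \<sigma>1 (16 * r + 12)
      (\<lambda>\<rho>. Inv r \<rho> \<and> agree (insert ''z'' (writes ?c)) \<sigma>2 \<rho>)"
    by (rule runs_Seq_Assign_at[OF loop[unfolded \<sigma>2_def], folded \<sigma>2_def]) simp_all
  then have "runs Clear \<sigma> (16 * r + 16) (\<lambda>\<rho>. Inv r \<rho> \<and> agree (insert ''z'' (writes ?c)) \<sigma>2 \<rho>)"
    unfolding Clear_def \<sigma>1_def by (rule runs_Seq_Assign_at) (simp_all add: d)
  \<comment> \<open>If there is any digit at all, \<open>r \<le> m\<close> makes \<open>m\<close>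
    positive, so that 0 is a legal digit.\<close>
  then show ?thesis by (rule runs_mono) (use r in \<open>auto simp: Inv_def digits_def\<close>)
qed

definition admissible :: "nat \<Rightarrow> (nat \<Rightarrow> nat) \<Rightarrow> bool" where
  "admissible r f \<longleftrightarrow> (\<forall>z<r. es ! f z \<in> vulnerable I \<and> (0 < z \<longrightarrow> f (z - 1) < f z))"

lemma runs_Test:
  assumes dig: "digits r f \<sigma>"
  shows "runs Test \<sigma> (41 * r + 12) (\<lambda>\<tau>. \<tau> ''valid'' 0 = of_bool (admissible r f))"
proof -
  define Inv where "Inv k \<tau> \<longleftrightarrow> digits r f \<tau> \<and> \<tau> ''valid'' 0 = of_bool (admissible k f)" for k and \<tau> :: store
  let ?b = "And (Eq (Cell ''vulnerable'' (Cell ''sel'' (Var ''z''))) (Num 1))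
      (Less (Cell ''sel'' (Minus (Var ''z'') (Num 1))) (Cell ''sel'' (Var ''z'')))"
  let ?c = "If ?b Skip (Set ''valid'' (Num 0))"
  have loop: "runs (For ''z'' ''q'' ?c) \<tau> (r * (29 + 12) + 9)
      (\<lambda>\<rho>. Inv r \<rho> \<and> agree (insert ''z'' (writes ?c)) \<tau> \<rho>)" if "Inv 0 \<tau>" for \<tau>
  proof (rule runs_For_const)
    show "\<tau> ''q'' 0 = int r" using that by (simp add: Inv_def digits_def)
    show "Inv 0 \<tau>" by fact
    show "Inv k (\<rho>(''z'' := h))" if "Inv k \<rho>" for k \<rho> h using that by (simp add: Inv_def digits_upd)
    fix k \<rho> assume k: "k < r" and inv: "Inv k \<rho>" and z: "\<rho> ''z'' 0 = int k"
    have fk: "\<rho> ''sel'' (int k) = int (f k)" "f k < m" using inv k by (simp_all add: Inv_def digits_def)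
    have vul: "\<rho> ''vulnerable'' (int (f k)) = of_bool (es ! f k \<in> vulnerable I)"
      using inv fk(2) by (simp add: Inv_def digits_def loaded_def)
    \<comment> \<open>For \<open>k = 0\<close> the predecessor is the sentinel \<open>- 1\<close>,
      which is below every digit, so the comparison imposes nothing on the first digit.\<close>
    have prev: "\<rho> ''sel'' (int k - 1) < int (f k) \<longleftrightarrow> (0 < k \<longrightarrow> f (k - 1) < f k)"
    proof (cases k)
      case 0
      then show ?thesis using inv by (simp add: Inv_def digits_def)
    next
      case (Suc l)
      then have "int k - 1 = int l" by simp
      then show ?thesis using inv k Suc by (simp add: Inv_def digits_def)
    qed
    have b: "bval ?b \<rho> \<longleftrightarrow> es ! f k \<in> vulnerable I \<and> (0 < k \<longrightarrow> f (k - 1) < f k)"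
      using z fk vul prev by simp
    have adm: "admissible (Suc k) f \<longleftrightarrow> admissible k f \<and> bval ?b \<rho>"
      unfolding b admissible_def less_Suc_eq by blast
    show "runs ?c \<rho> 29 (Inv (Suc k))"
    proof (rule runs_If[where T = 3])
      assume "bval ?b \<rho>"
      then have "Inv (Suc k) \<rho>" using inv adm by (simp add: Inv_def)
      then show "runs Skip \<rho> 3 (Inv (Suc k))" by - (rule runs_Skip, assumption, simp)
    next
      assume "\<not> bval ?b \<rho>"
      then have no: "\<not> admissible (Suc k) f" using adm by blast
      show "runs (Set ''valid'' (Num 0)) \<rho> 3 (Inv (Suc k))"
        by (rule runs_Assign_at[of "Inv (Suc k)" _ _ 0 0])
          (use inv no in \<open>simp_all add: Inv_def digits_upd\<close>)
    qed simp
  qed simp_all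
  have "Inv 0 (\<sigma>(''valid'' := (\<sigma> ''valid'')(0 := 1)))"
    using dig by (simp add: Inv_def digits_upd admissible_def)
  from loop[OF this] have "runs Test \<sigma> (3 + (r * (29 + 12) + 9))
      (\<lambda>\<rho>. Inv r \<rho> \<and> agree (insert ''z'' (writes ?c)) (\<sigma>(''valid'' := (\<sigma> ''valid'')(0 := 1))) \<rho>)"
    unfolding Test_def by (rule runs_Seq_Assign_at) simp_all
  then show ?thesis by (rule runs_mono) (simp_all add: Inv_def)
qed

text \<open>\<open>step k g b\<close>: the lowest \<open>k\<close> digits of \<open>g\<close>,
  together with the carry \<open>b\<close> into place \<open>k\<close>, represent the successor of
  the lowest \<open>k\<close> digits of \<open>f\<close>, and the higher digits are untouched. A
  carry out of the last place means that \<open>f\<close> was the last reading, for which nothing is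
  claimed about the value of \<open>g\<close>.\<close>

lemma runs_Increment:
  assumes dig: "digits r f \<sigma>"
  shows "runs Increment \<sigma> (44 * r + 12)
    (\<lambda>\<tau>. \<exists>g. digits r g \<tau> \<and> (Suc (enc r f) < m ^ r \<longrightarrow> enc r g = Suc (enc r f)))"
proof -
  define step where "step k g b \<longleftrightarrow> enc k g + (if b then m ^ k else 0) = Suc (enc k f) \<and>
    (\<forall>j\<ge>k. g j = f j)" for k g b
  define Inv where "Inv k \<tau> \<longleftrightarrow> (\<exists>g b. digits r g \<tau> \<and> \<tau> ''carry'' 0 = of_bool b \<and> step k g b)"
    for k and \<tau> :: store
  let ?i = "Seq (Assign ''sel'' (Var ''z'') (Plus (Cell ''sel'' (Var ''z'')) (Num 1))) (Set ''carry'' (Num 0))"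
  let ?l = "Less (Plus (Cell ''sel'' (Var ''z'')) (Num 1)) (Var ''m'')"
  let ?d = "If ?l ?i (Assign ''sel'' (Var ''z'') (Num 0))"
  let ?c = "If (Eq (Var ''carry'') (Num 1)) ?d Skip"
  have loop: "runs (For ''z'' ''q'' ?c) \<tau> (r * (32 + 12) + 9)
      (\<lambda>\<rho>. Inv r \<rho> \<and> agree (insert ''z'' (writes ?c)) \<tau> \<rho>)" if inv0: "Inv 0 \<tau>" for \<tau>
  proof (rule runs_For_const)
    show "\<tau> ''q'' 0 = int r" using inv0 by (auto simp: Inv_def digits_def)
    show "Inv 0 \<tau>" by fact
    show "Inv k (\<rho>(''z'' := h))" if "Inv k \<rho>" for k \<rho> h
    proof -
      obtain g b where "digits r g \<rho>" "\<rho> ''carry'' 0 = of_bool b" "step k g b"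
        using \<open>Inv k \<rho>\<close> unfolding Inv_def by blast
      then show ?thesis unfolding Inv_def by (intro exI[of _ g] exI[of _ b]) (simp add: digits_upd)
    qed
    fix k \<rho> assume k: "k < r" and inv: "Inv k \<rho>" and z: "\<rho> ''z'' 0 = int k"
    obtain g b where g: "digits r g \<rho>" and b: "\<rho> ''carry'' 0 = of_bool b" and st: "step k g b"
      using inv unfolding Inv_def by blast
    have gk: "g k = f k" using st by (simp add: step_def)
    have sel: "\<rho> ''sel'' (int k) = int (f k)" "f k < m" and m: "\<rho> ''m'' 0 = int m"
      using g k gk by (auto simp: digits_def loaded_def)
    have enc_upd: "enc (Suc k) (g(k := a)) = enc k g + a * m ^ k" for a
      unfolding enc_def by simp
    have enc_Suc: "enc (Suc k) h = enc k h + h k * m ^ k" for h by (simp add: enc_def)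
    have dig_upd: "digits r (g(k := a)) (\<rho>(''sel'' := (\<rho> ''sel'')(int k := int a)))" if "a < m" for a
      using g that by (simp add: digits_def loaded_def)
    have other: "\<forall>j\<ge>Suc k. (g(k := a)) j = f j" for a using st by (simp add: step_def)
    show "runs ?c \<rho> 32 (Inv (Suc k))"
    proof (rule runs_If[where T = 20])
      assume "bval (Eq (Var ''carry'') (Num 1)) \<rho>"
      then have "b" using b by (cases b) simp_all
      then have sum: "enc k g + m ^ k = Suc (enc k f)" using st by (simp add: step_def)
      show "runs ?d \<rho> 20 (Inv (Suc k))"
      proof (rule runs_If[where T = 11])
        assume "bval ?l \<rho>"
        then have less: "f k + 1 < m" using z sel m by simp
        define \<rho>1 where "\<rho>1 = \<rho>(''sel'' := (\<rho> ''sel'')(int k := int (f k + 1)))"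
        define \<rho>2 where "\<rho>2 = \<rho>1(''carry'' := (\<rho>1 ''carry'')(0 := 0))"
        have "digits r (g(k := f k + 1)) \<rho>2"
          unfolding \<rho>2_def \<rho>1_def by (intro digits_upd dig_upd less) simp
        moreover have "step (Suc k) (g(k := f k + 1)) False"
          using sum other[of "f k + 1"] unfolding step_def enc_upd enc_Suc[of f] by simp
        ultimately have Q: "Inv (Suc k) \<rho>2"
          unfolding Inv_def by (intro exI[of _ "g(k := f k + 1)"] exI[of _ False]) (simp add: \<rho>2_def)
        have "runs (Set ''carry'' (Num 0)) \<rho>1 3 (Inv (Suc k))"
          by (rule runs_Assign_at[of "Inv (Suc k)" \<rho>1 "''carry''" 0 0, OF Q[unfolded \<rho>2_def]]) simp_all
        then show "runs ?i \<rho> 11 (Inv (Suc k))"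
          unfolding \<rho>1_def by (rule runs_Seq_Assign_at) (simp_all add: z sel)
      next
        assume "\<not> bval ?l \<rho>"
        then have "f k + 1 = m" using z sel m by simp
        \<comment> \<open>The digit was \<open>m - 1\<close>, so resetting it to 0 and carrying on
          accounts for the same value.\<close>
        then have "m ^ Suc k = f k * m ^ k + m ^ k" by (metis add_mult_distrib mult_1 power_Suc)
        then have "step (Suc k) (g(k := 0)) True"
          using sum other[of 0] unfolding step_def enc_upd enc_Suc[of f] by simp
        moreover have "digits r (g(k := 0)) (\<rho>(''sel'' := (\<rho> ''sel'')(int k := int 0)))"
          by (rule dig_upd) (use sel(2) in simp)
        ultimately have Q: "Inv (Suc k) (\<rho>(''sel'' := (\<rho> ''sel'')(int k := 0)))"
          unfolding Inv_def using b \<open>b\<close> by (intro exI[of _ "g(k := 0)"] exI[of _ True]) simp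
        show "runs (Assign ''sel'' (Var ''z'') (Num 0)) \<rho> 11 (Inv (Suc k))"
          by (rule runs_Assign_at[of "Inv (Suc k)" \<rho> "''sel''" "int k" 0, OF Q]) (simp_all add: z)
      qed simp
    next
      assume "\<not> bval (Eq (Var ''carry'') (Num 1)) \<rho>"
      then have "\<not> b" using b by (cases b) simp_all
      then have "step (Suc k) g b" using st gk by (simp add: step_def enc_Suc)
      then have "Inv (Suc k) \<rho>" using g b unfolding Inv_def by blast
      then show "runs Skip \<rho> 20 (Inv (Suc k))" by - (rule runs_Skip, assumption, simp)
    qed simp
  qed simp_all
  have "Inv 0 (\<sigma>(''carry'' := (\<sigma> ''carry'')(0 := 1)))"
    unfolding Inv_def using dig
    by (intro exI[of _ f] exI[of _ True]) (simp add: step_def enc_def digits_upd)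
  from loop[OF this] have "runs Increment \<sigma> (3 + (r * (32 + 12) + 9))
      (\<lambda>\<rho>. Inv r \<rho> \<and> agree (insert ''z'' (writes ?c)) (\<sigma>(''carry'' := (\<sigma> ''carry'')(0 := 1))) \<rho>)"
    unfolding Increment_def by (rule runs_Seq_Assign_at) simp_all
  then show ?thesis
  proof (rule runs_mono)
    fix \<rho> assume *: "Inv r \<rho> \<and> agree (insert ''z'' (writes ?c)) (\<sigma>(''carry'' := (\<sigma> ''carry'')(0 := 1))) \<rho>"
    then obtain g b where "digits r g \<rho>" "step r g b" unfolding Inv_def by blast
    then show "\<exists>g. digits r g \<rho> \<and> (Suc (enc r f) < m ^ r \<longrightarrow> enc r g = Suc (enc r f))"
      by (intro exI[of _ g]) (auto simp: step_def split: if_splits)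
  qed simp
qed

definition good :: "nat \<Rightarrow> (nat \<Rightarrow> nat) \<Rightarrow> bool" where
  "good r f \<longleftrightarrow> admissible r f \<and> solvable_with (map (\<lambda>j. es ! f j) [0..<r])"

lemma good_cong: "(\<And>j. j < r \<Longrightarrow> f j = g j) \<Longrightarrow> good r f \<longleftrightarrow> good r g"
proof -
  assume eq: "\<And>j. j < r \<Longrightarrow> f j = g j"
  then have "map (\<lambda>j. es ! f j) [0..<r] = map (\<lambda>j. es ! g j) [0..<r]" by simp
  moreover have "admissible r f \<longleftrightarrow> admissible r g" using eq by (simp add: admissible_def)
  ultimately show ?thesis by (simp only: good_def)
qed

lemma admissible_edges:
  assumes "admissible r f" "\<And>j. j < r \<Longrightarrow> f j < m"
  shows "distinct (map (\<lambda>j. es ! f j) [0..<r])" "set (map (\<lambda>j. es ! f j) [0..<r]) \<subseteq> vulnerable I"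
proof -
  have less: "f i < f j" if "i < j" "j < r" for i j
    using that
  proof (induction j)
    case (Suc j)
    then have "f j < f (Suc j)" using assms(1) by (force simp: admissible_def)
    then show ?case using Suc by (cases "i = j") auto
  qed simp
  have "inj_on (\<lambda>j. es ! f j) {..<r}"
  proof (rule linorder_inj_onI')
    fix i j assume ij: "i \<in> {..<r}" "j \<in> {..<r}" "i < j"
    then have "f i \<noteq> f j" using less[of i j] by simp
    then show "es ! f i \<noteq> es ! f j"
      using ij assms(2) distinct_es length_es by (simp add: nth_eq_iff_index_eq)
  qed
  then show "distinct (map (\<lambda>j. es ! f j) [0..<r])" by (simp add: distinct_map atLeast0LessThan)
  show "set (map (\<lambda>j. es ! f j) [0..<r]) \<subseteq> vulnerable I"
    using assms(1) by (auto simp: admissible_def)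
qed

lemma good_yes: "good r f \<Longrightarrow> ftp_yes I"
  unfolding good_def solvable_with_def ftp_yes_def by blast

text \<open>The positions of the vulnerable edges of \<open>K\<close> in the input, in increasing
  order, form an admissible reading. Its length is exactly the number of these edges, which is what
  lets the search stop at the minimum.\<close>

lemma good_exists:
  assumes "ftp_solution I K"
  shows "\<exists>f. (\<forall>j<card (K \<inter> vulnerable I). f j < m) \<and> good (card (K \<inter> vulnerable I)) f"
proof -
  define r where "r = card (K \<inter> vulnerable I)"
  define xs where "xs = filter (\<lambda>e. es ! e \<in> K \<inter> vulnerable I) [0..<m]"
  have xs: "x < m" "es ! x \<in> K \<inter> vulnerable I" if "x \<in> set xs" for x using that by (auto simp: xs_def)
  have sorted: "sorted_wrt (<) xs" by (simp add: xs_def sorted_wrt_filter)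
  have "inj_on ((!) es) (set xs)"
    using distinct_es length_es by (auto simp: inj_on_def nth_eq_iff_index_eq xs_def)
  moreover have "distinct xs" by (simp add: xs_def)
  ultimately have "distinct (map ((!) es) xs)" by (simp add: distinct_map)
  have set: "set (map ((!) es) xs) = K \<inter> vulnerable I"
  proof (intro equalityI subsetI)
    fix x assume x: "x \<in> K \<inter> vulnerable I"
    then have "x \<in> set es" using parts(1) by blast
    then obtain e where "e < m" "es ! e = x" using length_es by (metis in_set_conv_nth)
    then show "x \<in> set (map ((!) es) xs)" using x by (auto simp: xs_def)
  qed (auto simp: xs_def)
  have len: "length xs = r"
    using distinct_card[OF \<open>distinct (map ((!) es) xs)\<close>] unfolding set r_def by simp
  have map: "map (\<lambda>j. es ! (xs ! j)) [0..<r] = map ((!) es) xs"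
    unfolding len[symmetric] by (rule nth_equalityI) simp_all
  have "admissible r (\<lambda>j. xs ! j)"
    unfolding admissible_def
  proof (intro allI impI conjI)
    fix z assume z: "z < r"
    then show "es ! (xs ! z) \<in> vulnerable I" using xs(2)[of "xs ! z"] len by simp
    assume "0 < z"
    then show "xs ! (z - 1) < xs ! z" using sorted_wrt_nth_less[OF sorted, of "z - 1" z] z len by simp
  qed
  moreover have "solvable_with (map (\<lambda>j. es ! (xs ! j)) [0..<r])"
    unfolding map solvable_with_def set using assms by blast
  ultimately have "good r (\<lambda>j. xs ! j)" by (simp add: good_def)
  moreover have "\<forall>j<r. xs ! j < m" using xs(1) len by simp
  ultimately show ?thesis unfolding r_def by blast
qed

lemma Core_keeps:
  assumes "agree (writes Core) \<sigma> \<tau>"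
    "z \<in> {''n'', ''m'', ''tail'', ''head'', ''weight'', ''vulnerable'', ''s'', ''t'', ''k'', ''l'', ''q'', ''sel'',
      ''M'', ''U'', ''d'', ''g''}"
  shows "\<tau> z = \<sigma> z"
  by (rule agreeD[OF assms(1) contra_subsetD[OF writes_Core]]) (use assms(2) in auto)

lemma runs_Attempt:
  assumes dig: "digits r f \<sigma>"
  shows "runs Attempt \<sigma> (85 * r + 40 + 1000 * 64 ^ (r + 1) * n ^ 3)
    (\<lambda>\<tau>. (\<exists>g. digits r g \<tau> \<and> (Suc (enc r f) < m ^ r \<longrightarrow> enc r g = Suc (enc r f))) \<and>
      \<tau> ''answer'' 0 = (if good r f then 1 else \<sigma> ''answer'' 0))"
proof -
  define a where "a = (if good r f then 1 else \<sigma> ''answer'' 0)"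
  define R1 where "R1 \<tau> \<longleftrightarrow> digits r f \<tau> \<and> \<tau> ''valid'' 0 = of_bool (admissible r f) \<and>
    \<tau> ''answer'' 0 = \<sigma> ''answer'' 0" for \<tau> :: store
  define R2 where "R2 \<tau> \<longleftrightarrow> digits r f \<tau> \<and> \<tau> ''answer'' 0 = a" for \<tau> :: store
  let ?T = "1000 * 64 ^ (r + 1) * n ^ 3"
  have wT: "writes Test = {''z'', ''valid''}" and wI: "writes Increment = {''z'', ''carry'', ''sel''}"
    by (auto simp: Test_def Increment_def)
  have 1: "runs Test \<sigma> (41 * r + 12) R1"
  proof (rule runs_mono[OF runs_frame[OF runs_Test[OF dig]]])
    fix \<tau> assume *: "\<tau> ''valid'' 0 = of_bool (admissible r f) \<and> agree (writes Test) \<sigma> \<tau>"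
    then have same: "\<tau> z = \<sigma> z" if "z \<notin> {''z'', ''valid''}" for z using that by (simp add: agree_def wT)
    have "digits r f \<tau>" by (rule digits_cong[OF dig], rule same) auto
    then show "R1 \<tau>" using * same by (simp add: R1_def)
  qed simp
  have 2: "runs (If (Eq (Var ''valid'') (Num 1)) Core Skip) \<tau> (?T + 12) R2" if R: "R1 \<tau>" for \<tau>
  proof (rule runs_If[where T = ?T])
    have dig': "digits r f \<tau>" using R by (simp add: R1_def)
    then have load: "loaded \<tau>" and fm: "\<And>j. j < r \<Longrightarrow> f j < m" by (simp_all add: digits_def)
    {
      assume "bval (Eq (Var ''valid'') (Num 1)) \<tau>"
      then have adm: "admissible r f" using R by (simp add: R1_def split: if_splits)
      let ?vs = "map (\<lambda>j. es ! f j) [0..<r]"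
      have "runs Core \<tau> (1000 * 64 ^ (length ?vs + 1) * n ^ 3)
          (\<lambda>\<rho>. \<rho> ''answer'' 0 = (if solvable_with ?vs then 1 else \<tau> ''answer'' 0))"
      proof (rule runs_Core_input[OF load admissible_edges[OF adm fm]])
        show "\<tau> ''q'' 0 = int (length ?vs)" using dig' by (simp add: digits_def)
        show "\<exists>e<m. \<tau> ''sel'' (int j) = int e \<and> es ! e = ?vs ! j" if "j < length ?vs" for j
          using dig' that by (intro exI[of _ "f j"]) (simp add: digits_def)
      qed simp
      note core = runs_frame[OF this]
      show "runs Core \<tau> ?T R2"
      proof (rule runs_mono[OF core])
        fix \<rho> assume *: "\<rho> ''answer'' 0 = (if solvable_with ?vs then 1 else \<tau> ''answer'' 0) \<and>
          agree (writes Core) \<tau> \<rho>"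
        have "digits r f \<rho>"
          by (rule digits_cong[OF dig'], rule Core_keeps[OF conjunct2[OF *]]) auto
        then show "R2 \<rho>" using * R adm by (simp add: R2_def R1_def a_def good_def)
      qed simp
    }
    assume "\<not> bval (Eq (Var ''valid'') (Num 1)) \<tau>"
    then have "\<not> admissible r f" using R by (auto simp: R1_def)
    then have "R2 \<tau>" using R by (simp add: R2_def R1_def a_def good_def)
    moreover have "1 \<le> ?T" using n_positive by (simp add: Suc_le_eq)
    ultimately show "runs Skip \<tau> ?T R2" by (rule runs_Skip)
  qed simp
  have 3: "runs Increment \<tau> (44 * r + 12)
      (\<lambda>\<rho>. (\<exists>g. digits r g \<rho> \<and> (Suc (enc r f) < m ^ r \<longrightarrow> enc r g = Suc (enc r f))) \<and> \<rho> ''answer'' 0 = a)"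
    if R: "R2 \<tau>" for \<tau>
  proof -
    have "digits r f \<tau>" using R by (simp add: R2_def)
    note inc = runs_frame[OF runs_Increment[OF this]]
    show ?thesis by (rule runs_mono[OF inc]) (use R in \<open>simp_all add: R2_def agree_def wI\<close>)
  qed
  have "runs Attempt \<sigma> (41 * r + 12 + (?T + 12 + (44 * r + 12)))
      (\<lambda>\<rho>. (\<exists>g. digits r g \<rho> \<and> (Suc (enc r f) < m ^ r \<longrightarrow> enc r g = Suc (enc r f))) \<and> \<rho> ''answer'' 0 = a)"
    unfolding Attempt_def by (rule runs_Seq[OF 1], rule runs_Seq[OF 2], assumption, rule 3)
  then show ?thesis unfolding a_def by (rule runs_mono) simp_all
qed

lemma runs_Grow:
  assumes load: "loaded \<sigma>" and M: "\<sigma> ''M'' 0 = int (m ^ r)"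
  shows "runs Grow \<sigma> (19 * m + 16) (\<lambda>\<tau>. \<tau> ''M'' 0 = int (m ^ Suc r))"
proof -
  define Inv where "Inv k \<tau> \<longleftrightarrow> \<tau> ''A'' 0 = int (k * m ^ r) \<and> \<tau> ''M'' 0 = int (m ^ r)" for k and \<tau> :: store
  let ?c = "Set ''A'' (Plus (Var ''A'') (Var ''M''))"
  define \<sigma>1 where "\<sigma>1 = \<sigma>(''A'' := (\<sigma> ''A'')(0 := 0))"
  have "runs (For ''z'' ''m'' ?c) \<sigma>1 (m * (7 + 12) + 9)
      (\<lambda>\<rho>. Inv m \<rho> \<and> agree (insert ''z'' (writes ?c)) \<sigma>1 \<rho>)"
  proof (rule runs_For_const)
    show "\<sigma>1 ''m'' 0 = int m" using load by (simp add: \<sigma>1_def loaded_def)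
    show "Inv 0 \<sigma>1" using M by (simp add: Inv_def \<sigma>1_def)
    show "Inv k (\<rho>(''z'' := h))" if "Inv k \<rho>" for k \<rho> h using that by (simp add: Inv_def)
    fix k \<rho> assume inv: "Inv k \<rho>"
    show "runs ?c \<rho> 7 (Inv (Suc k))"
      by (rule runs_Assign_at[of "Inv (Suc k)" _ _ 0 "int (Suc k * m ^ r)"])
        (use inv in \<open>simp_all add: Inv_def algebra_simps\<close>)
  qed simp_all
  note loop = this
  have last: "runs (Set ''M'' (Var ''A'')) \<tau> 4 (\<lambda>\<tau>. \<tau> ''M'' 0 = int (m ^ Suc r))"
    if "Inv m \<tau> \<and> agree (insert ''z'' (writes ?c)) \<sigma>1 \<tau>" for \<tau>
    by (rule runs_Assign_at[of _ _ _ 0 "int (m ^ Suc r)"]) (use that in \<open>simp_all add: Inv_def\<close>)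
  have "runs (Seq (For ''z'' ''m'' ?c) (Set ''M'' (Var ''A''))) \<sigma>1 (m * (7 + 12) + 9 + 4)
      (\<lambda>\<tau>. \<tau> ''M'' 0 = int (m ^ Suc r))"
    by (rule runs_Seq[OF loop last])
  then show ?thesis
    unfolding Grow_def \<sigma>1_def by (rule runs_Seq_Assign_at) simp_all
qed

definition round_time :: "nat \<Rightarrow> nat" where
  "round_time r = 16 * r + 16 +
     (m ^ r * (85 * r + 40 + 1000 * 64 ^ (r + 1) * n ^ 3 + 12) + 9 + (19 * m + 16))"

text \<open>In iteration \<open>k\<close> the odometer shows the reading with code \<open>k\<close>.
  As codes determine readings and are below \<open>m ^ r\<close>, the \<open>m ^ r\<close>
  iterations miss no reading. For \<open>r = 0\<close> there is one reading, the empty one, even if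
  \<open>m = 0\<close>.\<close>

lemma runs_Round:
  assumes load: "loaded \<sigma>" and d: "\<sigma> ''d'' 0 = int r" and r: "r \<le> m"
    and M: "\<sigma> ''M'' 0 = int (m ^ r)" and ans: "\<sigma> ''answer'' 0 = 0"
  shows "runs Round \<sigma> (round_time r) (\<lambda>\<tau>. loaded \<tau> \<and> \<tau> ''M'' 0 = int (m ^ Suc r) \<and>
    \<tau> ''answer'' 0 = of_bool (\<exists>f. (\<forall>j<r. f j < m) \<and> good r f))"
proof -
  define tried where "tried k \<longleftrightarrow> (\<exists>f. (\<forall>j<r. f j < m) \<and> enc r f < k \<and> good r f)" for k
  \<comment> \<open>The code is prescribed only for \<open>k < m ^ r\<close>: after the last
    iteration the odometer has wrapped around.\<close>
  define Inv where "Inv k \<tau> \<longleftrightarrow> (\<exists>f. digits r f \<tau> \<and> (k < m ^ r \<longrightarrow> enc r f = k)) \<and>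
    \<tau> ''answer'' 0 = of_bool (tried k) \<and> \<tau> ''M'' 0 = int (m ^ r)" for k and \<tau> :: store
  have 1: "runs Clear \<sigma> (16 * r + 16) (Inv 0)"
  proof (rule runs_mono[OF runs_frame[OF runs_Clear[OF load d r]]])
    fix \<tau> assume *: "digits r (\<lambda>_. 0) \<tau> \<and> agree (writes Clear) \<sigma> \<tau>"
    have "''answer'' \<notin> writes Clear" "''M'' \<notin> writes Clear" by (simp_all add: Clear_def)
    then have "\<tau> ''answer'' 0 = 0" "\<tau> ''M'' 0 = int (m ^ r)" using * ans M by (simp_all add: agree_def)
    moreover have "enc r (\<lambda>_. 0) = 0" by (simp add: enc_def)
    ultimately show "Inv 0 \<tau>"
      unfolding Inv_def using * by (intro conjI exI[of _ "\<lambda>_. 0"]) (simp_all add: tried_def)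
  qed simp
  have 2: "runs (For ''g'' ''M'' Attempt) \<tau> (m ^ r * (85 * r + 40 + 1000 * 64 ^ (r + 1) * n ^ 3 + 12) + 9)
      (\<lambda>\<rho>. Inv (m ^ r) \<rho> \<and> agree (insert ''g'' (writes Attempt)) \<tau> \<rho>)" if "Inv 0 \<tau>" for \<tau>
  proof (rule runs_For_const)
    have keep: "z \<notin> writes Attempt" if "z \<in> {''g'', ''M''}" for z
    proof -
      have "z \<notin> writes Core" by (rule contra_subsetD[OF writes_Core]) (use that in auto)
      then show ?thesis using that by (auto simp: Attempt_def Test_def Increment_def)
    qed
    show "\<tau> ''M'' 0 = int (m ^ r)" using that by (simp add: Inv_def)
    show "Inv 0 \<tau>" by fact
    show "''g'' \<notin> writes Attempt" "''M'' \<notin> writes Attempt" by (simp_all add: keep)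
    show "Inv k (\<rho>(''g'' := h))" if inv: "Inv k \<rho>" for k \<rho> h
    proof -
      obtain f where "digits r f \<rho>" "k < m ^ r \<longrightarrow> enc r f = k" using inv unfolding Inv_def by blast
      moreover from this(1) have "digits r f (\<rho>(''g'' := h))" by (rule digits_upd) simp
      ultimately have "\<exists>f. digits r f (\<rho>(''g'' := h)) \<and> (k < m ^ r \<longrightarrow> enc r f = k)" by blast
      then show ?thesis using inv by (simp add: Inv_def)
    qed
    fix k \<rho> assume k: "k < m ^ r" and inv: "Inv k \<rho>"
    obtain f where f: "digits r f \<rho>" "enc r f = k" using inv k unfolding Inv_def by blast
    have fm: "f j < m" if "j < r" for j using f(1) that by (simp add: digits_def)
    have tried: "tried (Suc k) \<longleftrightarrow> tried k \<or> good r f"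
    proof
      assume "tried (Suc k)"
      then obtain h where h: "\<forall>j<r. h j < m" "enc r h < Suc k" "good r h" unfolding tried_def by blast
      show "tried k \<or> good r f"
      proof (cases "enc r h < k")
        case True
        then show ?thesis using h unfolding tried_def by blast
      next
        case False
        then have "enc r h = enc r f" using h(2) f(2) by simp
        then have "h j = f j" if "j < r" for j using enc_inj[of r h f j] h(1) fm that by blast
        then show ?thesis using h(3) good_cong[of r h f] by blast
      qed
    next
      assume "tried k \<or> good r f"
      then show "tried (Suc k)"
      proof
        assume "tried k"
        then show ?thesis unfolding tried_def using less_SucI by blast
      next
        assume "good r f"
        then show ?thesis unfolding tried_def using f(2) fm by (intro exI[of _ f]) simp
      qed
    qed
    show "runs Attempt \<rho> (85 * r + 40 + 1000 * 64 ^ (r + 1) * n ^ 3) (Inv (Suc k))"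
    proof (rule runs_mono[OF runs_frame[OF runs_Attempt[OF f(1)]]])
      fix \<pi> assume *: "((\<exists>g. digits r g \<pi> \<and> (Suc (enc r f) < m ^ r \<longrightarrow> enc r g = Suc (enc r f))) \<and>
          \<pi> ''answer'' 0 = (if good r f then 1 else \<rho> ''answer'' 0)) \<and> agree (writes Attempt) \<rho> \<pi>"
      have "\<pi> ''M'' = \<rho> ''M''" by (rule agreeD[OF conjunct2[OF *] keep]) simp
      then have "\<pi> ''M'' 0 = int (m ^ r)" using inv by (simp add: Inv_def)
      moreover have "\<pi> ''answer'' 0 = of_bool (tried (Suc k))"
        using conjunct2[OF conjunct1[OF *]] inv unfolding Inv_def tried by simp
      moreover obtain g where "digits r g \<pi>" "Suc k < m ^ r \<longrightarrow> enc r g = Suc k"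
        using conjunct1[OF conjunct1[OF *]] unfolding f(2) by blast
      ultimately show "Inv (Suc k) \<pi>" unfolding Inv_def by (intro conjI exI[of _ g])
    qed simp
  qed simp
  have 3: "runs Grow \<tau> (19 * m + 16) (\<lambda>\<tau>. loaded \<tau> \<and> \<tau> ''M'' 0 = int (m ^ Suc r) \<and>
      \<tau> ''answer'' 0 = of_bool (tried (m ^ r)))"
    if "Inv (m ^ r) \<tau> \<and> agree (insert ''g'' (writes Attempt)) \<rho> \<tau>" for \<tau> \<rho>
  proof -
    have load': "loaded \<tau>" and M': "\<tau> ''M'' 0 = int (m ^ r)" and ans': "\<tau> ''answer'' 0 = of_bool (tried (m ^ r))"
      using that unfolding Inv_def digits_def by blast+
    show ?thesis
    proof (rule runs_mono[OF runs_frame[OF runs_Grow[OF load' M']]])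
      fix \<pi> assume *: "\<pi> ''M'' 0 = int (m ^ Suc r) \<and> agree (writes Grow) \<tau> \<pi>"
      have same: "\<pi> z = \<tau> z" if "z \<notin> {''z'', ''A'', ''M''}" for z
        using agreeD[OF conjunct2[OF *], of z] that by (simp add: Grow_def)
      have "loaded \<pi>" by (rule loaded_cong[OF load'], rule same) auto
      moreover have "\<pi> ''answer'' 0 = \<tau> ''answer'' 0" using same[of "''answer''"] by simp
      ultimately show "loaded \<pi> \<and> \<pi> ''M'' 0 = int (m ^ Suc r) \<and> \<pi> ''answer'' 0 = of_bool (tried (m ^ r))"
        using * ans' by simp
    qed simp
  qed
  have "tried (m ^ r) \<longleftrightarrow> (\<exists>f. (\<forall>j<r. f j < m) \<and> good r f)"
  proof
    assume "\<exists>f. (\<forall>j<r. f j < m) \<and> good r f"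
    then obtain f where "\<forall>j<r. f j < m" "good r f" by blast
    then show "tried (m ^ r)" unfolding tried_def using enc_less[of r f] by (intro exI[of _ f]) simp
  qed (auto simp: tried_def)
  moreover have "runs Round \<sigma> (round_time r) (\<lambda>\<tau>. loaded \<tau> \<and> \<tau> ''M'' 0 = int (m ^ Suc r) \<and>
      \<tau> ''answer'' 0 = of_bool (tried (m ^ r)))"
    unfolding Round_def round_time_def
    by (rule runs_Seq[OF 1], rule runs_Seq[OF 2], assumption, rule 3)
  ultimately show ?thesis by simp
qed

lemma finite_vulnerable: "finite (vulnerable I)"
  by (rule finite_subset[of _ "set es"]) (use parts(1) in auto)

lemma card_solution_le: "card (K \<inter> vulnerable I) \<le> num_vulnerable I"
  unfolding num_vulnerable_def by (intro card_mono finite_vulnerable) simp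

lemma num_vulnerable_le: "num_vulnerable I \<le> m"
proof -
  have "card (vulnerable I) \<le> card (set es)" by (intro card_mono) (use parts(1) in auto)
  then show ?thesis using distinct_card[OF distinct_es] length_es by (simp add: num_vulnerable_def)
qed

lemma min_vulnerable_attained:
  assumes "ftp_yes I"
  shows "\<exists>K. ftp_solution I K \<and> card (K \<inter> vulnerable I) = min_vulnerable I"
proof -
  have "\<exists>j K. ftp_solution I K \<and> j = card (K \<inter> vulnerable I)" using assms by (auto simp: ftp_yes_def)
  from LeastI_ex[OF this] show ?thesis using assms by (auto simp: min_vulnerable_def)
qed

lemma min_vulnerable_le: "min_vulnerable I \<le> num_vulnerable I"
  using min_vulnerable_attained card_solution_le by (metis min_vulnerable_def order_refl)

text \<open>The hypothesis \<open>q \<le> m\<close> ensures \<open>1 \<le> m ^ q\<close>: for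
  \<open>m = 0\<close> it leaves only \<open>0 ^ 0 = 1\<close>. Inside the loop the coefficients 85,
  40, 1000 and 12 sum to 1137; the work outside adds 76, which keeps the total below 1300.\<close>

lemma round_time_le:
  assumes r: "r \<le> q" and q: "q \<le> m"
  shows "round_time r \<le> 1300 * (m ^ q * (64 ^ (q + 1) * n ^ 3))" "m \<le> m ^ q * (64 ^ (q + 1) * n ^ 3)"
    "1 \<le> m ^ q * (64 ^ (q + 1) * n ^ 3)"
proof -
  define E where "E = 64 ^ (q + 1) * n ^ 3"
  have pos: "m ^ r \<le> m ^ q \<and> 1 \<le> m ^ q"
  proof (cases "m = 0")
    case True
    then show ?thesis using r q by simp
  next
    case False
    then show ?thesis using r by (simp add: power_increasing Suc_le_eq)
  qed
  have n3: "n ^ 3 = n * (n * n)" by (simp add: power3_eq_cube)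
  have "1 \<le> n ^ 3" using n_positive by (simp add: Suc_le_eq)
  have "1 * (n * n) \<le> n * (n * n)" using n_positive by (intro mult_le_mono1) simp
  then have "m \<le> n ^ 3" using m_le n3 by linarith
  moreover have "1 * n ^ 3 \<le> E" unfolding E_def by (intro mult_le_mono1) simp
  ultimately have mE: "m \<le> E" and oneE: "1 \<le> E" using \<open>1 \<le> n ^ 3\<close> by linarith+
  have EB: "E \<le> m ^ q * E" using mult_le_mono1[of 1 "m ^ q" E] pos by simp
  have "r \<le> m" using r q by simp
  have "(64::nat) ^ (r + 1) \<le> 64 ^ (q + 1)" using r by (intro power_increasing) simp_all
  then have "64 ^ (r + 1) * n ^ 3 \<le> E" unfolding E_def by (rule mult_le_mono1)
  then have "85 * r + 40 + 1000 * (64 ^ (r + 1) * n ^ 3) + 12 \<le> 1137 * E"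
    using \<open>r \<le> m\<close> mE oneE by linarith
  then have "m ^ r * (85 * r + 40 + 1000 * (64 ^ (r + 1) * n ^ 3) + 12) \<le> m ^ q * (1137 * E)"
    using pos by (intro mult_le_mono) auto
  also have "\<dots> = 1137 * (m ^ q * E)" by simp
  finally have main: "m ^ r * (85 * r + 40 + 1000 * 64 ^ (r + 1) * n ^ 3 + 12) \<le> 1137 * (m ^ q * E)"
    by (simp only: mult.assoc)
  show "round_time r \<le> 1300 * (m ^ q * (64 ^ (q + 1) * n ^ 3))"
    unfolding round_time_def E_def[symmetric] using main EB mE oneE \<open>r \<le> m\<close> by linarith
  show "m \<le> m ^ q * (64 ^ (q + 1) * n ^ 3)" "1 \<le> m ^ q * (64 ^ (q + 1) * n ^ 3)"
    unfolding E_def[symmetric] using EB mE oneE by linarith+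
qed

lemma Round_keeps: "z \<in> {''U'', ''d''} \<Longrightarrow> z \<notin> writes Round"
proof -
  assume z: "z \<in> {''U'', ''d''}"
  have "z \<notin> writes Core" by (rule contra_subsetD[OF writes_Core]) (use z in auto)
  then show ?thesis
    using z by (auto simp: Round_def Clear_def Attempt_def Test_def Increment_def Grow_def)
qed

text \<open>As long as the answer is 0, no solution has fewer than \<open>k\<close> vulnerable
  edges. So rounds take place only for \<open>k \<le> q\<close>, and on a no-instance
  \<open>q\<close> is the number of all vulnerable edges. There are at most \<open>q + 1\<close>
  rounds, and \<open>q + 1 \<le> 64 ^ (q + 1)\<close> turns the base 64 of one round into
  \<open>64 * 64 = 4096\<close>.\<close>

lemma runs_Search:
  assumes load: "loaded \<sigma>" and ans: "\<sigma> ''answer'' 0 = 0"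
  shows "runs Search \<sigma> (1500 * 4096 ^ (min_vulnerable I + 1) * m ^ min_vulnerable I * n ^ 3)
    (\<lambda>\<tau>. \<tau> ''answer'' 0 = of_bool (ftp_yes I))"
proof -
  define u where "u = num_vulnerable I"
  define q where "q = min_vulnerable I"
  define B where "B = m ^ q * (64 ^ (q + 1) * n ^ 3)"
  have qu: "q \<le> u" and um: "u \<le> m" using min_vulnerable_le num_vulnerable_le by (simp_all add: q_def u_def)
  define Inv where "Inv k \<tau> \<longleftrightarrow> loaded \<tau> \<and>
    (\<tau> ''answer'' 0 = 1 \<and> ftp_yes I \<or> \<tau> ''answer'' 0 = 0 \<and> \<tau> ''M'' 0 = int (m ^ k) \<and>
      (\<forall>K. ftp_solution I K \<longrightarrow> k \<le> card (K \<inter> vulnerable I)))" for k and \<tau> :: store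
  \<comment> \<open>An iteration beyond \<open>q\<close> finds the answer set and skips the round,
    so a constant covers it.\<close>
  let ?T = "\<lambda>k. (if k \<le> q then 1300 * B else 0) + 20"
  let ?c = "If (Eq (Var ''answer'') (Num 0)) Round Skip"
  have loop: "runs (For ''d'' ''U'' ?c) \<tau> ((\<Sum>k<u + 1. ?T k) + 12 * (u + 1) + 9)
      (\<lambda>\<rho>. Inv (u + 1) \<rho> \<and> agree (insert ''d'' (writes ?c)) \<tau> \<rho>)"
    if inv0: "Inv 0 \<tau>" and U: "\<tau> ''U'' 0 = int (u + 1)" for \<tau>
  proof (rule runs_For)
    show "\<tau> ''U'' 0 = int (u + 1)" by fact
    show "Inv 0 \<tau>" by fact
    show "''d'' \<notin> writes ?c" "''U'' \<notin> writes ?c" by (simp_all add: Round_keeps)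
    show "Inv k (\<rho>(''d'' := h))" if "Inv k \<rho>" for k \<rho> h using that by (simp add: Inv_def loaded_upd)
    fix k \<rho> assume k: "k < u + 1" and inv: "Inv k \<rho>" and d: "\<rho> ''d'' 0 = int k"
    show "runs ?c \<rho> (?T k) (Inv (Suc k))"
    proof (cases "\<rho> ''answer'' 0 = 0")
      case False
      then have "Inv (Suc k) \<rho>" using inv by (simp add: Inv_def)
      have "runs ?c \<rho> 20 (Inv (Suc k))"
      proof (rule runs_If[where T = 1])
        show "runs Skip \<rho> 1 (Inv (Suc k))"
          using \<open>Inv (Suc k) \<rho>\<close> by - (rule runs_Skip, assumption, simp)
      qed (use False in simp_all)
      then show ?thesis by (rule runs_mono) simp_all
    next
      case True
      then have M: "\<rho> ''M'' 0 = int (m ^ k)" and load': "loaded \<rho>"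
        and large: "\<And>K. ftp_solution I K \<Longrightarrow> k \<le> card (K \<inter> vulnerable I)"
        using inv by (simp_all add: Inv_def)
      \<comment> \<open>On a yes-instance a solution with \<open>q\<close> vulnerable edges exists
        and the invariant applies to it; otherwise \<open>q\<close> is the largest size
        tried.\<close>
      have "k \<le> q"
      proof (cases "ftp_yes I")
        case True
        then show ?thesis using min_vulnerable_attained large unfolding q_def by metis
      next
        case False
        then show ?thesis using k by (simp add: q_def u_def min_vulnerable_def)
      qed
      then have time: "round_time k \<le> 1300 * B" unfolding B_def by (rule round_time_le) (use qu um in simp)
      have km: "k \<le> m" using k um by simp
      have "runs ?c \<rho> (1300 * B + 20) (Inv (Suc k))"
      proof (rule runs_If[where T = "1300 * B"])
        show "runs Round \<rho> (1300 * B) (Inv (Suc k))"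
        proof (rule runs_mono[OF runs_Round[OF load' d km M True] time])
          fix \<pi> assume *: "loaded \<pi> \<and> \<pi> ''M'' 0 = int (m ^ Suc k) \<and>
            \<pi> ''answer'' 0 = of_bool (\<exists>f. (\<forall>j<k. f j < m) \<and> good k f)"
          show "Inv (Suc k) \<pi>"
          proof (cases "\<exists>f. (\<forall>j<k. f j < m) \<and> good k f")
            case True
            then have "ftp_yes I" using good_yes by blast
            then show ?thesis using * True by (simp add: Inv_def)
          next
            case False
            have "Suc k \<le> card (K \<inter> vulnerable I)" if K: "ftp_solution I K" for K
            proof -
              have "card (K \<inter> vulnerable I) \<noteq> k" using good_exists[OF K] False by auto
              then show ?thesis using large[OF K] by simp
            qed
            moreover have "\<pi> ''answer'' 0 = 0" using * False by simp
            ultimately show ?thesis using * unfolding Inv_def by blast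
          qed
        qed
      qed (use True in simp_all)
      then show ?thesis using \<open>k \<le> q\<close> by simp
    qed
  qed simp
  define R where "R \<tau> \<longleftrightarrow> loaded \<tau> \<and> \<tau> ''answer'' 0 = 0 \<and> \<tau> ''q'' 0 = int u" for \<tau> :: store
  have gather: "runs Gather \<sigma> (37 * m + 12) R"
    by (rule runs_mono[OF runs_Gather[OF load]]) (simp_all add: R_def u_def ans)
  have rest: "runs (Seq (Set ''U'' (Plus (Var ''q'') (Num 1))) (Seq (Set ''M'' (Num 1)) (For ''d'' ''U'' ?c))) \<tau>
      (6 + (3 + ((\<Sum>k<u + 1. ?T k) + 12 * (u + 1) + 9))) (\<lambda>\<rho>. \<rho> ''answer'' 0 = of_bool (ftp_yes I))"
    if R: "R \<tau>" for \<tau>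
  proof -
    define \<tau>1 where "\<tau>1 = \<tau>(''U'' := (\<tau> ''U'')(0 := int (u + 1)))"
    define \<tau>2 where "\<tau>2 = \<tau>1(''M'' := (\<tau>1 ''M'')(0 := 1))"
    have "Inv 0 \<tau>2" "\<tau>2 ''U'' 0 = int (u + 1)"
      using R by (simp_all add: Inv_def R_def \<tau>2_def \<tau>1_def loaded_upd)
    then have "runs (For ''d'' ''U'' ?c) \<tau>2 ((\<Sum>k<u + 1. ?T k) + 12 * (u + 1) + 9)
      (\<lambda>\<rho>. Inv (u + 1) \<rho> \<and> agree (insert ''d'' (writes ?c)) \<tau>2 \<rho>)" by (rule loop)
    then have "runs (For ''d'' ''U'' ?c) \<tau>2 ((\<Sum>k<u + 1. ?T k) + 12 * (u + 1) + 9)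
      (\<lambda>\<rho>. \<rho> ''answer'' 0 = of_bool (ftp_yes I))"
    proof (rule runs_mono)
      fix \<rho> assume "Inv (u + 1) \<rho> \<and> agree (insert ''d'' (writes ?c)) \<tau>2 \<rho>"
      then have inv: "Inv (u + 1) \<rho>" by blast
      have "\<not> ftp_yes I" if none: "\<forall>K. ftp_solution I K \<longrightarrow> u + 1 \<le> card (K \<inter> vulnerable I)"
      proof
        assume "ftp_yes I"
        then obtain K where "ftp_solution I K" by (auto simp: ftp_yes_def)
        then show False using none card_solution_le[of K] unfolding u_def by fastforce
      qed
      then show "\<rho> ''answer'' 0 = of_bool (ftp_yes I)" using inv unfolding Inv_def by auto
    qed simp
    then have "runs (Seq (Set ''M'' (Num 1)) (For ''d'' ''U'' ?c)) \<tau>1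
        (3 + ((\<Sum>k<u + 1. ?T k) + 12 * (u + 1) + 9)) (\<lambda>\<rho>. \<rho> ''answer'' 0 = of_bool (ftp_yes I))"
      unfolding \<tau>2_def by (rule runs_Seq_Assign_at) simp_all
    then show ?thesis
      unfolding \<tau>1_def by (rule runs_Seq_Assign_at) (use R in \<open>simp_all add: R_def\<close>)
  qed
  have "runs Search \<sigma> (37 * m + 12 + (6 + (3 + ((\<Sum>k<u + 1. ?T k) + 12 * (u + 1) + 9))))
      (\<lambda>\<rho>. \<rho> ''answer'' 0 = of_bool (ftp_yes I))"
    unfolding Search_def by (rule runs_Seq[OF gather rest])
  then show ?thesis
  proof (rule runs_mono)
    have B: "m \<le> B" "1 \<le> B" unfolding B_def using round_time_le(2,3)[of q q] qu um by simp_all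
    have "(\<Sum>k<N. ?T k) \<le> (q + 1) * (1300 * B) + N * 20" for N
    proof -
      have "(\<Sum>k<N. if k \<le> q then 1300 * B else 0) = card ({..<N} \<inter> {k. k \<le> q}) * (1300 * B)"
        by (simp add: sum.If_cases)
      also have "\<dots> \<le> card {..q} * (1300 * B)" by (intro mult_le_mono1 card_mono) auto
      finally show ?thesis by (simp only: sum.distrib) simp
    qed
    from this[of "u + 1"] have "(\<Sum>k<u + 1. ?T k) \<le> (q + 1) * (1300 * B) + (u + 1) * 20" .
    moreover define C where "C = (q + 1) * B"
    moreover define D where "D = (\<Sum>k<u + 1. ?T k)"
    ultimately have D: "D \<le> 1300 * C + (u + 1) * 20" by simp
    have "B \<le> C" by (simp add: C_def)
    then have C: "m \<le> C" "1 \<le> C" using B by (auto intro: le_trans)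
    have u: "u \<le> C" by (rule le_trans[OF um C(1)])
    have "37 * m + 12 + (6 + (3 + (D + 12 * (u + 1) + 9))) = D + (37 * m + 12 * u + 42)" by simp
    also have "\<dots> \<le> (1300 * C + (u + 1) * 20) + (37 * m + 12 * u + 42)" by (rule add_right_mono[OF D])
    also have "\<dots> = 1300 * C + (37 * m + (32 * u + 62 * 1))" by (simp only: algebra_simps)
    also have "\<dots> \<le> 1300 * C + (37 * C + (32 * C + 62 * C))"
      by (intro add_mono mult_le_mono2 order_refl C u)
    also have "\<dots> = 1431 * C" by simp
    also have "\<dots> \<le> 1500 * C" by (rule mult_le_mono1) simp
    finally have "37 * m + 12 + (6 + (3 + (D + 12 * (u + 1) + 9))) \<le> 1500 * C" .
    then have "37 * m + 12 + (6 + (3 + ((\<Sum>k<u + 1. ?T k) + 12 * (u + 1) + 9))) \<le> 1500 * ((q + 1) * B)"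
      unfolding C_def D_def .
    also have "(q + 1) * B \<le> 64 ^ (q + 1) * B"
    proof (rule mult_le_mono1)
      have "q + 1 < 2 ^ (q + 1)" by (rule less_exp)
      also have "(2::nat) ^ (q + 1) \<le> 64 ^ (q + 1)" by (intro power_mono) simp_all
      finally show "q + 1 \<le> 64 ^ (q + 1)" by simp
    qed
    also have "64 ^ (q + 1) * B = 4096 ^ (q + 1) * m ^ q * n ^ 3"
    proof -
      have "(64::nat) ^ (q + 1) * 64 ^ (q + 1) = 4096 ^ (q + 1)" by (simp flip: power_mult_distrib)
      then show ?thesis unfolding B_def by (metis mult.assoc mult.commute)
    qed
    finally show "37 * m + 12 + (6 + (3 + ((\<Sum>k<u + 1. ?T k) + 12 * (u + 1) + 9)))
        \<le> 1500 * 4096 ^ (min_vulnerable I + 1) * m ^ min_vulnerable I * n ^ 3"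
      unfolding q_def[symmetric] by (simp only: mult.assoc)
  qed
qed

end

section \<open>The theorem\<close>

lemma solvesI:
  assumes "\<And>I es. ftp_input I es \<Longrightarrow>
      runs P (encode I es) (T I) (\<lambda>\<tau>. \<tau> ''answer'' 0 = of_bool (ftp_yes I))"
    and "\<And>I. real (T I) \<le> T' I"
  shows "solves_ftp_in_time P T'"
  unfolding solves_ftp_in_time_def
proof (intro allI impI)
  fix I :: "nat ftp" and es
  assume "ftp_instance I \<and> pverts (graph I) = {..<num_verts I} \<and> distinct es \<and> set es = parcs (graph I)"
  then have "ftp_input I es" by unfold_locales auto
  from assms(1)[OF this] obtain t \<tau> where "exec P (encode I es) t \<tau>" "t \<le> T I"
    "\<tau> ''answer'' 0 = of_bool (ftp_yes I)"
    unfolding runs_def by blast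
  moreover have "real t \<le> T' I" using calculation(2) assms(2)[of I] by linarith
  ultimately show "\<exists>t \<tau>. exec P (encode I es) t \<tau> \<and> \<tau> ''answer'' 0 = (if ftp_yes I then 1 else 0) \<and>
      real t \<le> T' I"
    by (intro exI[of _ t] exI[of _ \<tau>]) simp
qed

lemma powr_affine:
  assumes "0 < c"
  shows "2 powr (log 2 c + real d * (real u + 1)) = c * (2 ^ d) ^ (u + 1)"
proof -
  have "2 powr (real d * (real u + 1)) = 2 powr real (d * (u + 1))" by (simp add: algebra_simps)
  also have "\<dots> = 2 ^ (d * (u + 1))" by (rule powr_realpow) simp
  finally show ?thesis using assms by (simp only: powr_add power_mult) simp
qed

text \<open>From \<open>u = 2\<close> on the logarithm is at least 1, so \<open>u log u\<close>
  dominates \<open>u\<close>, while \<open>u + 1 \<le> 2 u\<close>. At 0 and 1 the right-hand side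
  is 0, but the bound is only asymptotic.\<close>

lemma affine_bigo: "(\<lambda>u::nat. a + b * (real u + 1)) \<in> O(\<lambda>u. real u * log 2 (real u))"
proof (rule bigoI)
  show "\<forall>\<^sub>F u in sequentially. norm (a + b * (real u + 1)) \<le> (\<bar>a\<bar> + 2 * \<bar>b\<bar>) * norm (real u * log 2 (real u))"
  proof (rule eventually_sequentiallyI)
    fix u :: nat assume u: "2 \<le> u"
    then have "1 \<le> log 2 (real u)" by simp
    then have "real u * 1 \<le> real u * log 2 (real u)" by (intro mult_left_mono) simp_all
    then have big: "real u \<le> norm (real u * log 2 (real u))" by simp
    have "\<bar>a\<bar> * 1 \<le> \<bar>a\<bar> * real u" using u by (intro mult_left_mono) simp_all
    moreover have "\<bar>b\<bar> * (real u + 1) \<le> \<bar>b\<bar> * (2 * real u)" using u by (intro mult_left_mono) simp_all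
    moreover have "\<bar>b * (real u + 1)\<bar> = \<bar>b\<bar> * (real u + 1)" by (simp add: abs_mult)
    moreover have "norm (a + b * (real u + 1)) \<le> \<bar>a\<bar> + \<bar>b * (real u + 1)\<bar>" by simp
    ultimately have "norm (a + b * (real u + 1)) \<le> (\<bar>a\<bar> + 2 * \<bar>b\<bar>) * real u"
      by (simp add: algebra_simps)
    also have "\<dots> \<le> (\<bar>a\<bar> + 2 * \<bar>b\<bar>) * norm (real u * log 2 (real u))"
      using big by (intro mult_left_mono) simp_all
    finally show "norm (a + b * (real u + 1)) \<le> (\<bar>a\<bar> + 2 * \<bar>b\<bar>) * norm (real u * log 2 (real u))" .
  qed
qed

theorem theorem5:
  shows "(\<exists>P g. g \<in> O(\<lambda>u::nat. real u * log 2 (real u)) \<and>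
            solves_ftp_in_time P (\<lambda>I. 2 powr g (num_vulnerable I) * real (num_verts I) ^ 3)) \<and>
         (\<exists>P g. g \<in> O(\<lambda>q::nat. real q * log 2 (real q)) \<and>
            solves_ftp_in_time P
              (\<lambda>I. 2 powr g (min_vulnerable I) * real (num_edges I) ^ min_vulnerable I
                     * real (num_verts I) ^ 3))"
proof (intro conjI exI)
  have start: "encode I es ''answer'' 0 = 0" for I es by (simp add: encode_def)
  \<comment> \<open>The constant factor 1049 moves into the exponent as its logarithm, and the 6
    comes from \<open>64 = 2 ^ 6\<close>.\<close>
  show "(\<lambda>u. log 2 1049 + real 6 * (real u + 1)) \<in> O(\<lambda>u::nat. real u * log 2 (real u))"
    by (rule affine_bigo)
  show "solves_ftp_in_time (Seq Gather Core)
      (\<lambda>I. 2 powr (log 2 1049 + real 6 * (real (num_vulnerable I) + 1)) * real (num_verts I) ^ 3)"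
  proof (rule solvesI)
    fix I es assume "ftp_input I es"
    then interpret ftp_input I es .
    show "runs (Seq Gather Core) (encode I es) (1049 * 64 ^ (num_vulnerable I + 1) * num_verts I ^ 3)
        (\<lambda>\<tau>. \<tau> ''answer'' 0 = of_bool (ftp_yes I))"
      by (rule runs_mono[OF runs_all[OF loaded_encode]]) (simp_all add: start)
  next
    show "real (1049 * 64 ^ (num_vulnerable I + 1) * num_verts I ^ 3)
        \<le> 2 powr (log 2 1049 + real 6 * (real (num_vulnerable I) + 1)) * real (num_verts I) ^ 3" for I
      by (subst powr_affine) simp_all
  qed
  \<comment> \<open>Likewise for 1500 and \<open>4096 = 2 ^ 12\<close>; the factor
    \<open>m ^ q\<close> stays outside the exponent.\<close>
  show "(\<lambda>q. log 2 1500 + real 12 * (real q + 1)) \<in> O(\<lambda>q::nat. real q * log 2 (real q))"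
    by (rule affine_bigo)
  show "solves_ftp_in_time Search
      (\<lambda>I. 2 powr (log 2 1500 + real 12 * (real (min_vulnerable I) + 1))
        * real (num_edges I) ^ min_vulnerable I * real (num_verts I) ^ 3)"
  proof (rule solvesI)
    fix I es assume "ftp_input I es"
    then interpret ftp_input I es .
    show "runs Search (encode I es)
        (1500 * 4096 ^ (min_vulnerable I + 1) * num_edges I ^ min_vulnerable I * num_verts I ^ 3)
        (\<lambda>\<tau>. \<tau> ''answer'' 0 = of_bool (ftp_yes I))"
      by (rule runs_Search[OF loaded_encode start])
  next
    show "real (1500 * 4096 ^ (min_vulnerable I + 1) * num_edges I ^ min_vulnerable I * num_verts I ^ 3)
        \<le> 2 powr (log 2 1500 + real 12 * (real (min_vulnerable I) + 1))
          * real (num_edges I) ^ min_vulnerable I * real (num_verts I) ^ 3" for I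
      by (subst powr_affine) simp_all
  qed
qed

end
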